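(* Let $n$ be a positive integer with $\gcd(n,6)=1$, and suppose there exists a prime $p\equiv 2\pmod 3$ such that $\mathrm{ord}_p(n)$ is odd. Let $c_n=0$ if $n\equiv 1\pmod 3$, and let $c_n\in\{1,2\}$ (either choice) if $n\equiv 2\pmod 3$. Then \[ \sum_{\substack{r\in\mathbb{Z},\ |r|<\sqrt n,\\ r\equiv c_n\pmod 3}}H(n-r^2)=\frac{\sigma(n)}{12}, \] where $\sigma(n)=\sum_{d\mid n}d$.
   Context: $H(N)$ denotes the Hurwitz class number: for an integer $N\ge 0$, $H(0)=-1/12$; $H(N)=0$ if $N\equiv 1,2\pmod 4$; otherwise $H(N)$ is the number of $\mathrm{SL}_2(\mathbb{Z})$-equivalence classes of (not necessarily primitive) positive definite binary quadratic forms of discriminant $-N$, where classes containing a multiple of $x^2+y^2$ are counted with weight $1/2$ and classes containing a multiple of $x^2+xy+y^2$ are counted with weight $1/3$. $\mathrm{ord}_p(n)$ is the exponent of $p$ in the factorization of $n$. The sum runs over all integers $r$ (positive, negative and zero) satisfying the stated conditions. *)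

theory Defs
  imports Complex_Main "HOL-Computational_Algebra.Primes"
begin

text \<open>Binary quadratic forms a x^2 + b x y + c y^2 are represented by triples (a,b,c).\<close>
type_synonym qform = "int \<times> int \<times> int"

definition pd_forms :: "int \<Rightarrow> qform set" where
  "pd_forms N = {(a,b,c). b^2 - 4*a*c = -N \<and> a > 0}"

text \<open>The form f(p x + q y, r x + s y).\<close>
definition form_act :: "qform \<Rightarrow> int \<Rightarrow> int \<Rightarrow> int \<Rightarrow> int \<Rightarrow> qform" where
  "form_act f p q r s = (case f of (a,b,c) \<Rightarrow>
     (a*p^2 + b*p*r + c*r^2, 2*a*p*q + b*(p*s + q*r) + 2*c*r*s, a*q^2 + b*q*s + c*s^2))"

definition sl2_equiv :: "int \<Rightarrow> (qform \<times> qform) set" where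
  "sl2_equiv N = {(f,g). f \<in> pd_forms N \<and> g \<in> pd_forms N \<and>
      (\<exists>p q r s. p*s - q*r = 1 \<and> g = form_act f p q r s)}"

definition class_weight :: "qform set \<Rightarrow> real" where
  "class_weight C = (if \<exists>k. (k,0,k) \<in> C then 1/2
                     else if \<exists>k. (k,k,k) \<in> C then 1/3 else 1)"

text \<open>Hurwitz class number H(N) for N \<ge> 0 (value 0 for N < 0, never used).\<close>
definition hurwitz :: "int \<Rightarrow> real" where
  "hurwitz N = (if N = 0 then -1/12
     else if N < 0 \<or> N mod 4 = 1 \<or> N mod 4 = 2 then 0
     else (\<Sum>C \<in> pd_forms N // sl2_equiv N. class_weight C))"

end

theory Submission
  imports Defs "HOL-Number_Theory.Number_Theory"
begin

text \<open>
  (1) Counted with weight 2, or 1 if one of $u,v,w$ vanishes, the triples $u,v,w \ge 0$ of equal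
  parity with $uv+vw+wu=N$ number $6H(N)$ for $3 \nmid N$. Writing $N=4n-t^2$,
  these triples for all $t$ become integer points $ac+xy=n$, $t=x+y$, in one cone. Cutting the cone by
  signs and moving the pieces with unimodular substitutions gives a class number relation for
  $\sum H(4n-t^2)$ over those $t$ with $4n-t^2\equiv 1 \pmod 3$.
  (2) The number of elements of norm $n$ in a maximal order of the quaternion algebra ramified at
  $3,\infty$ is $12\sigma(n)$, and sorting them by the trace $t$ of an element shows that
  $r(N)=\#\{3z^2+4(x^2-xy+y^2)=N\}$ satisfies the same relation as $12H(N)$; the terms with the smallest
  $|t|$ are determined by the others, so $12H(N)=r(N)$ for $N\equiv 1\pmod 3$ by induction.
  (3) Hence 12 times the required sum counts the quaternions $q\equiv 1\pmod 2$ of norm $n$ whose residue modulo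
  the prime above 3 has a prescribed first coordinate. For $n\equiv 2$ this is settled by $q\mapsto -q$. For
  $n\equiv 1$ write $n=p^k l$ with $p^k\equiv l\equiv 2\pmod 3$, factor $q=gs$ with $g$ of norm $p^k$ and
  replace $g$ by its conjugate: this exchanges first coordinate 0 and first coordinate different from 0.
\<close>

section \<open>Sums over the points of ac + xy = n\<close>

text \<open>The restriction to \<open>N = 1\<close> (mod 3) is forced: 3 is then inert in
  Q(sqrt(-N)), whereas for \<open>N = 2\<close> (mod 3) it splits and \<open>tern N\<close> is
  empty, so no identity \<open>12 H = r\<close> could hold. Hence a relation over only part of the
  traces is needed. That restriction is also the obstacle: the unimodular moves preserve
  \<open>a c + x y\<close> but not the residue of \<open>x + y\<close>, so the pieces come back with
  other linear forms inside \<open>ind\<close> and do not cancel by themselves. The auxiliary weight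
  \<open>auxw\<close> repairs this. On the other hand the restriction removes all degenerate forms,
  since \<open>-s^2\<close> is never 1 (mod 3), and all forms of weight 1/3, whose discriminant is
  \<open>-3 k^2\<close>.

  The hypothesis on \<open>p\<close> gives coprime factors that are both 2 (mod 3). Elements of such
  norms have residues in F_9 with both coordinates nonzero, which is why conjugating one factor
  always changes whether the first coordinate of the product is 0.\<close>

type_synonym region = "int \<Rightarrow> int \<Rightarrow> int \<Rightarrow> int \<Rightarrow> bool"

text \<open>A point is the integer matrix with rows \<open>(x, -a)\<close> and
  \<open>(c, y)\<close>: determinant \<open>n\<close>, trace \<open>x + y\<close>, associated form
  \<open>(a, y - x, c)\<close> of discriminant \<open>(x + y)^2 - 4 n\<close>.\<close>

definition qset :: "int \<Rightarrow> region \<Rightarrow> (int \<times> int \<times> int \<times> int) set" where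
  "qset n C = {(a,c,x,y). C a c x y \<and> a*c + x*y = n}"

definition qsum :: "int \<Rightarrow> region \<Rightarrow> (int \<Rightarrow> int \<Rightarrow> int \<Rightarrow> int \<Rightarrow> int) \<Rightarrow> int" where
  "qsum n C h = (\<Sum>(a,c,x,y)\<in>qset n C. h a c x y)"

text \<open>Made for boundary terms: on a face where a linear relation holds between the
  coordinates, \<open>a c + x y = n\<close> factors as \<open>d e = n\<close> and one free parameter
  \<open>z\<close> is left.\<close>

definition dsum :: "int \<Rightarrow> (int \<Rightarrow> int \<Rightarrow> int \<Rightarrow> bool) \<Rightarrow> (int \<Rightarrow> int \<Rightarrow> int \<Rightarrow> int) \<Rightarrow> int" where
  "dsum n C g = (\<Sum>(d,e,z)\<in>{(d,e,z). d > 0 \<and> e > 0 \<and> d*e = n \<and> C d e z}. g d e z)"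

lemma int_prod_bound:
  fixes a c m :: int assumes "a > 0" "c > 0" "a*c \<le> m" shows "a \<le> m" "c \<le> m"
  using assms mult_left_mono[of 1 c a] mult_right_mono[of 1 a c] by linarith+

lemma finite_qset:
  assumes "\<And>a c x y. C a c x y \<Longrightarrow> a > 0 \<and> c > 0 \<and> x > 0 \<and> y > 0"
  shows "finite (qset n C)"
proof (rule finite_subset)
  show "qset n C \<subseteq> {0..n} \<times> {0..n} \<times> {0..n} \<times> {0..n}"
  proof (clarsimp simp: qset_def)
    fix a c x y assume "C a c x y" 
    then have p: "a > 0" "c > 0" "x > 0" "y > 0" using assms by blast+
    then have "a*c > 0" "x*y > 0" by simp_all
    then show "0 \<le> a \<and> a \<le> a*c+x*y \<and> 0 \<le> c \<and> c \<le> a*c+x*y \<and> 0 \<le> x \<and> x \<le> a*c+x*y \<and> 0 \<le> y \<and> y \<le> a*c+x*y"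
      using p int_prod_bound[of a c "a*c+x*y"] int_prod_bound[of x y "a*c+x*y"] by linarith
  qed
qed simp

lemma qsum_cong:
  assumes "\<And>a c x y. a*c+x*y = n \<Longrightarrow> C a c x y \<longleftrightarrow> D a c x y" "\<And>a c x y. a*c+x*y = n \<Longrightarrow> D a c x y \<Longrightarrow> h a c x y = k a c x y"
  shows "qsum n C h = qsum n D k"
  unfolding qsum_def by (rule sum.cong) (use assms in \<open>auto simp: qset_def\<close>)

lemma qsum_disjoint:
  assumes "finite (qset n C)" "\<And>a c x y. C a c x y \<longleftrightarrow> A a c x y \<or> B a c x y" "\<And>a c x y. A a c x y \<Longrightarrow> \<not> B a c x y"
  shows "qsum n C h = qsum n A h + qsum n B h"
proof -
  have eq: "qset n C = qset n A \<union> qset n B" using assms(2) by (auto simp: qset_def)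
  then have "finite (qset n A)" "finite (qset n B)" using assms(1) by auto
  then show ?thesis unfolding qsum_def eq
    by (rule sum.union_disjoint) (use assms(3) in \<open>auto simp: qset_def\<close>)
qed

lemma qsum_split:
  assumes "finite (qset n C)"
  shows "qsum n C h = qsum n (\<lambda>a c x y. C a c x y \<and> D a c x y) h + qsum n (\<lambda>a c x y. C a c x y \<and> \<not> D a c x y) h"
  by (rule qsum_disjoint[OF assms]) auto

lemmas qsum_disjoint_pos = qsum_disjoint[OF finite_qset]

lemma qsum_add: "qsum n C (\<lambda>a c x y. h a c x y + k a c x y) = qsum n C h + qsum n C k"
  by (simp add: qsum_def sum.distrib case_prod_beta)
lemma qsum_diff: "qsum n C (\<lambda>a c x y. h a c x y - k a c x y) = qsum n C h - qsum n C k"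
  by (simp add: qsum_def sum_subtractf case_prod_beta)
lemma qsum_cmult: "qsum n C (\<lambda>a c x y. m * h a c x y) = m * qsum n C h"
  by (simp add: qsum_def sum_distrib_left case_prod_beta)
lemma qsum_zero: "qsum n C (\<lambda>a c x y. 0) = 0"
  by (simp add: qsum_def case_prod_beta)

section \<open>Unimodular moves between regions of positive points\<close>

abbreviation pos4 :: region where
  "pos4 a c x y \<equiv> a > 0 \<and> c > 0 \<and> x > 0 \<and> y > 0"
abbreviation regZ where "regZ a c x y \<equiv> pos4 a c x y \<and> a > x \<and> c > x"
abbreviation regP0 where "regP0 a c x y \<equiv> pos4 a c x y \<and> a < x \<and> c < x \<and> x < a + c + y"
abbreviation regQ where "regQ a c x y \<equiv> pos4 a c x y \<and> x > a + c + y"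

lemma qsum_swap: "qsum n (\<lambda>a c x y. pos4 a c x y \<and> x > a) h = qsum n (\<lambda>a c x y. pos4 a c x y \<and> a > x) (\<lambda>a c x y. h x y a c)"
  unfolding qsum_def
  by (rule sum.reindex_bij_witness[where i="\<lambda>(a,c,x,y). (x,y,a,c)" and j="\<lambda>(a,c,x,y). (x,y,a,c)"])
     (auto simp: qset_def algebra_simps)

lemma qsum_Z1: "qsum n (\<lambda>a c x y. pos4 a c x y \<and> a > x \<and> x > c) h = qsum n regZ (\<lambda>a c x y. h (y+a) x a (c-x))"
  unfolding qsum_def
  by (rule sum.reindex_bij_witness[where i="\<lambda>(a,c,x,y). (y+a,x,a,c-x)" and j="\<lambda>(a,c,x,y). (x,y+c,c,a-x)"])
     (auto simp: qset_def algebra_simps)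

lemma qsum_Z2: "qsum n (\<lambda>a c x y. pos4 a c x y \<and> x > a \<and> c > x) h = qsum n regZ (\<lambda>a c x y. h x (y+a) a (c-x))"
  unfolding qsum_def
  by (rule sum.reindex_bij_witness[where i="\<lambda>(a,c,x,y). (x,y+a,a,c-x)" and j="\<lambda>(a,c,x,y). (x,y+a,a,c-x)"])
     (auto simp: qset_def algebra_simps)

lemma qsum_Q: "qsum n regQ h = qsum n regZ (\<lambda>a c x y. h (a-x) (c-x) (y+a+c-x) x)"
  unfolding qsum_def
  by (rule sum.reindex_bij_witness[where i="\<lambda>(a,c,x,y). (a-x,c-x,y+a+c-x,x)" and j="\<lambda>(a,c,x,y). (a+y,c+y,y,x-a-c-y)"])
     (auto simp: qset_def algebra_simps)

lemma qsum_mirror_Z: "qsum n regZ h = qsum n regZ (\<lambda>a c x y. h c a x y)"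
  unfolding qsum_def
  by (rule sum.reindex_bij_witness[where i="\<lambda>(a,c,x,y). (c,a,x,y)" and j="\<lambda>(a,c,x,y). (c,a,x,y)"])
     (auto simp: qset_def algebra_simps)

lemma qsum_mirror_P0: "qsum n regP0 h = qsum n regP0 (\<lambda>a c x y. h c a x y)"
  unfolding qsum_def
  by (rule sum.reindex_bij_witness[where i="\<lambda>(a,c,x,y). (c,a,x,y)" and j="\<lambda>(a,c,x,y). (c,a,x,y)"])
     (auto simp: qset_def algebra_simps)

lemma qsum_rot_P0: "qsum n regP0 h = qsum n regP0 (\<lambda>a c x y. h (a+c-x+y) a (a+y) (x-a))"
  unfolding qsum_def
  by (rule sum.reindex_bij_witness[where i="\<lambda>(a,c,x,y). (a+c-x+y,a,a+y,x-a)" and j="\<lambda>(a,c,x,y). (c,a+c-x+y,c+y,x-c)"])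
     (auto simp: qset_def algebra_simps)

lemma tie_x_eq_c_gt: "qsum n (\<lambda>a c x y. pos4 a c x y \<and> a > x \<and> x = c) h = dsum n (\<lambda>d e z. d < z \<and> z < e) (\<lambda>d e z. h z d d (e-z))"
  unfolding qsum_def dsum_def
  by (rule sum.reindex_bij_witness[where i="\<lambda>(d,e,z). (z,d,d,e-z)" and j="\<lambda>(a,c,x,y). (c,a+y,a)"])
     (auto simp: qset_def algebra_simps)

lemma tie_x_eq_c_lt: "qsum n (\<lambda>a c x y. pos4 a c x y \<and> x > a \<and> c = x) h = dsum n (\<lambda>d e z. 0 < z \<and> z < d \<and> z < e) (\<lambda>d e z. h z d d (e-z))"
  unfolding qsum_def dsum_def
  by (rule sum.reindex_bij_witness[where i="\<lambda>(d,e,z). (z,d,d,e-z)" and j="\<lambda>(a,c,x,y). (c,a+y,a)"])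
     (auto simp: qset_def algebra_simps)

lemma tie_d_zero: "qsum n (\<lambda>a c x y. pos4 a c x y \<and> x = a + c + y) h = dsum n (\<lambda>d e z. 0 < z \<and> z < d \<and> z < e) (\<lambda>d e z. h (d-z) (e-z) (d+e-z) z)"
  unfolding qsum_def dsum_def
  by (rule sum.reindex_bij_witness[where i="\<lambda>(d,e,z). (d-z,e-z,d+e-z,z)" and j="\<lambda>(a,c,x,y). (a+y,c+y,y)"])
     (auto simp: qset_def algebra_simps)

text \<open>Exchanging \<open>(a,c)\<close> with \<open>(x,y)\<close> matches \<open>x > a\<close>
  with \<open>a > x\<close>. When both sides are cut by the remaining comparisons, every open piece
  except \<open>regP0\<close> is a unimodular copy of \<open>regZ\<close>. As \<open>h\<close> is
  arbitrary, a weight on \<open>regP0\<close> can be chosen for the sake of its image on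
  \<open>regZ\<close>.\<close>

lemma qsum_P0:
  "qsum n regP0 h = qsum n regZ (\<lambda>a c x y. h x y a c + h a (c-x) (y+a) x - h x (y+a) a (c-x) - h (a-x) (c-x) (y+a+c-x) x)
     + dsum n (\<lambda>d e z. d < z \<and> z < e) (\<lambda>d e z. h d (e-z) z d)
     - dsum n (\<lambda>d e z. 0 < z \<and> z < d \<and> z < e) (\<lambda>d e z. h z d d (e-z))
     - dsum n (\<lambda>d e z. 0 < z \<and> z < d \<and> z < e) (\<lambda>d e z. h (d-z) (e-z) (d+e-z) z)"
proof -
  let ?h = "\<lambda>a c x y. h x y a c"
  have "qsum n (\<lambda>a c x y. pos4 a c x y \<and> x > a) h
      = qsum n (\<lambda>a c x y. pos4 a c x y \<and> x > a \<and> c > x) h + qsum n (\<lambda>a c x y. pos4 a c x y \<and> x > a \<and> x \<ge> c) h"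
    by (rule qsum_disjoint_pos) auto
  moreover have "qsum n (\<lambda>a c x y. pos4 a c x y \<and> x > a \<and> x \<ge> c) h
      = qsum n (\<lambda>a c x y. pos4 a c x y \<and> x > a \<and> c = x) h + qsum n (\<lambda>a c x y. pos4 a c x y \<and> x > a \<and> x > c) h"
    by (rule qsum_disjoint_pos) auto
  moreover have "qsum n (\<lambda>a c x y. pos4 a c x y \<and> x > a \<and> x > c) h
      = qsum n regP0 h + qsum n (\<lambda>a c x y. pos4 a c x y \<and> x \<ge> a + c + y) h"
    by (rule qsum_disjoint_pos) auto
  moreover have "qsum n (\<lambda>a c x y. pos4 a c x y \<and> x \<ge> a + c + y) h
      = qsum n (\<lambda>a c x y. pos4 a c x y \<and> x = a + c + y) h + qsum n regQ h"
    by (rule qsum_disjoint_pos) auto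
  moreover have "qsum n (\<lambda>a c x y. pos4 a c x y \<and> a > x) ?h
      = qsum n regZ ?h + qsum n (\<lambda>a c x y. pos4 a c x y \<and> a > x \<and> x \<ge> c) ?h"
    by (rule qsum_disjoint_pos) auto
  moreover have "qsum n (\<lambda>a c x y. pos4 a c x y \<and> a > x \<and> x \<ge> c) ?h
      = qsum n (\<lambda>a c x y. pos4 a c x y \<and> a > x \<and> x = c) ?h + qsum n (\<lambda>a c x y. pos4 a c x y \<and> a > x \<and> x > c) ?h"
    by (rule qsum_disjoint_pos) auto
  ultimately show ?thesis
    unfolding qsum_swap qsum_Z1 qsum_Z2 qsum_Q tie_x_eq_c_gt tie_x_eq_c_lt tie_d_zero qsum_add qsum_diff by linarith
qed

text \<open>For $3 \nmid n$ this is the indicator of $4n - t^2 \equiv 1 \pmod 3$.\<close>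
definition ind :: "int \<Rightarrow> int \<Rightarrow> int" where
  "ind n t = (if n mod 3 = 1 then of_bool (3 dvd t) else of_bool (\<not> 3 dvd t))"

abbreviation trace_ind :: "int \<Rightarrow> int \<Rightarrow> int \<Rightarrow> int \<Rightarrow> int \<Rightarrow> int" where
  "trace_ind n \<equiv> \<lambda>a c x y. ind n (x+y)"

lemma ind_cong: "[s = t] (mod 3) \<Longrightarrow> ind n s = ind n t"
  by (auto simp: ind_def cong_dvd_iff)

lemma ind_minus: "ind n (- t) = ind n t"
  by (simp add: ind_def)

lemma mod3_cases: "(a::int) mod 3 \<in> {0,1,2}"
  by auto

text \<open>
  The coefficients solve a linear system: they make the defect below change sign under
  the exchange of $a$ and $c$, which is a finite check modulo 3.
\<close>
definition auxw :: "int \<Rightarrow> int \<Rightarrow> int \<Rightarrow> int \<Rightarrow> int \<Rightarrow> int" where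
  "auxw n a c x y = 2 * ind n (a+c-x) - 2 * ind n (x+y) + 2 * ind n (x+y+c) - 2 * ind n (x+y+a)
      + ind n (x+y-c) - 2 * ind n (x+y-a) + ind n (a+c+x)"

lemma auxw_cong:
  assumes "[a = a'] (mod 3)" "[c = c'] (mod 3)" "[x = x'] (mod 3)" "[y = y'] (mod 3)"
  shows "auxw n a c x y = auxw n a' c' x' y'"
  unfolding auxw_def
  by (intro arg_cong2[where f="(+)"] arg_cong2[where f="(-)"] arg_cong2[where f="(*)"] refl ind_cong cong_add cong_diff assms)

text \<open>The image of \<open>auxw\<close> under \<open>qsum_P0\<close>, plus 6 times the trace
  weight on \<open>regZ\<close>, minus 6 times the trace weight on \<open>regQ\<close> carried over
  by \<open>qsum_Q\<close>. The factors 6 are those of \<open>ties_collect\<close>.\<close>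

definition auxd :: "int \<Rightarrow> int \<Rightarrow> int \<Rightarrow> int \<Rightarrow> int \<Rightarrow> int" where
  "auxd n a c x y = auxw n x y a c + auxw n a (c-x) (y+a) x - auxw n x (y+a) a (c-x) - auxw n (a-x) (c-x) (y+a+c-x) x
      + 6 * ind n (x+y) - 6 * ind n (a+c+y)"

lemma auxd_cong:
  assumes "[a = a'] (mod 3)" "[c = c'] (mod 3)" "[x = x'] (mod 3)" "[y = y'] (mod 3)"
  shows "auxd n a c x y = auxd n a' c' x' y'"
  unfolding auxd_def
  by (intro arg_cong2[where f="(+)"] arg_cong2[where f="(-)"] arg_cong2[where f="(*)"] refl ind_cong auxw_cong cong_add cong_diff assms)

lemma auxd_mod: "auxd n a c x y = auxd n (a mod 3) (c mod 3) (x mod 3) (y mod 3)"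
  by (rule auxd_cong) (simp_all add: cong_def)

lemma ind_numerals:
  "ind n 2 = ind n 1" "ind n 3 = ind n 0" "ind n 4 = ind n 1" "ind n 5 = ind n 1" "ind n 6 = ind n 0" "ind n 7 = ind n 1" "ind n 8 = ind n 1" "ind n 9 = ind n 0" "ind n 10 = ind n 1"
  "ind n (-1) = ind n 1" "ind n (-2) = ind n 1" "ind n (-3) = ind n 0" "ind n (-4) = ind n 1" "ind n (-5) = ind n 1" "ind n (-6) = ind n 0"
  by (simp_all add: ind_def)

lemma auxd_cancel_residues:
  assumes "a \<in> {0,1,2}" "c \<in> {0,1,2}" "x \<in> {0,1,2}" "y \<in> {0,1,2}" "\<not> 3 dvd (a*c+x*y)"
  shows "auxd n a c x y + auxd n c a x y = 0"
proof -
  have "a = 0 \<or> a = 1 \<or> a = 2" "c = 0 \<or> c = 1 \<or> c = 2" "x = 0 \<or> x = 1 \<or> x = 2" "y = 0 \<or> y = 1 \<or> y = 2" 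
    using assms by auto
  then show ?thesis using assms(5)
    by (elim disjE; hypsubst; simp add: auxd_def auxw_def ind_numerals)
qed

lemma auxd_cancel:
  assumes "\<not> 3 dvd n" "a*c+x*y = n"
  shows "auxd n a c x y + auxd n c a x y = 0"
proof -
  have "[(a mod 3)*(c mod 3)+(x mod 3)*(y mod 3) = a*c+x*y] (mod 3)"
    by (intro cong_add cong_mult) (simp_all add: cong_def)
  then have "\<not> 3 dvd ((a mod 3)*(c mod 3)+(x mod 3)*(y mod 3))" using assms cong_dvd_iff by blast
  then show ?thesis unfolding auxd_mod[of n a c x y] auxd_mod[of n c a x y]
    by (intro auxd_cancel_residues mod3_cases)
qed

lemma auxd_sum_zero:
  assumes "\<not> 3 dvd n" shows "qsum n regZ (auxd n) = 0"
proof -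
  have "qsum n regZ (auxd n) + qsum n regZ (auxd n) = qsum n regZ (\<lambda>a c x y. auxd n a c x y + auxd n c a x y)"
    by (subst (2) qsum_mirror_Z) (simp add: qsum_add)
  also have "\<dots> = qsum n regZ (\<lambda>a c x y. 0)"
    by (rule qsum_cong) (use assms auxd_cancel in auto)
  finally show ?thesis by (simp add: qsum_zero)
qed

text \<open>The rotation of order 3 and the reflection of \<open>regP0\<close> make the last five
  terms of \<open>auxw\<close> cancel. What survives compares the interior of \<open>regR\<close>,
  in the shape of \<open>R_interior\<close>, with the trace sum over \<open>regP0\<close>.\<close>

lemma auxw_sum_P0:
  "qsum n regP0 (auxw n) = 2 * qsum n regP0 (\<lambda>a c x y. ind n (a+c-x)) - 2 * qsum n regP0 (trace_ind n)"
proof -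
  have 1: "qsum n regP0 (\<lambda>a c x y. ind n (x+y+c)) = qsum n regP0 (\<lambda>a c x y. ind n (x+y+a))"
    by (subst qsum_mirror_P0) simp
  have 2: "qsum n regP0 (\<lambda>a c x y. ind n (x+y-c)) = qsum n regP0 (\<lambda>a c x y. ind n (x+y-a))"
    by (subst qsum_mirror_P0) simp
  have 3: "qsum n regP0 (\<lambda>a c x y. ind n (x+y-a)) = qsum n regP0 (\<lambda>a c x y. ind n (a+c+x))"
  proof (subst qsum_rot_P0, rule qsum_cong, simp)
    fix a c x y :: int
    have "[a + y + (x - a) - (a + c - x + y) = - (a+c+x)] (mod 3)"
      unfolding cong_iff_dvd_diff by (rule dvdI[of _ _ x]) simp
    then show "ind n (a + y + (x - a) - (a + c - x + y)) = ind n (a+c+x)"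
      using ind_cong ind_minus by metis
  qed
  show ?thesis unfolding auxw_def qsum_add qsum_diff qsum_cmult 1 2 3 by simp
qed

section \<open>The cone without crossings and its faces\<close>

abbreviation regR :: region where
  "regR a c x y \<equiv> x \<ge> 0 \<and> y \<le> 0 \<and> a \<ge> x \<and> a \<ge> -y \<and> c \<ge> x \<and> c \<ge> -y"

lemma finite_regR:
  assumes "n > 0" shows "finite (qset n regR)"
proof (rule finite_subset)
  show "qset n regR \<subseteq> {-2*n..2*n} \<times> {-2*n..2*n} \<times> {-2*n..2*n} \<times> {-2*n..2*n}"
  proof (rule subsetI)
    fix v assume "v \<in> qset n regR"
    then obtain a c x y where v: "v = (a,c,x,y)" and "(a,c,x,y) \<in> qset n regR" by (cases v) auto
    then have h: "x \<ge> 0" "y \<le> 0" "a \<ge> x" "a \<ge> -y" "c \<ge> x" "c \<ge> -y" and eq: "a*c+x*y = n"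
      by (auto simp: qset_def)
    \<comment> \<open>Here \<open>a c\<close> and \<open>x y\<close> have opposite signs and bound
      nothing; regrouped, the equation is a sum of two nonnegative products.\<close>
    have eq': "(a-x)*c + x*(c+y) = n" using eq by (simp add: algebra_simps)
    have nn: "(a-x)*c \<ge> 0" "x*(c+y) \<ge> 0" using h by (auto intro!: mult_nonneg_nonneg)
    have c: "c > 0" using eq' assms h by (cases "c = 0") auto
    have "a \<in> {-2*n..2*n} \<and> c \<in> {-2*n..2*n} \<and> x \<in> {-2*n..2*n} \<and> y \<in> {-2*n..2*n}"
    proof (cases "a = x")
      case True
      then have "x*(c+y) = n" using eq' by simp
      then have "x > 0" "c + y > 0" using assms h by (auto simp: zero_less_mult_iff)
      then have "x \<le> n" "c+y \<le> n" using int_prod_bound[of x "c+y" n] \<open>x*(c+y) = n\<close> by auto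
      then show ?thesis using True h c by auto
    next
      case False
      then have "a - x > 0" using h by simp
      then have "a - x \<le> n" "c \<le> n" using int_prod_bound[of "a-x" c n] c eq' nn by auto
      then show ?thesis using h c by auto
    qed
    then show "v \<in> {-2*n..2*n} \<times> {-2*n..2*n} \<times> {-2*n..2*n} \<times> {-2*n..2*n}" by (simp add: v)
  qed
qed simp

lemma pos_factors:
  fixes p q :: int assumes "p * q = m" "m > 0" "p \<ge> 0 \<or> q \<ge> 0" shows "p > 0 \<and> q > 0"
  using assms by (auto simp: zero_less_mult_iff)

text \<open>The faces are removed in the order \<open>x = 0\<close>, \<open>y = 0\<close>,
  \<open>a = x\<close>, \<open>a = -y\<close>, \<open>c = x\<close>, \<open>c = -y\<close>. Whether
  \<open>z\<close> starts at 0 or 1, and whether a bound is strict or shifted by 1, records which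
  faces are already gone, so that no point is counted twice.\<close>

lemma R_tie1:
  assumes "n > 0"
  shows "qsum n (\<lambda>a c x y. regR a c x y \<and> x = 0) (trace_ind n) = dsum n (\<lambda>d e z. 0 \<le> z \<and> z < min d e + 1) (\<lambda>d e z. ind n z)"
  unfolding qsum_def dsum_def
proof (rule sum.reindex_bij_witness[where i="\<lambda>(d,e,z). (d,e,0,-z)" and j="\<lambda>(a,c,x,y). (a,c,-y)"], goal_cases)
  case (2 v)
  then show ?case using assms pos_factors[of "fst v" "fst (snd v)" n] by (auto simp: qset_def)
qed (auto simp: qset_def ind_minus)

lemma R_tie2:
  assumes "n > 0"
  shows "qsum n (\<lambda>a c x y. regR a c x y \<and> x > 0 \<and> y = 0) (trace_ind n) = dsum n (\<lambda>d e z. 1 \<le> z \<and> z < min d e + 1) (\<lambda>d e z. ind n z)"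
  unfolding qsum_def dsum_def
proof (rule sum.reindex_bij_witness[where i="\<lambda>(d,e,z). (d,e,z,0)" and j="\<lambda>(a,c,x,y). (a,c,x)"], goal_cases)
  case (2 v)
  then show ?case using assms pos_factors[of "fst v" "fst (snd v)" n] by (auto simp: qset_def)
qed (auto simp: qset_def)

lemma R_tie3:
  assumes "n > 0"
  shows "qsum n (\<lambda>a c x y. regR a c x y \<and> x > 0 \<and> y < 0 \<and> a = x) (trace_ind n) = dsum n (\<lambda>d e z. 0 \<le> z \<and> z < min d (e+1)) (\<lambda>d e z. ind n z)"
  unfolding qsum_def dsum_def
proof (rule sum.reindex_bij_witness[where i="\<lambda>(d,e,z). (d,e+d-z,d,z-d)" and j="\<lambda>(a,c,x,y). (x,c+y,x+y)"], goal_cases)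
  case (2 v)
  then show ?case using assms pos_factors[of "fst v" "fst (snd v) + snd (snd (snd v))" n] by (auto simp: qset_def algebra_simps)
qed (auto simp: qset_def algebra_simps)

lemma R_tie4:
  assumes "n > 0"
  shows "qsum n (\<lambda>a c x y. regR a c x y \<and> x > 0 \<and> y < 0 \<and> a \<noteq> x \<and> a = -y) (trace_ind n) = dsum n (\<lambda>d e z. 1 \<le> z \<and> z < min d (e+1)) (\<lambda>d e z. ind n z)"
  unfolding qsum_def dsum_def
proof (rule sum.reindex_bij_witness[where i="\<lambda>(d,e,z). (d,e+d-z,d-z,-d)" and j="\<lambda>(a,c,x,y). (a,c-x,a-x)"], goal_cases)
  case (2 v)
  then show ?case using assms pos_factors[of "fst v" "fst (snd v) - fst (snd (snd v))" n] by (auto simp: qset_def algebra_simps)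
next
  case (5 v)
  then show ?case using ind_minus[of n "fst v - fst (snd (snd v))"] by (auto simp: qset_def)
qed (auto simp: qset_def algebra_simps)

lemma R_tie5:
  assumes "n > 0"
  shows "qsum n (\<lambda>a c x y. regR a c x y \<and> x > 0 \<and> y < 0 \<and> a \<noteq> x \<and> a \<noteq> -y \<and> c = x) (trace_ind n) = dsum n (\<lambda>d e z. 0 \<le> z \<and> z < min d e) (\<lambda>d e z. ind n z)"
  unfolding qsum_def dsum_def
proof (rule sum.reindex_bij_witness[where i="\<lambda>(d,e,z). (e+d-z,d,d,z-d)" and j="\<lambda>(a,c,x,y). (c,a+y,x+y)"], goal_cases)
  case (2 v)
  then show ?case using assms pos_factors[of "fst (snd v)" "fst v + snd (snd (snd v))" n] by (auto simp: qset_def algebra_simps)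
qed (auto simp: qset_def algebra_simps)

lemma R_tie6:
  assumes "n > 0"
  shows "qsum n (\<lambda>a c x y. regR a c x y \<and> x > 0 \<and> y < 0 \<and> a \<noteq> x \<and> a \<noteq> -y \<and> c \<noteq> x \<and> c = -y) (trace_ind n) = dsum n (\<lambda>d e z. 1 \<le> z \<and> z < min d e) (\<lambda>d e z. ind n z)"
  unfolding qsum_def dsum_def
proof (rule sum.reindex_bij_witness[where i="\<lambda>(d,e,z). (e+d-z,d,d-z,-d)" and j="\<lambda>(a,c,x,y). (c,a-x,c-x)"], goal_cases)
  case (2 v)
  then show ?case using assms pos_factors[of "fst (snd v)" "fst v - fst (snd (snd v))" n] by (auto simp: qset_def algebra_simps)
next
  case (5 v)
  then show ?case using ind_minus[of n "fst (snd v) - fst (snd (snd v))"] by (auto simp: qset_def)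
qed (auto simp: qset_def algebra_simps)

text \<open>The move makes all coordinates positive but turns the trace into
  \<open>a + c - x\<close>; this is the origin of the first term of \<open>auxw\<close>.\<close>

lemma R_interior:
  "qsum n (\<lambda>a c x y. regR a c x y \<and> x > 0 \<and> y < 0 \<and> a \<noteq> x \<and> a \<noteq> -y \<and> c \<noteq> x \<and> c \<noteq> -y) (trace_ind n) 
    = qsum n regP0 (\<lambda>a c x y. ind n (a+c-x))"
  unfolding qsum_def
  by (rule sum.reindex_bij_witness[where i="\<lambda>(a,c,x,y). (y+c,x,c,a-x)" and j="\<lambda>(a,c,x,y). (c+y,x,c,a-x)"])
     (auto simp: qset_def algebra_simps)

lemma qsum_R:
  assumes "n > 0"
  shows "qsum n regR (trace_ind n) = qsum n regP0 (\<lambda>a c x y. ind n (a+c-x))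
     + dsum n (\<lambda>d e z. 0 \<le> z \<and> z < min d e + 1) (\<lambda>d e z. ind n z)
     + dsum n (\<lambda>d e z. 1 \<le> z \<and> z < min d e + 1) (\<lambda>d e z. ind n z)
     + dsum n (\<lambda>d e z. 0 \<le> z \<and> z < min d (e+1)) (\<lambda>d e z. ind n z)
     + dsum n (\<lambda>d e z. 1 \<le> z \<and> z < min d (e+1)) (\<lambda>d e z. ind n z)
     + dsum n (\<lambda>d e z. 0 \<le> z \<and> z < min d e) (\<lambda>d e z. ind n z)
     + dsum n (\<lambda>d e z. 1 \<le> z \<and> z < min d e) (\<lambda>d e z. ind n z)"
proof -
  let ?h = "\<lambda>a c x y. ind n (x+y)"
  have fin: "finite (qset n (\<lambda>a c x y. regR a c x y \<and> D a c x y))" for D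
    by (rule finite_subset[OF _ finite_regR[OF assms]]) (auto simp: qset_def)
  let ?C1 = "\<lambda>a c x y. regR a c x y \<and> x > 0"
  let ?C2 = "\<lambda>a c x y. regR a c x y \<and> x > 0 \<and> y < 0"
  let ?C3 = "\<lambda>a c x y. regR a c x y \<and> x > 0 \<and> y < 0 \<and> a \<noteq> x"
  let ?C4 = "\<lambda>a c x y. regR a c x y \<and> x > 0 \<and> y < 0 \<and> a \<noteq> x \<and> a \<noteq> -y"
  let ?C5 = "\<lambda>a c x y. regR a c x y \<and> x > 0 \<and> y < 0 \<and> a \<noteq> x \<and> a \<noteq> -y \<and> c \<noteq> x"
  have "qsum n regR ?h = qsum n (\<lambda>a c x y. regR a c x y \<and> x = 0) ?h + qsum n ?C1 ?h"
    by (rule qsum_disjoint[OF finite_regR[OF assms]]) auto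
  moreover have "qsum n ?C1 ?h = qsum n (\<lambda>a c x y. regR a c x y \<and> x > 0 \<and> y = 0) ?h + qsum n ?C2 ?h"
    by (rule qsum_disjoint[OF fin]) auto
  moreover have "qsum n ?C2 ?h = qsum n (\<lambda>a c x y. regR a c x y \<and> x > 0 \<and> y < 0 \<and> a = x) ?h + qsum n ?C3 ?h"
    by (rule qsum_disjoint[OF fin]) auto
  moreover have "qsum n ?C3 ?h = qsum n (\<lambda>a c x y. regR a c x y \<and> x > 0 \<and> y < 0 \<and> a \<noteq> x \<and> a = -y) ?h + qsum n ?C4 ?h"
    by (rule qsum_disjoint[OF fin]) auto
  moreover have "qsum n ?C4 ?h = qsum n (\<lambda>a c x y. regR a c x y \<and> x > 0 \<and> y < 0 \<and> a \<noteq> x \<and> a \<noteq> -y \<and> c = x) ?h + qsum n ?C5 ?h"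
    by (rule qsum_disjoint[OF fin]) auto
  moreover have "qsum n ?C5 ?h = qsum n (\<lambda>a c x y. regR a c x y \<and> x > 0 \<and> y < 0 \<and> a \<noteq> x \<and> a \<noteq> -y \<and> c \<noteq> x \<and> c = -y) ?h
      + qsum n (\<lambda>a c x y. regR a c x y \<and> x > 0 \<and> y < 0 \<and> a \<noteq> x \<and> a \<noteq> -y \<and> c \<noteq> x \<and> c \<noteq> -y) ?h"
    by (rule qsum_disjoint[OF fin]) auto
  ultimately show ?thesis
    unfolding R_tie1[OF assms] R_tie2[OF assms] R_tie3[OF assms] R_tie4[OF assms] R_tie5[OF assms] R_tie6[OF assms] R_interior
    by linarith
qed

abbreviation regP2 :: region where
  "regP2 a c x y \<equiv> pos4 a c x y \<and> a \<ge> x \<and> c \<ge> x"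

lemma qsum_P2:
  "qsum n regP2 (trace_ind n) = qsum n regZ (trace_ind n)
     + dsum n (\<lambda>d e z. d \<le> z \<and> z < e) (\<lambda>d e z. ind n (d+e-z)) + dsum n (\<lambda>d e z. d + 1 \<le> z \<and> z < e) (\<lambda>d e z. ind n (d+e-z))"
proof -
  let ?h = "\<lambda>a c x y. ind n (x+y)"
  have "qsum n regP2 ?h = qsum n (\<lambda>a c x y. regP2 a c x y \<and> a = x) ?h + qsum n (\<lambda>a c x y. regP2 a c x y \<and> a > x) ?h"
    by (rule qsum_disjoint_pos) auto
  moreover have "qsum n (\<lambda>a c x y. regP2 a c x y \<and> a > x) ?h = qsum n (\<lambda>a c x y. regP2 a c x y \<and> a > x \<and> c = x) ?h + qsum n regZ ?h"
    by (rule qsum_disjoint_pos) auto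
  moreover have "qsum n (\<lambda>a c x y. regP2 a c x y \<and> a = x) ?h = dsum n (\<lambda>d e z. d \<le> z \<and> z < e) (\<lambda>d e z. ind n (d+e-z))"
    unfolding qsum_def dsum_def
    by (rule sum.reindex_bij_witness[where i="\<lambda>(d,e,z). (d,z,d,e-z)" and j="\<lambda>(a,c,x,y). (x,c+y,c)"])
       (auto simp: qset_def algebra_simps)
  moreover have "qsum n (\<lambda>a c x y. regP2 a c x y \<and> a > x \<and> c = x) ?h = dsum n (\<lambda>d e z. d + 1 \<le> z \<and> z < e) (\<lambda>d e z. ind n (d+e-z))"
    unfolding qsum_def dsum_def
    by (rule sum.reindex_bij_witness[where i="\<lambda>(d,e,z). (z,d,d,e-z)" and j="\<lambda>(a,c,x,y). (x,a+y,a)"])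
       (auto simp: qset_def algebra_simps)
  ultimately show ?thesis by linarith
qed

section \<open>Boundary terms as divisor sums\<close>

definition posdivs :: "int \<Rightarrow> int set" where "posdivs n = {d. d > 0 \<and> d dvd n}"

lemma finite_posdivs: "n > 0 \<Longrightarrow> finite (posdivs n)"
  by (rule finite_subset[of _ "{0..n}"]) (auto simp: posdivs_def dest: zdvd_imp_le)

lemma dsum_interval:
  assumes "n > 0"
  shows "dsum n (\<lambda>d e z. l d e \<le> z \<and> z < u d e) g = (\<Sum>d\<in>posdivs n. \<Sum>z\<in>{l d (n div d)..<u d (n div d)}. g d (n div d) z)"
proof -
  have "(\<Sum>d\<in>posdivs n. \<Sum>z\<in>{l d (n div d)..<u d (n div d)}. g d (n div d) z)
      = (\<Sum>(d,z)\<in>Sigma (posdivs n) (\<lambda>d. {l d (n div d)..<u d (n div d)}). g d (n div d) z)"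
    by (rule sum.Sigma) (use finite_posdivs assms in auto)
  also have "\<dots> = dsum n (\<lambda>d e z. l d e \<le> z \<and> z < u d e) g"
    unfolding dsum_def
    by (rule sum.reindex_bij_witness[where i="\<lambda>(d,e,z). (d,z)" and j="\<lambda>(d,z). (d,n div d,z)"])
       (use assms in \<open>auto simp: posdivs_def pos_imp_zdiv_pos_iff zdvd_imp_le\<close>)
  finally show ?thesis by simp
qed

lemma dsum_cong:
  assumes "\<And>d e z. d * e = n \<Longrightarrow> C d e z \<longleftrightarrow> D d e z" "\<And>d e z. d * e = n \<Longrightarrow> g d e z = k d e z"
  shows "dsum n C g = dsum n D k"
  unfolding dsum_def by (rule sum.cong) (use assms in auto)

definition ind_sum :: "int \<Rightarrow> int \<Rightarrow> int \<Rightarrow> int \<Rightarrow> int" where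
  "ind_sum n k l u = (\<Sum>z\<in>{l..<u}. ind n (z+k))"

text \<open>What one factorization \<open>d e = n\<close> contributes in
  \<open>ties_collect\<close>: the faces of \<open>regR\<close> with factor 2, those of
  \<open>regP2\<close> with factor 6, the boundary terms of \<open>qsum_P0\<close> applied to
  \<open>auxw\<close>, and the correction \<open>3 * ind n 0\<close> for triples with a zero
  entry.\<close>

definition tie_total :: "int \<Rightarrow> int \<Rightarrow> int \<Rightarrow> int" where
  "tie_total n d e = 
     2 * (\<Sum>z\<in>{0..<min d e + 1}. ind n z) + 2 * (\<Sum>z\<in>{1..<min d e + 1}. ind n z)
   + 2 * (\<Sum>z\<in>{0..<min d (e+1)}. ind n z) + 2 * (\<Sum>z\<in>{1..<min d (e+1)}. ind n z)
   + 2 * (\<Sum>z\<in>{0..<min d e}. ind n z) + 2 * (\<Sum>z\<in>{1..<min d e}. ind n z)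
   + 6 * (\<Sum>z\<in>{d..<e}. ind n (d+e-z)) + 6 * (\<Sum>z\<in>{d+1..<e}. ind n (d+e-z))
   + (\<Sum>z\<in>{d+1..<e}. auxw n d (e-z) z d) - (\<Sum>z\<in>{1..<min d e}. auxw n z d d (e-z))
   - (\<Sum>z\<in>{1..<min d e}. auxw n (d-z) (e-z) (d+e-z) z) - 3 * ind n 0"

text \<open>The left side is the shape that the count over \<open>regT\<close> takes in
  \<open>weighted_triples_sum\<close>. Its open parts cancel: twice \<open>regR\<close> minus twice
  \<open>regP0\<close> is the \<open>auxw\<close> sum over \<open>regP0\<close>, hence a sum over
  \<open>regZ\<close>, and with 6 times \<open>regZ\<close> minus 6 times \<open>regQ\<close> it
  becomes the vanishing sum of \<open>auxd\<close>.\<close>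

lemma ties_collect:
  assumes "n > 0" "\<not> 3 dvd n"
  shows "2 * qsum n regR (trace_ind n) + 6 * qsum n regP2 (trace_ind n)
       - 2 * qsum n regP0 (trace_ind n) - 6 * qsum n regQ (trace_ind n)
       - 3 * ind n 0 * int (card (posdivs n)) = (\<Sum>d\<in>posdivs n. tie_total n d (n div d))"
proof -
  have Q: "qsum n regQ (trace_ind n) = qsum n regZ (\<lambda>a c x y. ind n (a+c+y))"
    unfolding qsum_Q by (rule qsum_cong) (auto simp: algebra_simps)
  have auxd: "qsum n regZ (\<lambda>a c x y. auxw n x y a c + auxw n a (c-x) (y+a) x - auxw n x (y+a) a (c-x) - auxw n (a-x) (c-x) (y+a+c-x) x)
      + 6 * qsum n regZ (trace_ind n) - 6 * qsum n regZ (\<lambda>a c x y. ind n (a+c+y)) = 0"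
    using auxd_sum_zero[OF assms(2)] unfolding auxd_def qsum_add qsum_diff qsum_cmult by simp
  have t1: "dsum n (\<lambda>d e z. d < z \<and> z < e) (\<lambda>d e z. auxw n d (e-z) z d) = dsum n (\<lambda>d e z. d + 1 \<le> z \<and> z < e) (\<lambda>d e z. auxw n d (e-z) z d)"
    by (rule dsum_cong) auto
  have t2: "dsum n (\<lambda>d e z. 0 < z \<and> z < d \<and> z < e) g = dsum n (\<lambda>d e z. 1 \<le> z \<and> z < min d e) g" for g
    by (rule dsum_cong) auto
  note ints = dsum_interval[OF assms(1), of "\<lambda>d e. 0" "\<lambda>d e. min d e + 1"] dsum_interval[OF assms(1), of "\<lambda>d e. 1" "\<lambda>d e. min d e + 1"]
    dsum_interval[OF assms(1), of "\<lambda>d e. 0" "\<lambda>d e. min d (e+1)"] dsum_interval[OF assms(1), of "\<lambda>d e. 1" "\<lambda>d e. min d (e+1)"]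
    dsum_interval[OF assms(1), of "\<lambda>d e. 0" "\<lambda>d e. min d e"] dsum_interval[OF assms(1), of "\<lambda>d e. 1" "\<lambda>d e. min d e"]
    dsum_interval[OF assms(1), of "\<lambda>d e. d" "\<lambda>d e. e"] dsum_interval[OF assms(1), of "\<lambda>d e. d+1" "\<lambda>d e. e"]
  show ?thesis
    unfolding tie_total_def sum.distrib sum_subtractf sum_distrib_left[symmetric] sum_constant
    using auxd auxw_sum_P0[of n] qsum_P0[of n "auxw n"] qsum_R[OF assms(1)] qsum_P2[of n]
    unfolding Q t1 t2 ints by (simp add: algebra_simps)
qed

lemma ind_sum_closed_1:
  assumes "n mod 3 = 1" "l \<le> u"
  shows "ind_sum n k l u = (u - 1 + k) div 3 - (l - 1 + k) div 3"
  using assms(2)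
proof (induction u rule: int_ge_induct)
  case base then show ?case by (simp add: ind_sum_def)
next
  case (step u)
  have "{l..<u+1} = insert u {l..<u}" using step by auto
  then have "ind_sum n k l (u+1) = ind n (u+k) + ind_sum n k l u" by (simp add: ind_sum_def)
  moreover have "ind n (u+k) = (u+k) div 3 - (u - 1 + k) div 3"
    using assms(1) by (simp add: ind_def of_bool_def) presburger
  ultimately show ?case using step by simp
qed

lemma ind_sum_closed_2:
  assumes "n mod 3 = 2" "l \<le> u"
  shows "ind_sum n k l u = (u - l) - ((u - 1 + k) div 3 - (l - 1 + k) div 3)"
proof -
  have "ind_sum n k l u = (\<Sum>z\<in>{l..<u}. 1 - ind 1 (z+k))"
    unfolding ind_sum_def by (rule sum.cong) (use assms in \<open>auto simp: ind_def\<close>)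
  also have "\<dots> = (u - l) - ind_sum 1 k l u" using assms by (simp add: sum_subtractf ind_sum_def)
  finally show ?thesis using ind_sum_closed_1[of 1 l u k] assms by simp
qed

lemma ind_lin: "ind n (z+d) = ind n (z mod 3 + d mod 3)" "ind n (z-d) = ind n (z mod 3 - d mod 3)" "ind n z = ind n (z mod 3)"
  by (rule ind_cong; simp add: cong_def mod_simps)+

lemma cong_residues:
  "[d - e = d mod 3 - e mod 3] (mod (3::int))" "[d + e - z = d mod 3 + e mod 3 - z mod 3] (mod (3::int))" "[z = z mod 3] (mod (3::int))"
  by (intro cong_add cong_diff; simp add: cong_def)+ (simp add: cong_def)

lemma residues_of_prod:
  assumes "d * e = (n::int)" 
  shows "n mod 3 = 1 \<Longrightarrow> d mod 3 = 1 \<and> e mod 3 = 1 \<or> d mod 3 = 2 \<and> e mod 3 = 2"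
    "n mod 3 = 2 \<Longrightarrow> d mod 3 = 1 \<and> e mod 3 = 2 \<or> d mod 3 = 2 \<and> e mod 3 = 1"
proof -
  have "n mod 3 = (d mod 3) * (e mod 3) mod 3" using assms by (simp add: mod_simps)
  moreover have "d mod 3 = 0 \<or> d mod 3 = 1 \<or> d mod 3 = 2" "e mod 3 = 0 \<or> e mod 3 = 1 \<or> e mod 3 = 2" by auto
  ultimately show "n mod 3 = 1 \<Longrightarrow> d mod 3 = 1 \<and> e mod 3 = 1 \<or> d mod 3 = 2 \<and> e mod 3 = 2"
    "n mod 3 = 2 \<Longrightarrow> d mod 3 = 1 \<and> e mod 3 = 2 \<or> d mod 3 = 2 \<and> e mod 3 = 1" by auto
qed

text \<open>Here \<open>d\<close> and \<open>e\<close> lie in the same nonzero class modulo 3, so on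
  a tie every weight depends only on \<open>z\<close> and \<open>d\<close> and is a combination of
  \<open>ind\<close> at \<open>z\<close> and \<open>z + d\<close>. Such terms can be summed in
  closed form.\<close>

lemma auxw_ties_1:
  assumes "d * e = n" "n mod 3 = 1"
  shows "auxw n d (e-z) z d = - 2 * ind n (z+d) - ind n z"
    "auxw n z d d (e-z) = 4 * ind n z - 2 * ind n (z+d)"
    "auxw n (d-z) (e-z) (d+e-z) z = 2 * ind n z - ind n (z+d)"
    "ind n (d+e-z) = ind n (z+d)"
proof -
  have z: "z mod 3 = 0 \<or> z mod 3 = 1 \<or> z mod 3 = 2" by auto
  have f0: "ind n 1 = 0" "ind n 0 = 1" using assms by (auto simp: ind_def)
  have 1: "auxw n d (e-z) z d = auxw n (d mod 3) (e mod 3-z mod 3) (z mod 3) (d mod 3)" by (intro auxw_cong cong_residues)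
  have 2: "auxw n z d d (e-z) = auxw n (z mod 3) (d mod 3) (d mod 3) (e mod 3-z mod 3)" by (intro auxw_cong cong_residues)
  have 3: "auxw n (d-z) (e-z) (d+e-z) z = auxw n (d mod 3 - z mod 3) (e mod 3 - z mod 3) (d mod 3+ e mod 3 - z mod 3) (z mod 3)" by (intro auxw_cong cong_residues)
  have 4: "ind n (d+e-z) = ind n (d mod 3 + e mod 3-z mod 3)" by (intro ind_cong cong_residues)
  have "auxw n (d mod 3) (e mod 3-z mod 3) (z mod 3) (d mod 3) = - 2 * ind n (z mod 3 + d mod 3) - ind n (z mod 3)"
    using residues_of_prod(1)[OF assms] z by (elim disjE conjE; simp add: auxw_def ind_numerals f0)
  then show "auxw n d (e-z) z d = - 2 * ind n (z+d) - ind n z" unfolding 1 ind_lin(1)[of n z d] ind_lin(3)[of n z] .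
  have "auxw n (z mod 3) (d mod 3) (d mod 3) (e mod 3-z mod 3) = 4 * ind n (z mod 3) - 2 * ind n (z mod 3 + d mod 3)"
    using residues_of_prod(1)[OF assms] z by (elim disjE conjE; simp add: auxw_def ind_numerals f0)
  then show "auxw n z d d (e-z) = 4 * ind n z - 2 * ind n (z+d)" unfolding 2 ind_lin(1)[of n z d] ind_lin(3)[of n z] .
  have "auxw n (d mod 3 - z mod 3) (e mod 3 - z mod 3) (d mod 3+ e mod 3 - z mod 3) (z mod 3) = 2 * ind n (z mod 3) - ind n (z mod 3 + d mod 3)"
    using residues_of_prod(1)[OF assms] z by (elim disjE conjE; simp add: auxw_def ind_numerals f0)
  then show "auxw n (d-z) (e-z) (d+e-z) z = 2 * ind n z - ind n (z+d)" unfolding 3 ind_lin(1)[of n z d] ind_lin(3)[of n z] .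
  have "ind n (d mod 3 + e mod 3-z mod 3) = ind n (z mod 3 + d mod 3)"
    using residues_of_prod(1)[OF assms] z by (elim disjE conjE; simp add: ind_numerals f0)
  then show "ind n (d+e-z) = ind n (z+d)" unfolding 4 ind_lin(1)[of n z d] .
qed

text \<open>Here \<open>e = -d\<close> (mod 3), so \<open>d + e - z\<close> reduces to
  \<open>-z\<close>; the shift \<open>z - d\<close> appears as a third argument.\<close>

lemma auxw_ties_2:
  assumes "d * e = n" "n mod 3 = 2"
  shows "auxw n d (e-z) z d = - ind n (z+d) - 2 * ind n (z-d)"
    "auxw n z d d (e-z) = 3 * ind n (z-d) + ind n (z+d) - 2 * ind n z"
    "auxw n (d-z) (e-z) (d+e-z) z = 2 * ind n z + 3 * ind n (z+d) - 4 * ind n (z-d)"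
    "ind n (d+e-z) = ind n z"
proof -
  have z: "z mod 3 = 0 \<or> z mod 3 = 1 \<or> z mod 3 = 2" by auto
  have f0: "ind n 1 = 1" "ind n 0 = 0" using assms by (auto simp: ind_def)
  have 1: "auxw n d (e-z) z d = auxw n (d mod 3) (e mod 3-z mod 3) (z mod 3) (d mod 3)" by (intro auxw_cong cong_residues)
  have 2: "auxw n z d d (e-z) = auxw n (z mod 3) (d mod 3) (d mod 3) (e mod 3-z mod 3)" by (intro auxw_cong cong_residues)
  have 3: "auxw n (d-z) (e-z) (d+e-z) z = auxw n (d mod 3 - z mod 3) (e mod 3 - z mod 3) (d mod 3+ e mod 3 - z mod 3) (z mod 3)" by (intro auxw_cong cong_residues)
  have 4: "ind n (d+e-z) = ind n (d mod 3 + e mod 3-z mod 3)" by (intro ind_cong cong_residues)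
  have "auxw n (d mod 3) (e mod 3-z mod 3) (z mod 3) (d mod 3) = - ind n (z mod 3 + d mod 3) - 2 * ind n (z mod 3 - d mod 3)"
    using residues_of_prod(2)[OF assms] z by (elim disjE conjE; simp add: auxw_def ind_numerals f0)
  then show "auxw n d (e-z) z d = - ind n (z+d) - 2 * ind n (z-d)" unfolding 1 ind_lin(1,2)[of n z d] ind_lin(3)[of n z] .
  have "auxw n (z mod 3) (d mod 3) (d mod 3) (e mod 3-z mod 3) = 3 * ind n (z mod 3 - d mod 3) + ind n (z mod 3 + d mod 3) - 2 * ind n (z mod 3)"
    using residues_of_prod(2)[OF assms] z by (elim disjE conjE; simp add: auxw_def ind_numerals f0)
  then show "auxw n z d d (e-z) = 3 * ind n (z-d) + ind n (z+d) - 2 * ind n z" unfolding 2 ind_lin(1,2)[of n z d] ind_lin(3)[of n z] .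
  have "auxw n (d mod 3 - z mod 3) (e mod 3 - z mod 3) (d mod 3+ e mod 3 - z mod 3) (z mod 3) = 2 * ind n (z mod 3) + 3 * ind n (z mod 3 + d mod 3) - 4 * ind n (z mod 3 - d mod 3)"
    using residues_of_prod(2)[OF assms] z by (elim disjE conjE; simp add: auxw_def ind_numerals f0)
  then show "auxw n (d-z) (e-z) (d+e-z) z = 2 * ind n z + 3 * ind n (z+d) - 4 * ind n (z-d)" unfolding 3 ind_lin(1,2)[of n z d] ind_lin(3)[of n z] .
  have "ind n (d mod 3 + e mod 3-z mod 3) = ind n (z mod 3)"
    using residues_of_prod(2)[OF assms] z by (elim disjE conjE; simp add: ind_numerals f0)
  then show "ind n (d+e-z) = ind n z" unfolding 4 ind_lin(3)[of n z] .
qed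

lemma tie_total_1:
  assumes "d * e = n" "n mod 3 = 1"
  shows "tie_total n d e = 2 * ind_sum n 0 0 (min d e + 1) + 2 * ind_sum n 0 1 (min d e + 1) + 2 * ind_sum n 0 0 (min d (e+1)) + 2 * ind_sum n 0 1 (min d (e+1))
     + 2 * ind_sum n 0 0 (min d e) - 4 * ind_sum n 0 1 (min d e) + 3 * ind_sum n d 1 (min d e) 
     + 6 * ind_sum n d d e + 4 * ind_sum n d (d+1) e - ind_sum n 0 (d+1) e - 3"
proof -
  have "ind n 0 = 1" using assms by (simp add: ind_def)
  then show ?thesis
    unfolding tie_total_def auxw_ties_1[OF assms] ind_sum_def sum.distrib sum_subtractf sum_distrib_left[symmetric] by simp
qed

lemma tie_total_2:
  assumes "d * e = n" "n mod 3 = 2"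
  shows "tie_total n d e = 2 * ind_sum n 0 0 (min d e + 1) + 2 * ind_sum n 0 1 (min d e + 1) + 2 * ind_sum n 0 0 (min d (e+1)) + 2 * ind_sum n 0 1 (min d (e+1))
     + 2 * ind_sum n 0 0 (min d e) + 2 * ind_sum n 0 1 (min d e) - 4 * ind_sum n d 1 (min d e) + ind_sum n (-d) 1 (min d e)
     + 6 * ind_sum n 0 d e + 6 * ind_sum n 0 (d+1) e - ind_sum n d (d+1) e - 2 * ind_sum n (-d) (d+1) e"
proof -
  have "ind n 0 = 0" using assms by (simp add: ind_def)
  then show ?thesis
    unfolding tie_total_def auxw_ties_2[OF assms] ind_sum_def sum.distrib sum_subtractf sum_distrib_left[symmetric] by (simp add: sum_negf)
qed

text \<open>The removal order of the faces makes \<open>tie_total\<close> asymmetric, so the two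
  orders of a factorization are added. Once the residues of \<open>d\<close> and \<open>e\<close>
  are fixed, each quotient by 3 is an explicit linear expression.\<close>

lemma tie_total_sym_1_lt:
  assumes "d * e = n" "n mod 3 = 1" "0 < d" "d < e"
  shows "tie_total n d e + tie_total n e d = 3 * (d + e)"
proof -
  have emp: "ind_sum n k e d = 0" "ind_sum n k (e+1) d = 0" for k using assms by (simp_all add: ind_sum_def)
  have eq: "tie_total n d e + tie_total n e d = 2 * ind_sum n 0 0 (d + 1) + 2 * ind_sum n 0 1 (d + 1) + 2 * ind_sum n 0 0 d + 2 * ind_sum n 0 1 d
     + 2 * ind_sum n 0 0 d - 4 * ind_sum n 0 1 d + 3 * ind_sum n d 1 d + 6 * ind_sum n d d e + 4 * ind_sum n d (d+1) e - ind_sum n 0 (d+1) e - 3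
     + (2 * ind_sum n 0 0 (d + 1) + 2 * ind_sum n 0 1 (d + 1) + 2 * ind_sum n 0 0 (d + 1) + 2 * ind_sum n 0 1 (d + 1)
     + 2 * ind_sum n 0 0 d - 4 * ind_sum n 0 1 d + 3 * ind_sum n e 1 d - 3)"
    using assms tie_total_1[of d e n] tie_total_1[of e d n] by (simp add: mult.commute emp)
  have "d mod 3 = 1 \<and> e mod 3 = 1 \<or> d mod 3 = 2 \<and> e mod 3 = 2" using residues_of_prod(1)[OF assms(1,2)] .
  then show ?thesis
  proof (elim disjE conjE)
    assume "d mod 3 = 1" "e mod 3 = 1"
    then have "d = 3 * (d div 3) + 1" "e = 3 * (e div 3) + 1" by presburger+
    then obtain i j where ij: "d = 3*i+1" "e = 3*j+1" by blast
    have "(6*i+1) div 3 = 2*i" "(6*i+2) div 3 = 2*i" by presburger+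
    then show ?thesis unfolding eq using assms(3,4) by (simp add: ind_sum_closed_1[OF assms(2)] ij)
  next
    assume "d mod 3 = 2" "e mod 3 = 2"
    then have "d = 3 * (d div 3) + 2" "e = 3 * (e div 3) + 2" by presburger+
    then obtain i j where ij: "d = 3*i+2" "e = 3*j+2" by blast
    have "(6*i+4) div 3 = 2*i + 1" by presburger
    then show ?thesis unfolding eq using assms(3,4) by (simp add: ind_sum_closed_1[OF assms(2)] ij)
  qed
qed

lemma tie_total_sym_1_eq:
  assumes "d * d = n" "n mod 3 = 1" "0 < d"
  shows "tie_total n d d = 3 * d"
proof -
  have emp: "ind_sum n k d d = 0" "ind_sum n k (d+1) d = 0" for k by (simp_all add: ind_sum_def)
  have eq: "tie_total n d d = 2 * ind_sum n 0 0 (d + 1) + 2 * ind_sum n 0 1 (d + 1) + 2 * ind_sum n 0 0 d + 2 * ind_sum n 0 1 d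
     + 2 * ind_sum n 0 0 d - 4 * ind_sum n 0 1 d + 3 * ind_sum n d 1 d - 3"
    using assms tie_total_1[of d d n] by (simp add: emp)
  have "d mod 3 = 1 \<or> d mod 3 = 2" using residues_of_prod(1)[OF assms(1,2)] by auto
  then show ?thesis
  proof (elim disjE conjE)
    assume "d mod 3 = 1"
    then have "d = 3 * (d div 3) + 1" by presburger
    then obtain i where ij: "d = 3*i+1" by blast
    show ?thesis unfolding eq using assms(3) by (simp add: ind_sum_closed_1[OF assms(2)] ij)
  next
    assume "d mod 3 = 2"
    then have "d = 3 * (d div 3) + 2" by presburger
    then obtain i where ij: "d = 3*i+2" by blast
    show ?thesis unfolding eq using assms(3) by (simp add: ind_sum_closed_1[OF assms(2)] ij)
  qed
qed

lemma tie_total_sym_2_lt: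
  assumes "d * e = n" "n mod 3 = 2" "0 < d" "d < e"
  shows "tie_total n d e + tie_total n e d = 6 * (d + e)"
proof -
  have emp: "ind_sum n k e d = 0" "ind_sum n k (e+1) d = 0" for k using assms by (simp_all add: ind_sum_def)
  have eq: "tie_total n d e + tie_total n e d = 2 * ind_sum n 0 0 (d + 1) + 2 * ind_sum n 0 1 (d + 1) + 2 * ind_sum n 0 0 d + 2 * ind_sum n 0 1 d
     + 2 * ind_sum n 0 0 d + 2 * ind_sum n 0 1 d - 4 * ind_sum n d 1 d + ind_sum n (-d) 1 d
     + 6 * ind_sum n 0 d e + 6 * ind_sum n 0 (d+1) e - ind_sum n d (d+1) e - 2 * ind_sum n (-d) (d+1) e
     + (2 * ind_sum n 0 0 (d + 1) + 2 * ind_sum n 0 1 (d + 1) + 2 * ind_sum n 0 0 (d + 1) + 2 * ind_sum n 0 1 (d + 1)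
     + 2 * ind_sum n 0 0 d + 2 * ind_sum n 0 1 d - 4 * ind_sum n e 1 d + ind_sum n (-e) 1 d)"
    using assms tie_total_2[of d e n] tie_total_2[of e d n] by (simp add: mult.commute emp)
  have "d mod 3 = 1 \<and> e mod 3 = 2 \<or> d mod 3 = 2 \<and> e mod 3 = 1" using residues_of_prod(2)[OF assms(1,2)] .
  then show ?thesis
  proof (elim disjE conjE)
    assume "d mod 3 = 1" "e mod 3 = 2"
    then have "d = 3 * (d div 3) + 1" "e = 3 * (e div 3) + 2" by presburger+
    then obtain i j where ij: "d = 3*i+1" "e = 3*j+2" by blast
    have "(6*i+1) div 3 = 2*i" "(6*i+2) div 3 = 2*i" "(- (3*i) - 1) div 3 = - i - 1" "(2 + (3*j + 3*i)) div 3 = i + j" by presburger+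
    then show ?thesis unfolding eq using assms(3,4) by (simp add: ind_sum_closed_2[OF assms(2)] ij)
  next
    assume "d mod 3 = 2" "e mod 3 = 1"
    then have "d = 3 * (d div 3) + 2" "e = 3 * (e div 3) + 1" by presburger+
    then obtain i j where ij: "d = 3*i+2" "e = 3*j+1" by blast
    have "(6*i+4) div 3 = 2*i + 1" "(- (3*i) - 2) div 3 = - i - 1" "(- (3*j) - 1) div 3 = - j - 1" "(2 + (3*i + 3*j)) div 3 = i + j" by presburger+
    then show ?thesis unfolding eq using assms(3,4) by (simp add: ind_sum_closed_2[OF assms(2)] ij)
  qed
qed

lemma posdivs_flip: "n > 0 \<Longrightarrow> (\<Sum>d\<in>posdivs n. g d (n div d)) = (\<Sum>d\<in>posdivs n. g (n div d) d)"
  by (rule sum.reindex_bij_witness[where i="\<lambda>d. n div d" and j="\<lambda>d. n div d"])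
     (auto simp: posdivs_def pos_imp_zdiv_pos_iff zdvd_imp_le div_dvd_iff_mult elim!: dvdE)

lemma tie_total_sum:
  assumes "n > 0" "\<not> 3 dvd n"
  shows "(\<Sum>d\<in>posdivs n. tie_total n d (n div d)) = (if n mod 3 = 1 then 3 else 6) * (\<Sum>d\<in>posdivs n. d)"
proof -
  let ?k = "if n mod 3 = 1 then 3 else 6 :: int"
  have pair: "tie_total n d (n div d) + tie_total n (n div d) d = ?k * (d + n div d)" if "d \<in> posdivs n" for d
  proof -
    define e where "e = n div d"
    have d: "d > 0" "d * e = n" using that by (auto simp: posdivs_def e_def)
    have e: "e > 0" using d assms by (metis zero_less_mult_pos)
    have n3: "n mod 3 = 1 \<or> n mod 3 = 2" using assms(2) by presburger
    consider "d < e" | "e < d" | "d = e" by linarith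
    then have "tie_total n d e + tie_total n e d = ?k * (d + e)"
    proof cases
      case 1 then show ?thesis using tie_total_sym_1_lt[of d e n] tie_total_sym_2_lt[of d e n] d n3 by auto
    next
      case 2 then show ?thesis using tie_total_sym_1_lt[of e d n] tie_total_sym_2_lt[of e d n] d e n3 by (auto simp: mult.commute add.commute)
    next
      case 3
      \<comment> \<open>A square is never 2 (mod 3), so the diagonal occurs only in this
        class.\<close>
      then have "n mod 3 = 1" using residues_of_prod(2)[OF d(2)] n3 by auto
      then show ?thesis using tie_total_sym_1_eq[of d n] 3 d by auto
    qed
    then show ?thesis by (simp add: e_def)
  qed
  have "2 * (\<Sum>d\<in>posdivs n. tie_total n d (n div d)) = (\<Sum>d\<in>posdivs n. tie_total n d (n div d) + tie_total n (n div d) d)"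
    using posdivs_flip[OF assms(1), of "tie_total n"] by (simp add: sum.distrib)
  also have "\<dots> = (\<Sum>d\<in>posdivs n. ?k * (d + n div d))" by (rule sum.cong) (use pair in auto)
  also have "\<dots> = ?k * ((\<Sum>d\<in>posdivs n. d) + (\<Sum>d\<in>posdivs n. n div d))"
    by (simp only: sum_distrib_left[symmetric] sum.distrib)
  also have "(\<Sum>d\<in>posdivs n. n div d) = (\<Sum>d\<in>posdivs n. d)"
    using posdivs_flip[OF assms(1), of "\<lambda>d e. e"] by simp
  finally show ?thesis by (simp split: if_splits)
qed

lemma qsum_restrict:
  assumes "finite (qset n C)"
  shows "qsum n C (\<lambda>a c x y. of_bool (D a c x y) * h a c x y) = qsum n (\<lambda>a c x y. C a c x y \<and> D a c x y) h"
proof -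
  have "qsum n (\<lambda>a c x y. C a c x y \<and> D a c x y) (\<lambda>a c x y. of_bool (D a c x y) * h a c x y) = qsum n (\<lambda>a c x y. C a c x y \<and> D a c x y) h"
    by (rule qsum_cong) auto
  moreover have "qsum n (\<lambda>a c x y. C a c x y \<and> \<not> D a c x y) (\<lambda>a c x y. of_bool (D a c x y) * h a c x y) = qsum n (\<lambda>a c x y. C a c x y \<and> \<not> D a c x y) (\<lambda>a c x y. 0)"
    by (rule qsum_cong) auto
  ultimately show ?thesis using qsum_split[OF assms, of "\<lambda>a c x y. of_bool (D a c x y) * h a c x y" D] by (simp add: qsum_zero)
qed

text \<open>A matrix goes to minus its adjugate: same form, opposite trace.\<close>

lemma qsum_neg: "qsum n C h = qsum n (\<lambda>a c x y. C a c (-y) (-x)) (\<lambda>a c x y. h a c (-y) (-x))"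
  unfolding qsum_def
  by (rule sum.reindex_bij_witness[where i="\<lambda>(a,c,x,y). (a,c,-y,-x)" and j="\<lambda>(a,c,x,y). (a,c,-y,-x)"])
     (auto simp: qset_def algebra_simps)

text \<open>Conjugation by an element of order 3 in PSL2(Z), so the trace is preserved.\<close>

lemma qsum_rot: "qsum n C h = qsum n (\<lambda>a c x y. C (a+c-x+y) a (a+y) (x-a)) (\<lambda>a c x y. h (a+c-x+y) a (a+y) (x-a))"
  unfolding qsum_def
  by (rule sum.reindex_bij_witness[where i="\<lambda>(a,c,x,y). (a+c-x+y,a,a+y,x-a)" and j="\<lambda>(a,c,x,y). (c,a+c-x+y,c+y,x-c)"])
     (auto simp: qset_def algebra_simps)

lemma ind_neg_sum: "ind n (- y - x) = ind n (x+y)"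
  by (metis ind_minus add.commute minus_add_distrib uminus_add_conv_diff)

section \<open>Decomposition of the cone of triples\<close>

text \<open>
  Since \<open>cross x y\<close> means $|x-y|<|x+y|$, the three conditions occurring in \<open>regF\<close> below say
  $|u|<|t|$, $|v|<|t|$, $|w|<|t|$ for $t=x+y$.
\<close>
definition cross :: "int \<Rightarrow> int \<Rightarrow> bool" where
  "cross x y \<longleftrightarrow> x > 0 \<and> y > 0 \<or> x < 0 \<and> y < 0"

text \<open>
  The numbers $u=x-y$, $v=2a-x+y$, $w=2c-x+y$ satisfy $uv+vw+wu=4n-(x+y)^2$ and
  are permuted cyclically by the substitution of \<open>qsum_rot\<close>.
\<close>
abbreviation regT :: region where
  "regT a c x y \<equiv> a > 0 \<and> c > 0 \<and> a + c - x + y > 0 \<and> x - y \<ge> 0 \<and> 2*a - x + y \<ge> 0 \<and> 2*c - x + y \<ge> 0"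

abbreviation regT_weight :: "int \<Rightarrow> int \<Rightarrow> int \<Rightarrow> int \<Rightarrow> int" where
  "regT_weight a c x y \<equiv> sgn (x - y) + sgn (2*a - x + y) + sgn (2*c - x + y) - 1"

text \<open>The pair sums of \<open>u, v, w\<close> are \<open>2 a\<close>, \<open>2 c\<close> and
  \<open>2 (a + c - x + y)\<close>, all positive; a point outside \<open>regT\<close> therefore has
  exactly one negative entry and weight 0. Adding such points frees each crossing condition from the
  sign conditions of \<open>regT\<close>.\<close>

definition regF :: region where
  "regF a c x y \<longleftrightarrow> a > 0 \<and> c > 0 \<and> a + c - x + y > 0 \<and> (regT a c x y \<or> cross x y \<or> cross (a+y) (x-a) \<or> cross (x-c) (c+y))"

lemma cross_commute: "cross x y \<longleftrightarrow> cross y x"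
  unfolding cross_def by blast

lemma cross_minus: "cross (-x) (-y) \<longleftrightarrow> cross x y"
  unfolding cross_def by auto

lemma rot_args:
  fixes a c x y :: int
  shows "(a+c-x+y) + a - (a+y) + (x-a) = c" "(a+y) - (x-a) = 2*a - x + y" "2*(a+c-x+y) - (a+y) + (x-a) = 2*c - x + y"
    "2*a - (a+y) + (x-a) = x - y" "(a+c-x+y) + (x-a) = c + y" "(a+y) - (a+c-x+y) = x - c" "(a+y) - a = y" "a + (x-a) = x" "(a+y) + (x-a) = x + y"
  by simp_all

lemma regF_rot: "regF (a+c-x+y) a (a+y) (x-a) \<longleftrightarrow> regF a c x y"
  unfolding regF_def rot_args cross_commute[of y x] cross_commute[of "c+y" "x-c"] by blast

lemma cross_neg_args:
  "cross (- y) (- x) = cross x y" "cross (a + - x) (- y - a) = cross (a+y) (x-a)" "cross (- y - c) (c + - x) = cross (x-c) (c+y)"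
proof -
  have "a + - x = - (x - a)" "- y - a = - (a + y)" "- y - c = - (c + y)" "c + - x = - (x - c)" by simp_all
  then show "cross (- y) (- x) = cross x y" "cross (a + - x) (- y - a) = cross (a+y) (x-a)" "cross (- y - c) (c + - x) = cross (x-c) (c+y)"
    by (metis cross_minus cross_commute)+
qed

lemma regF_neg: "regF a c (-y) (-x) \<longleftrightarrow> regF a c x y"
proof -
  have "- y - - x = x - y" "a + c - - y + - x = a + c - x + y" "2 * a - - y + - x = 2*a - x + y" "2 * c - - y + - x = 2*c - x + y"
    by simp_all
  then show ?thesis unfolding regF_def using cross_neg_args by metis
qed

lemma regT_cases:
  assumes "regT a c x y" "\<not> cross x y" "\<not> cross (a+y) (x-a)" "\<not> cross (x-c) (c+y)"
  shows "regR a c x y"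
proof -
  have "x \<ge> 0" "y \<le> 0" using assms(1,2) unfolding cross_def by linarith+
  moreover have "a \<ge> x" "a \<ge> -y" using assms(1,3) unfolding cross_def by linarith+
  moreover have "c \<ge> x" "c \<ge> -y" using assms(1,4) unfolding cross_def by linarith+
  ultimately show ?thesis by blast
qed

lemma finite_cross: "finite (qset n (\<lambda>a c x y. a > 0 \<and> c > 0 \<and> cross x y))"
proof -
  have "qset n (\<lambda>a c x y. a > 0 \<and> c > 0 \<and> cross x y) \<subseteq> qset n pos4 \<union> (\<lambda>(a,c,x,y). (a,c,-y,-x)) ` qset n pos4"
  proof (rule subsetI)
    fix v assume "v \<in> qset n (\<lambda>a c x y. a > 0 \<and> c > 0 \<and> cross x y)"
    then obtain a c x y where v: "v = (a,c,x,y)" "a > 0" "c > 0" "cross x y" "a*c+x*y=n" by (auto simp: qset_def)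
    then have "(a,c,x,y) \<in> qset n pos4 \<or> (a,c,-y,-x) \<in> qset n pos4" by (auto simp: qset_def cross_def algebra_simps)
    then show "v \<in> qset n pos4 \<union> (\<lambda>(a,c,x,y). (a,c,-y,-x)) ` qset n pos4"
      using v(1) by (auto simp: image_iff intro!: bexI[of _ "(a,c,-y,-x)"])
  qed
  moreover have "finite (qset n pos4)" by (rule finite_qset) auto
  ultimately show ?thesis using finite_subset by blast
qed

text \<open>A point of the cone without crossing lies in \<open>regR\<close>; the other two
  crossings are rotated copies of \<open>cross x y\<close>.\<close>

lemma finite_regF: 
  assumes "n > 0" shows "finite (qset n regF)"
proof -
  let ?rot = "\<lambda>(a,c,x,y). (a+c-x+y,a,a+y,x-a) :: int \<times> int \<times> int \<times> int"
  let ?U = "qset n (\<lambda>a c x y. a > 0 \<and> c > 0 \<and> cross x y)"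
  have inj: "inj ?rot" by (auto simp: inj_on_def)
  have "qset n regF \<subseteq> qset n regR \<union> ?U \<union> ?rot -` ?U \<union> ?rot -` ?rot -` ?U"
  proof (rule subsetI)
    fix v assume "v \<in> qset n regF"
    then obtain a c x y where v: "v = (a,c,x,y)" "regF a c x y" "a*c+x*y=n" by (auto simp: qset_def)
    have "regR a c x y \<or> cross x y \<or> cross (a+y) (x-a) \<or> cross (x-c) (c+y)"
      using v(2) regT_cases[of a c x y] unfolding regF_def by blast
    moreover have "cross (x-c) (c+y) \<longleftrightarrow> cross (c+y) (x-c)" by (auto simp: cross_def)
    ultimately show "v \<in> qset n regR \<union> ?U \<union> ?rot -` ?U \<union> ?rot -` ?rot -` ?U"
      using v unfolding regF_def by (auto simp: qset_def algebra_simps)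
  qed
  moreover have "finite (?rot -` ?U)" using finite_cross inj by (rule finite_vimageI)
  moreover have "finite (?rot -` ?rot -` ?U)" by (rule finite_vimageI[OF _ inj]) fact
  ultimately show ?thesis using finite_regR[OF assms] finite_cross by (meson finite_UnI finite_subset)
qed

lemma square_mod_3:
  assumes "\<not> 3 dvd (t::int)" shows "t^2 mod 3 = 1"
proof -
  have "t mod 3 = 1 \<or> t mod 3 = 2" using assms by presburger
  then have "(t mod 3)^2 mod 3 = 1" by auto
  then show ?thesis by (simp add: power_mod)
qed

lemma ind_nonzero:
  assumes "\<not> 3 dvd n" "ind n t \<noteq> 0" shows "(4*n - t^2) mod 3 = 1"
proof (cases "n mod 3 = 1")
  case True
  then have "3 dvd t" using assms(2) by (simp add: ind_def split: if_splits)
  then obtain k where "t = 3*k" by blast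
  then have "t^2 = 3*(3*k^2)" by (simp add: power2_eq_square)
  then show ?thesis using True by presburger
next
  case False
  then have "n mod 3 = 2" "\<not> 3 dvd t" using assms by (presburger, simp add: ind_def split: if_splits)
  then show ?thesis using square_mod_3[of t] by presburger
qed

text \<open>\<open>-s^2\<close> is never 1 (mod 3). This disposes of degenerate points: the locus
  \<open>a + c - x + y = 0\<close> below, and later the rational integers among the elements of norm
  \<open>n\<close>.\<close>

lemma ind_vanish:
  assumes "\<not> 3 dvd n" "t^2 - 4*n = s^2" shows "ind n t = 0"
proof (rule ccontr)
  assume "ind n t \<noteq> 0"
  then have 1: "s^2 mod 3 = 2" using ind_nonzero[OF assms(1), of t] assms(2) by presburger
  show False
  proof (cases "3 dvd s")
    case True
    then have "3 dvd s^2" by (simp add: power2_eq_square)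
    then show False using 1 by simp
  qed (use 1 square_mod_3[of s] in simp)
qed

text \<open>The involution of \<open>qsum_neg\<close> exchanges the points having
  \<open>x, y\<close> both positive with those having both negative.\<close>

lemma qsum_fold_sign:
  assumes "finite (qset n C)" "\<And>a c x y. C a c (-y) (-x) \<longleftrightarrow> C a c x y" "\<And>a c x y. C a c x y \<Longrightarrow> cross x y"
  shows "qsum n C (trace_ind n) = 2 * qsum n (\<lambda>a c x y. C a c x y \<and> x > 0) (trace_ind n)"
proof -
  have "qsum n (\<lambda>a c x y. C a c x y \<and> \<not> x > 0) (trace_ind n) = qsum n (\<lambda>a c x y. C a c (-y) (-x) \<and> \<not> -y > 0) (\<lambda>a c x y. ind n (-y + -x))"
    by (rule qsum_neg)
  also have "\<dots> = qsum n (\<lambda>a c x y. C a c x y \<and> x > 0) (trace_ind n)"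
  proof (rule qsum_cong)
    fix a c x y show "(C a c (-y) (-x) \<and> \<not> -y > 0) = (C a c x y \<and> x > 0)"
      using assms(2)[of a c y x] assms(3)[of a c x y] unfolding cross_def by (cases "C a c x y") auto
  qed (simp add: ind_neg_sum)
  finally show ?thesis using qsum_split[OF assms(1), of _ "\<lambda>a c x y. x > 0"] by simp
qed

text \<open>Without the condition \<open>a + c - x + y > 0\<close> the sum is 0, because exchanging
  \<open>x\<close> and \<open>y\<close> reverses the sign. So the value is minus the sum over the
  complement: equality contributes nothing by \<open>ind_vanish\<close>, and the rest has
  \<open>x > y\<close>, hence sign 1, and consists of \<open>regQ\<close> and its image under
  \<open>qsum_neg\<close>.\<close>

lemma qsum_cross_part:
  assumes "n > 0" "\<not> 3 dvd n"
  shows "qsum n regF (\<lambda>a c x y. of_bool (cross x y) * (sgn (x-y) * ind n (x+y))) = - 2 * qsum n regQ (trace_ind n)"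
proof -
  let ?C = "\<lambda>a c x y. a > 0 \<and> c > 0 \<and> cross x y"
  let ?h = "\<lambda>a c x y. sgn (x-y) * ind n (x+y)" 
  have "qsum n ?C ?h = qsum n ?C (\<lambda>a c x y. - ?h a c x y)"
    unfolding qsum_def
    by (rule sum.reindex_bij_witness[where i="\<lambda>(a,c,x,y). (a,c,y,x)" and j="\<lambda>(a,c,x,y). (a,c,y,x)"])
       (auto simp: qset_def cross_def algebra_simps sgn_if)
  then have 0: "qsum n ?C ?h = 0" by (simp add: qsum_def case_prod_beta sum_negf)
  have 1: "qsum n regF (\<lambda>a c x y. of_bool (cross x y) * ?h a c x y) = qsum n (\<lambda>a c x y. ?C a c x y \<and> a + c - x + y > 0) ?h"
    unfolding qsum_restrict[OF finite_regF[OF assms(1)]] by (rule qsum_cong) (auto simp: regF_def)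
  have 2: "qsum n (\<lambda>a c x y. ?C a c x y \<and> \<not> a + c - x + y > 0) ?h = qsum n (\<lambda>a c x y. ?C a c x y \<and> a + c - x + y < 0) (trace_ind n)"
  proof -
    have f: "finite (qset n (\<lambda>a c x y. ?C a c x y \<and> \<not> a + c - x + y > 0))"
      by (rule finite_subset[OF _ finite_cross[of n]]) (auto simp: qset_def)
    have "qsum n (\<lambda>a c x y. ?C a c x y \<and> \<not> a + c - x + y > 0) ?h
      = qsum n (\<lambda>a c x y. ?C a c x y \<and> a + c - x + y < 0) ?h + qsum n (\<lambda>a c x y. ?C a c x y \<and> a + c - x + y = 0) ?h"
      by (rule qsum_disjoint[OF f]) auto
    moreover have "qsum n (\<lambda>a c x y. ?C a c x y \<and> a + c - x + y = 0) ?h = qsum n (\<lambda>a c x y. ?C a c x y \<and> a + c - x + y = 0) (\<lambda>a c x y. 0)"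
    proof (rule qsum_cong, simp)
      fix a c x y :: int assume eq: "a*c+x*y = n" and "?C a c x y \<and> a + c - x + y = 0"
      then have "x = a + c + y" by simp
      then have "(x+y)^2 - 4*n = (a-c)^2" unfolding eq[symmetric] by (simp add: power2_eq_square algebra_simps)
      then show "?h a c x y = 0" using ind_vanish[OF assms(2)] by simp
    qed
    moreover have "qsum n (\<lambda>a c x y. ?C a c x y \<and> a + c - x + y < 0) ?h = qsum n (\<lambda>a c x y. ?C a c x y \<and> a + c - x + y < 0) (trace_ind n)"
      by (rule qsum_cong) (auto simp: sgn_if)
    ultimately show ?thesis by (simp add: qsum_zero)
  qed
  have 3: "qsum n (\<lambda>a c x y. ?C a c x y \<and> a + c - x + y < 0) (trace_ind n) = 2 * qsum n regQ (trace_ind n)"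
  proof -
    have f: "finite (qset n (\<lambda>a c x y. ?C a c x y \<and> a + c - x + y < 0))"
      by (rule finite_subset[OF _ finite_cross[of n]]) (auto simp: qset_def)
    have "qsum n (\<lambda>a c x y. (?C a c x y \<and> a + c - x + y < 0) \<and> x > 0) (trace_ind n) = qsum n regQ (trace_ind n)"
      by (rule qsum_cong) (auto simp: cross_def)
    moreover have "qsum n (\<lambda>a c x y. ?C a c x y \<and> a + c - x + y < 0) (trace_ind n)
       = 2 * qsum n (\<lambda>a c x y. (?C a c x y \<and> a + c - x + y < 0) \<and> x > 0) (trace_ind n)"
    proof (rule qsum_fold_sign[OF f])
      fix a c x y :: int
      have "a + c - - y + - x = a + c - x + y" by simp
      then show "((a > 0 \<and> c > 0 \<and> cross (-y) (-x)) \<and> a + c - - y + - x < 0) \<longleftrightarrow> (?C a c x y \<and> a + c - x + y < 0)"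
        by (simp only: cross_neg_args)
    qed blast
    ultimately show ?thesis by simp
  qed
  show ?thesis using 0 1 2 3 qsum_split[OF finite_cross, of n ?h "\<lambda>a c x y. a + c - x + y > 0"] by simp
qed

lemma crossD: "cross x y \<Longrightarrow> x > 0 \<or> y > 0 \<Longrightarrow> x > 0 \<and> y > 0"
  by (auto simp: cross_def)

lemma crossI: "x > 0 \<Longrightarrow> y > 0 \<Longrightarrow> cross x y"
  unfolding cross_def by blast

lemma all_cross_pos:
  "(regF a c x y \<and> cross x y \<and> cross (a+y) (x-a) \<and> cross (x-c) (c+y)) \<and> x > 0 \<longleftrightarrow> regP0 a c x y"
proof (intro iffI)
  assume A: "(regF a c x y \<and> cross x y \<and> cross (a+y) (x-a) \<and> cross (x-c) (c+y)) \<and> x > 0"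
  then have "a > 0" "c > 0" "a + c - x + y > 0" unfolding regF_def by blast+
  moreover have "y > 0" using A crossD by blast
  moreover have "x - a > 0" using A crossD[of "a+y" "x-a"] calculation by linarith
  moreover have "x - c > 0" using A crossD[of "x-c" "c+y"] calculation by linarith
  ultimately show "regP0 a c x y" using A by linarith
next
  assume A: "regP0 a c x y"
  then have "cross x y" "cross (a+y) (x-a)" "cross (x-c) (c+y)" by (auto intro!: crossI)
  moreover have "x > 0" "a > 0" "c > 0" "a + c - x + y > 0" using A by linarith+
  ultimately show "(regF a c x y \<and> cross x y \<and> cross (a+y) (x-a) \<and> cross (x-c) (c+y)) \<and> x > 0"
    unfolding regF_def by blast
qed

lemma one_cross_pos:
  "(regF a c x y \<and> cross x y \<and> \<not> cross (a+y) (x-a) \<and> \<not> cross (x-c) (c+y)) \<and> x > 0 \<longleftrightarrow> regP2 a c x y"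
proof (intro iffI)
  assume A: "(regF a c x y \<and> cross x y \<and> \<not> cross (a+y) (x-a) \<and> \<not> cross (x-c) (c+y)) \<and> x > 0"
  then have 1: "a > 0" "c > 0" unfolding regF_def by blast+
  moreover have 2: "y > 0" using A crossD by blast
  moreover have "\<not> x - a > 0" using A crossI[of "a+y" "x-a"] 1 2 by linarith
  moreover have "\<not> x - c > 0" using A crossI[of "x-c" "c+y"] 1 2 by linarith
  ultimately show "regP2 a c x y" using A by linarith
next
  assume A: "regP2 a c x y"
  then have "cross x y" by (auto intro!: crossI)
  moreover have "\<not> cross (a+y) (x-a)" using A crossD[of "a+y" "x-a"] by linarith
  moreover have "\<not> cross (x-c) (c+y)" using A crossD[of "x-c" "c+y"] by linarith
  moreover have "x > 0" "a > 0" "c > 0" "a + c - x + y > 0" using A by linarith+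
  ultimately show "(regF a c x y \<and> cross x y \<and> \<not> cross (a+y) (x-a) \<and> \<not> cross (x-c) (c+y)) \<and> x > 0"
    unfolding regF_def by blast
qed

lemma qsum_all_cross:
  assumes "n > 0"
  shows "qsum n regF (\<lambda>a c x y. of_bool (cross x y \<and> cross (a+y) (x-a) \<and> cross (x-c) (c+y)) * ind n (x+y)) = 2 * qsum n regP0 (trace_ind n)"
proof -
  have f: "finite (qset n (\<lambda>a c x y. regF a c x y \<and> cross x y \<and> cross (a+y) (x-a) \<and> cross (x-c) (c+y)))"
    by (rule finite_subset[OF _ finite_regF[OF assms]]) (auto simp: qset_def)
  show ?thesis unfolding qsum_restrict[OF finite_regF[OF assms]] 
    by (subst qsum_fold_sign[OF f]) (simp_all only: regF_neg cross_neg_args all_cross_pos)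
qed

lemma qsum_one_cross:
  assumes "n > 0"
  shows "qsum n regF (\<lambda>a c x y. of_bool (cross x y \<and> \<not> cross (a+y) (x-a) \<and> \<not> cross (x-c) (c+y)) * ind n (x+y)) = 2 * qsum n regP2 (trace_ind n)"
proof -
  have f: "finite (qset n (\<lambda>a c x y. regF a c x y \<and> cross x y \<and> \<not> cross (a+y) (x-a) \<and> \<not> cross (x-c) (c+y)))"
    by (rule finite_subset[OF _ finite_regF[OF assms]]) (auto simp: qset_def)
  show ?thesis unfolding qsum_restrict[OF finite_regF[OF assms]] 
    by (subst qsum_fold_sign[OF f]) (simp_all only: regF_neg cross_neg_args one_cross_pos)
qed

lemma qsum_regF_rot: "qsum n regF (\<lambda>a c x y. h a c x y) = qsum n regF (\<lambda>a c x y. h (a+c-x+y) a (a+y) (x-a))"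
  by (subst qsum_rot) (simp only: regF_rot)

text \<open>These points form \<open>regR\<close>, where the weight is 2 minus the number of zeros
  among \<open>u, v, w\<close>. A zero forces \<open>x = y = 0\<close>, \<open>a = x = -y\<close> or
  \<open>c = x = -y\<close>; in each case the trace is 0 and the points are the factorizations of
  \<open>n\<close>, which yields one \<open>ind n 0\<close> per divisor.\<close>

lemma qsum_none_cross:
  assumes "n > 0" "\<not> 3 dvd n"
  shows "qsum n regF (\<lambda>a c x y. of_bool (\<not> cross x y \<and> \<not> cross (a+y) (x-a) \<and> \<not> cross (x-c) (c+y)) * (regT_weight a c x y * ind n (x+y)))
     = 2 * qsum n regR (trace_ind n) - 3 * ind n 0 * int (card (posdivs n))"
proof -
  have nz: "a + c - x + y \<noteq> 0" if "regR a c x y" "a*c+x*y = n" for a c x y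
  proof
    assume "a + c - x + y = 0"
    then have "a = x" "c = -y" using that(1) by linarith+
    then show False using that(2) assms(1) by simp
  qed
  have pos: "a > 0 \<and> c > 0" if "regR a c x y" "a*c+x*y = n" for a c x y
  proof -
    have "a \<noteq> 0" "c \<noteq> 0" using that assms(1) by auto
    then show ?thesis using that(1) by linarith
  qed
  have 1: "qsum n regF (\<lambda>a c x y. of_bool (\<not> cross x y \<and> \<not> cross (a+y) (x-a) \<and> \<not> cross (x-c) (c+y)) * (regT_weight a c x y * ind n (x+y)))
      = qsum n regR (\<lambda>a c x y. 2 * ind n (x+y) - of_bool (x = y) * ind n (x+y) - of_bool (2*a-x+y = 0) * ind n (x+y) - of_bool (2*c-x+y=0) * ind n (x+y))"
    unfolding qsum_restrict[OF finite_regF[OF assms(1)]]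
  proof (rule qsum_cong)
    fix a c x y :: int assume eq: "a*c+x*y = n"
    show "(regF a c x y \<and> \<not> cross x y \<and> \<not> cross (a+y) (x-a) \<and> \<not> cross (x-c) (c+y)) = regR a c x y"
    proof
      assume "regF a c x y \<and> \<not> cross x y \<and> \<not> cross (a+y) (x-a) \<and> \<not> cross (x-c) (c+y)"
      then show "regR a c x y" using regT_cases unfolding regF_def by blast
    next
      assume R: "regR a c x y"
      have "a > 0" "c > 0" "a + c - x + y > 0" using pos[OF R eq] nz[OF R eq] R by linarith+
      moreover have "\<not> cross x y" "\<not> cross (a+y) (x-a)" "\<not> cross (x-c) (c+y)" using R unfolding cross_def by linarith+
      moreover have "x - y \<ge> 0 \<and> 2*a - x + y \<ge> 0 \<and> 2*c - x + y \<ge> 0" using R by linarith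
      ultimately show "regF a c x y \<and> \<not> cross x y \<and> \<not> cross (a+y) (x-a) \<and> \<not> cross (x-c) (c+y)"
        unfolding regF_def by blast
    qed
    assume R: "regR a c x y"
    have sg: "sgn (x-y) = 1 - of_bool (x = y)" "sgn (2*a-x+y) = 1 - of_bool (2*a-x+y = 0)" "sgn (2*c-x+y) = 1 - of_bool (2*c-x+y=0)"
      using R by (simp_all add: sgn_if)
    have gen: "(1 - p + (1 - q) + (1 - r) - 1) * F = 2 * F - p * F - q * F - r * F" for p q r F :: int by (simp add: algebra_simps)
    show "regT_weight a c x y * ind n (x+y) = 2 * ind n (x+y) - of_bool (x = y) * ind n (x+y) - of_bool (2*a-x+y = 0) * ind n (x+y) - of_bool (2*c-x+y=0) * ind n (x+y)"
      unfolding sg by (rule gen)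
  qed
  have card: "(\<Sum>d\<in>posdivs n. ind n 0) = ind n 0 * int (card (posdivs n))" by simp
  have e: "d * (n div d) = n" "n div d > 0" if "d \<in> posdivs n" for d
    using that assms(1) by (auto simp: posdivs_def pos_imp_zdiv_pos_iff zdvd_imp_le)
  have 2: "qsum n (\<lambda>a c x y. regR a c x y \<and> x = y) (trace_ind n) = ind n 0 * int (card (posdivs n))"
    unfolding card[symmetric] qsum_def
  proof (rule sum.reindex_bij_witness[where i="\<lambda>d. (d, n div d, 0, 0)" and j="\<lambda>(a,c,x,y). a"], goal_cases)
    case (1 v)
    then obtain a c where v: "v = (a,c,0,0)" "regR a c 0 0" "a*c = n" by (auto simp: qset_def)
    then have "a > 0" using pos[OF v(2)] by simp
    then show ?case using v by auto
  next case (2 v) 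
    then obtain a c where v: "v = (a,c,0,0)" "regR a c 0 0" "a*c = n" by (auto simp: qset_def)
    then have "a > 0" using pos[OF v(2)] by simp
    then show ?case using v by (auto simp: posdivs_def)
  next case (4 d) then show ?case using e[of d] by (auto simp: qset_def posdivs_def)
  qed (auto simp: qset_def)
  have 3: "qsum n (\<lambda>a c x y. regR a c x y \<and> 2*a-x+y = 0) (trace_ind n) = ind n 0 * int (card (posdivs n))"
    unfolding card[symmetric] qsum_def
  proof (rule sum.reindex_bij_witness[where i="\<lambda>d. (d, n div d + d, d, -d)" and j="\<lambda>(a,c,x,y). a"], goal_cases)
    case (1 v) 
    then obtain a c x y where v: "v = (a,c,x,y)" "regR a c x y" "2*a-x+y=0" "a*c+x*y=n" by (auto simp: qset_def)
    then have h: "x = a" "y = -a" by linarith+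
    then have h: "x = a" "y = -a" "a * (c - a) = n" "a > 0" using v(4) pos[OF v(2,4)] by (auto simp: algebra_simps)
    then have "n div a = c - a" by (metis nonzero_mult_div_cancel_left less_irrefl)
    then show ?case using h v by simp
  next case (2 v) 
    then obtain a c x y where v: "v = (a,c,x,y)" "regR a c x y" "2*a-x+y=0" "a*c+x*y=n" by (auto simp: qset_def)
    then have h: "x = a" "y = -a" by linarith+
    then have h: "x = a" "y = -a" "a * (c - a) = n" "a > 0" using v(4) pos[OF v(2,4)] by (auto simp: algebra_simps)
    then have "a dvd n" by (metis dvd_triv_left)
    then show ?case using h v by (simp add: posdivs_def)
  next case (4 d) then show ?case using e[of d] by (auto simp: qset_def posdivs_def algebra_simps)
  next case (5 v)
    then obtain a c x y where v: "v = (a,c,x,y)" "regR a c x y" "2*a-x+y=0" by (auto simp: qset_def)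
    then have "x + y = 0" by linarith
    then have "ind n (x+y) = ind n 0" by (rule arg_cong)
    then show ?case by (simp add: v(1))
  qed (auto simp: qset_def)
  have 4: "qsum n (\<lambda>a c x y. regR a c x y \<and> 2*c-x+y = 0) (trace_ind n) = qsum n (\<lambda>a c x y. regR a c x y \<and> 2*a-x+y = 0) (trace_ind n)"
    unfolding qsum_def
    by (rule sum.reindex_bij_witness[where i="\<lambda>(a,c,x,y). (c,a,x,y)" and j="\<lambda>(a,c,x,y). (c,a,x,y)"]) (auto simp: qset_def algebra_simps)
  show ?thesis unfolding 1 qsum_diff qsum_cmult qsum_restrict[OF finite_regR[OF assms(1)]] 2 3 4 by simp
qed

text \<open>If an entry does not cross while another one does, it has the larger absolute value, and
  their sum is positive; so it is positive itself. Thus, as soon as one entry crosses, only the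
  signs of crossing entries are open, and the eight cases can be checked.\<close>

lemma weight_split:
  assumes "regF a c x y"
  defines "p \<equiv> cross x y" and "q \<equiv> cross (a+y) (x-a)" and "r \<equiv> cross (x-c) (c+y)"
  shows "regT_weight a c x y
     = of_bool p * sgn (x-y) + of_bool q * sgn (2*a-x+y) + of_bool r * sgn (2*c-x+y) - of_bool (p \<and> q \<and> r)
       + of_bool (p \<and> \<not> q \<and> \<not> r) + of_bool (q \<and> \<not> r \<and> \<not> p) + of_bool (r \<and> \<not> p \<and> \<not> q)
       + of_bool (\<not> p \<and> \<not> q \<and> \<not> r) * regT_weight a c x y"
proof -
  have cr: "cross s t \<longleftrightarrow> \<bar>s - t\<bar> < \<bar>s + t\<bar>" for s t unfolding cross_def by linarith
  have p: "p \<longleftrightarrow> \<bar>x - y\<bar> < \<bar>x + y\<bar>" unfolding p_def cr by simp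
  have "a + y - (x - a) = 2*a-x+y" "a + y + (x - a) = x + y" "x - c - (c + y) = - (2*c-x+y)" "x - c + (c + y) = x + y" by simp_all
  then have q: "q \<longleftrightarrow> \<bar>2*a-x+y\<bar> < \<bar>x + y\<bar>" and r: "r \<longleftrightarrow> \<bar>2*c-x+y\<bar> < \<bar>x + y\<bar>" unfolding q_def r_def cr by (simp_all only: abs_minus_cancel)
  define u v w t where "u = x - y" "v = 2*a-x+y" "w = 2*c-x+y" "t = \<bar>x+y\<bar>"
  note uvw = this
  have s: "u + v > 0" "u + w > 0" "v + w > 0" using assms(1) unfolding regF_def uvw by linarith+
  have one: "sgn z = 1" if "z > 0" for z :: int using that by simp
  have pqr: "p \<longleftrightarrow> \<bar>u\<bar> < t" "q \<longleftrightarrow> \<bar>v\<bar> < t" "r \<longleftrightarrow> \<bar>w\<bar> < t" using p q r unfolding uvw by auto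
  have pos: "u > 0" if "q \<or> r" "\<not> p" using that s pqr by (auto simp: abs_if split: if_splits)
  have posv: "v > 0" if "p \<or> r" "\<not> q" using that s pqr by (auto simp: abs_if split: if_splits)
  have posw: "w > 0" if "p \<or> q" "\<not> r" using that s pqr by (auto simp: abs_if split: if_splits)
  have "sgn u + sgn v + sgn w - 1
     = of_bool p * sgn u + of_bool q * sgn v + of_bool r * sgn w - of_bool (p \<and> q \<and> r)
       + of_bool (p \<and> \<not> q \<and> \<not> r) + of_bool (q \<and> \<not> r \<and> \<not> p) + of_bool (r \<and> \<not> p \<and> \<not> q)
       + of_bool (\<not> p \<and> \<not> q \<and> \<not> r) * (sgn u + sgn v + sgn w - 1)"
    using pos posv posw by (cases p; cases q; cases r; simp)
  then show ?thesis unfolding uvw .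
qed

lemma qsum_T_eq_F:
  assumes "n > 0"
  shows "qsum n regT (\<lambda>a c x y. regT_weight a c x y * ind n (x+y))
    = qsum n regF (\<lambda>a c x y. regT_weight a c x y * ind n (x+y))" (is "qsum n regT ?h = _")
proof -
  have "qsum n (\<lambda>a c x y. regF a c x y \<and> regT a c x y) ?h = qsum n regT ?h"
    by (rule qsum_cong) (auto simp: regF_def)
  moreover have "qsum n (\<lambda>a c x y. regF a c x y \<and> \<not> regT a c x y) ?h = qsum n (\<lambda>a c x y. regF a c x y \<and> \<not> regT a c x y) (\<lambda>a c x y. 0)"
  proof (rule qsum_cong, simp)
    fix a c x y :: int assume "regF a c x y \<and> \<not> regT a c x y"
    then have "a > 0" "c > 0" "a + c - x + y > 0" "x - y < 0 \<or> 2*a - x + y < 0 \<or> 2*c - x + y < 0" unfolding regF_def by auto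
    then have "regT_weight a c x y = 0" by (elim disjE) (simp_all add: sgn_if)
    then show "?h a c x y = 0" by simp
  qed
  ultimately show ?thesis using qsum_split[OF finite_regF[OF assms], of ?h regT] by (simp add: qsum_zero)
qed

text \<open>The rotation makes the three single-crossing terms equal, and likewise the three sign
  terms; this triples both and produces the combination of \<open>ties_collect\<close>.\<close>

theorem weighted_triples_sum:
  assumes "n > 0" "\<not> 3 dvd n"
  shows "qsum n regT (\<lambda>a c x y. regT_weight a c x y * ind n (x+y))
    = (if n mod 3 = 1 then 3 else 6) * (\<Sum>d\<in>posdivs n. d)"
proof -
  let ?p = "\<lambda>a c x y. cross x y" and ?q = "\<lambda>a c x y. cross (a+y) (x-a)" and ?r = "\<lambda>a c x y. cross (x-c) (c+y)"
  let ?U = "\<lambda>a c x y. of_bool (cross x y) * (sgn (x-y) * ind n (x+y))"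
  let ?V = "\<lambda>a c x y. of_bool (cross (a+y) (x-a)) * (sgn (2*a-x+y) * ind n (x+y))"
  let ?W = "\<lambda>a c x y. of_bool (cross (x-c) (c+y)) * (sgn (2*c-x+y) * ind n (x+y))"
  let ?A = "\<lambda>a c x y. of_bool (cross x y \<and> cross (a+y) (x-a) \<and> cross (x-c) (c+y)) * ind n (x+y)"
  let ?B1 = "\<lambda>a c x y. of_bool (cross x y \<and> \<not> cross (a+y) (x-a) \<and> \<not> cross (x-c) (c+y)) * ind n (x+y)"
  let ?B2 = "\<lambda>a c x y. of_bool (cross (a+y) (x-a) \<and> \<not> cross (x-c) (c+y) \<and> \<not> cross x y) * ind n (x+y)"
  let ?B3 = "\<lambda>a c x y. of_bool (cross (x-c) (c+y) \<and> \<not> cross x y \<and> \<not> cross (a+y) (x-a)) * ind n (x+y)"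
  let ?N = "\<lambda>a c x y. of_bool (\<not> cross x y \<and> \<not> cross (a+y) (x-a) \<and> \<not> cross (x-c) (c+y)) * (regT_weight a c x y * ind n (x+y))"
  have com: "cross (c+y) (x-c) = cross (x-c) (c+y)" "cross y x = cross x y" for c x y by (rule cross_commute)+
  have UV: "qsum n regF ?V = qsum n regF ?U" by (subst (2) qsum_regF_rot) (simp only: rot_args com)
  have VW: "qsum n regF ?W = qsum n regF ?V" by (subst (2) qsum_regF_rot) (simp only: rot_args com)
  have B12: "qsum n regF ?B2 = qsum n regF ?B1" by (subst (2) qsum_regF_rot) (simp only: rot_args com)
  have B23: "qsum n regF ?B3 = qsum n regF ?B2" by (subst (2) qsum_regF_rot) (simp only: rot_args com)
  have "qsum n regF (\<lambda>a c x y. regT_weight a c x y * ind n (x+y))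
    = qsum n regF (\<lambda>a c x y. ?U a c x y + ?V a c x y + ?W a c x y - ?A a c x y + ?B1 a c x y + ?B2 a c x y + ?B3 a c x y + ?N a c x y)"
  proof (rule qsum_cong, simp)
    fix a c x y assume F: "regF a c x y"
    show "regT_weight a c x y * ind n (x+y) = ?U a c x y + ?V a c x y + ?W a c x y - ?A a c x y + ?B1 a c x y + ?B2 a c x y + ?B3 a c x y + ?N a c x y"
      by (subst weight_split[OF F]) (simp only: left_diff_distrib distrib_right mult.assoc)
  qed
  then show ?thesis
    using qsum_T_eq_F[OF assms(1)] qsum_cross_part[OF assms] qsum_all_cross[OF assms(1)] qsum_one_cross[OF assms(1)] qsum_none_cross[OF assms]
      ties_collect[OF assms] tie_total_sum[OF assms]
    unfolding qsum_add qsum_diff UV VW B12 B23 by linarith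
qed

section \<open>Reduced forms and the class number relation\<close>

lemma form_act_comp:
  "form_act (form_act f p q r s) p' q' r' s' = form_act f (p*p'+q*r') (p*q'+q*s') (r*p'+s*r') (r*q'+s*s')"
  by (cases f) (simp add: form_act_def algebra_simps power2_eq_square)

lemma form_act_id: "form_act f 1 0 0 1 = f"
  by (cases f) (simp add: form_act_def)

lemma form_act_inv:
  assumes "p*s - q*r = 1" shows "form_act (form_act f p q r s) s (-q) (-r) p = f"
proof -
  have "p*s + q*(-r) = 1" "r*(-q)+s*p = 1" "p*(-q)+q*p = 0" "r*s+s*(-r) = 0" using assms by (simp_all add: algebra_simps)
  then show ?thesis unfolding form_act_comp by (simp only: form_act_id)
qed

lemma equiv_sl2: "equiv (pd_forms N) (sl2_equiv N)"
proof (rule equivI)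
  show "sl2_equiv N \<subseteq> pd_forms N \<times> pd_forms N" by (auto simp: sl2_equiv_def)
  show "refl_on (pd_forms N) (sl2_equiv N)"
  proof (rule refl_onI)
    fix f assume "f \<in> pd_forms N"
    moreover have "1*1 - 0*(0::int) = 1 \<and> f = form_act f 1 0 0 1" by (simp add: form_act_id)
    ultimately show "(f,f) \<in> sl2_equiv N" unfolding sl2_equiv_def by blast
  qed
  show "sym (sl2_equiv N)"
  proof (rule symI)
    fix f g assume "(f,g) \<in> sl2_equiv N"
    then obtain p q r s where h: "f \<in> pd_forms N" "g \<in> pd_forms N" "p*s - q*r = 1" "g = form_act f p q r s"
      unfolding sl2_equiv_def by auto
    have "s*p - (-q)*(-r) = 1" "f = form_act g s (-q) (-r) p" using h form_act_inv[of p s q r f] by (simp_all add: algebra_simps)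
    then show "(g,f) \<in> sl2_equiv N" unfolding sl2_equiv_def using h by blast
  qed
  show "trans (sl2_equiv N)"
  proof (rule transI)
    fix f g k assume "(f,g) \<in> sl2_equiv N" "(g,k) \<in> sl2_equiv N"
    then obtain p q r s p' q' r' s' where h: "f \<in> pd_forms N" "k \<in> pd_forms N" "p*s - q*r = 1" "p'*s' - q'*r' = 1" 
        "k = form_act (form_act f p q r s) p' q' r' s'"
      unfolding sl2_equiv_def by auto
    have "(p*p'+q*r')*(r*q'+s*s') - (p*q'+q*s')*(r*p'+s*r') = (p*s-q*r)*(p'*s'-q'*r')" by (simp add: algebra_simps)
    then have "(p*p'+q*r')*(r*q'+s*s') - (p*q'+q*s')*(r*p'+s*r') = 1" using h by simp
    then show "(f,k) \<in> sl2_equiv N" unfolding sl2_equiv_def using h form_act_comp by blast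
  qed
qed

lemma pd_formsD: 
  assumes "(a,b,c) \<in> pd_forms N" "N > 0" shows "a > 0" "c > 0" "4*a*c - b^2 = N"
proof -
  show a: "a > 0" and e: "4*a*c - b^2 = N" using assms by (auto simp: pd_forms_def)
  have "a*c > 0" using e assms(2) zero_le_power2[of b] by linarith
  then show "c > 0" using a by (simp add: zero_less_mult_iff)
qed

lemma pd_forms_translate: "(a,b,c) \<in> pd_forms N \<Longrightarrow> (a, b + 2*a*k, a*k^2 + b*k + c) \<in> pd_forms N"
  by (auto simp: pd_forms_def power2_eq_square algebra_simps)

lemma equiv_translate: "(a,b,c) \<in> pd_forms N \<Longrightarrow> ((a,b,c), (a, b + 2*a*k, a*k^2 + b*k + c)) \<in> sl2_equiv N"
proof -
  assume h: "(a,b,c) \<in> pd_forms N"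
  have "(a, b + 2*a*k, a*k^2 + b*k + c) = form_act (a,b,c) 1 k 0 1" by (simp add: form_act_def algebra_simps)
  moreover have "1*1 - k*0 = (1::int)" by simp
  ultimately show ?thesis unfolding sl2_equiv_def using h pd_forms_translate by blast
qed

lemma equiv_flip: 
  assumes "(a,b,c) \<in> pd_forms N" "N > 0" shows "((a,b,c), (c,-b,a)) \<in> sl2_equiv N"
proof -
  have "(c,-b,a) = form_act (a,b,c) 0 (-1) 1 0" by (simp add: form_act_def)
  moreover have "(c,-b,a) \<in> pd_forms N" using assms pd_formsD[OF assms] by (auto simp: pd_forms_def)
  moreover have "0*0 - (-1)*1 = (1::int)" by simp
  ultimately show ?thesis unfolding sl2_equiv_def using assms by blast
qed

definition reduced_forms :: "int \<Rightarrow> qform set" where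
  "reduced_forms N = {(a,b,c). (a,b,c) \<in> pd_forms N \<and> \<bar>b\<bar> \<le> a \<and> a \<le> c \<and> (\<bar>b\<bar> = a \<or> a = c \<longrightarrow> b \<ge> 0)}"

text \<open>Take a form of the class with least leading coefficient and translate it. The flip stays
  in the class, so minimality gives \<open>a \<le> c'\<close>; one more flip settles
  \<open>a = c'\<close> with negative middle coefficient.\<close>

lemma reduced_form_exists:
  assumes "g \<in> pd_forms N" "N > 0"
  shows "\<exists>f \<in> reduced_forms N. (g,f) \<in> sl2_equiv N"
proof -
  let ?P = "\<lambda>f. (g,f) \<in> sl2_equiv N"
  note tr = equivE[OF equiv_sl2[of N]]
  have trans: "(f,k) \<in> sl2_equiv N \<Longrightarrow> ?P f \<Longrightarrow> ?P k" for f k using equiv_sl2[of N] by (meson equivE transE)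
  have refl: "?P g" using equiv_sl2[of N] assms(1) by (meson equivE refl_onD)
  have inpd: "?P f \<Longrightarrow> f \<in> pd_forms N" for f by (auto simp: sl2_equiv_def)
  obtain f where f: "?P f" "\<And>k. ?P k \<Longrightarrow> nat (fst f) \<le> nat (fst k)"
    using ex_has_least_nat[of ?P g "\<lambda>f. nat (fst f)"] refl by blast
  obtain a b c where abc: "f = (a,b,c)" by (cases f) auto
  have pd: "(a,b,c) \<in> pd_forms N" using inpd f abc by auto
  have a: "a > 0" using pd_formsD[OF pd assms(2)] by simp
  define k where "k = (a - b) div (2*a)"
  define b' c' where "b' = b + 2*a*k" and "c' = a*k^2 + b*k + c"
  have "(a - b) mod (2*a) = a - b - 2*a*k" unfolding k_def by (simp add: minus_mult_div_eq_mod)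
  then have b': "-a < b'" "b' \<le> a" using a pos_mod_sign[of "2*a" "a-b"] pos_mod_bound[of "2*a" "a-b"] unfolding b'_def by linarith+
  have P': "?P (a,b',c')" using trans[OF equiv_translate[OF pd, of k]] f(1) abc unfolding b'_def c'_def by simp
  have pd': "(a,b',c') \<in> pd_forms N" using inpd P' by auto
  have P'': "?P (c',-b',a)" using trans[OF equiv_flip[OF pd' assms(2)] P'] .
  have "nat a \<le> nat c'" using f(2)[OF P''] abc by simp
  then have ac: "a \<le> c'" using pd_formsD[OF pd' assms(2)] by simp
  show ?thesis
  proof (cases "a = c' \<and> b' < 0")
    case True
    have "(c',-b',a) \<in> reduced_forms N" using True b' inpd[OF P''] unfolding reduced_forms_def by auto
    then show ?thesis using P'' by blast
  next
    case False
    have "(a,b',c') \<in> reduced_forms N" using False b' ac pd' unfolding reduced_forms_def by auto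
    then show ?thesis using P' by blast
  qed
qed

lemma reduced_lower_bound:
  fixes a b c x y :: int
  assumes "\<bar>b\<bar> \<le> a" "a \<le> c" "y \<noteq> 0" "a > 0"
  shows "c \<le> a*x^2 + b*x*y + c*y^2"
proof -
  have "\<bar>b*x*y\<bar> \<le> a * (\<bar>x\<bar>*\<bar>y\<bar>)" using assms by (simp add: abs_mult mult.assoc mult_right_mono)
  then have 1: "a*x^2 + b*x*y + c*y^2 \<ge> a*(\<bar>x\<bar>^2 - \<bar>x\<bar>*\<bar>y\<bar>) + c*\<bar>y\<bar>^2" by (simp add: algebra_simps)
  have y: "\<bar>y\<bar> \<ge> 1" using assms by simp
  show ?thesis
  proof (cases "\<bar>x\<bar> \<ge> \<bar>y\<bar>")
    case True
    then have "\<bar>x\<bar>^2 - \<bar>x\<bar>*\<bar>y\<bar> \<ge> 0" using mult_left_mono[OF True, of "\<bar>x\<bar>"] by (simp add: power2_eq_square)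
    then have "a*(\<bar>x\<bar>^2 - \<bar>x\<bar>*\<bar>y\<bar>) \<ge> 0" using assms by simp
    moreover have "c * \<bar>y\<bar>^2 \<ge> c * 1" using one_le_power[OF y, of 2] assms by (intro mult_left_mono) simp_all
    ultimately show ?thesis using 1 by linarith
  next
    case False
    then have "\<bar>x\<bar>^2 - \<bar>x\<bar>*\<bar>y\<bar> \<le> 0" using mult_left_mono[of "\<bar>x\<bar>" "\<bar>y\<bar>" "\<bar>x\<bar>"] by (simp add: power2_eq_square)
    then have "a*(\<bar>x\<bar>^2 - \<bar>x\<bar>*\<bar>y\<bar>) \<ge> c*(\<bar>x\<bar>^2 - \<bar>x\<bar>*\<bar>y\<bar>)" using assms by (intro mult_right_mono_neg) auto
    then have "a*(\<bar>x\<bar>^2 - \<bar>x\<bar>*\<bar>y\<bar>) + c*\<bar>y\<bar>^2 \<ge> c * (\<bar>x\<bar>^2 - \<bar>x\<bar>*\<bar>y\<bar> + \<bar>y\<bar>^2)" by (simp add: algebra_simps)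
    moreover have "\<bar>x\<bar>^2 - \<bar>x\<bar>*\<bar>y\<bar> + \<bar>y\<bar>^2 \<ge> 1"
    proof -
      have "\<bar>x\<bar>^2 - \<bar>x\<bar>*\<bar>y\<bar> + \<bar>y\<bar>^2 = \<bar>x\<bar>^2 + \<bar>y\<bar>*(\<bar>y\<bar> - \<bar>x\<bar>)" by (simp add: power2_eq_square algebra_simps)
      moreover have "\<bar>y\<bar>*(\<bar>y\<bar> - \<bar>x\<bar>) \<ge> 1 * 1" using y False by (intro mult_mono) auto
      ultimately show ?thesis by (metis add_increasing mult_1 zero_le_power2)
    qed
    then have "c * (\<bar>x\<bar>^2 - \<bar>x\<bar>*\<bar>y\<bar> + \<bar>y\<bar>^2) \<ge> c * 1" using assms by (intro mult_left_mono) auto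
    ultimately show ?thesis using 1 by linarith
  qed
qed

text \<open>\<open>a'\<close> is the value of the first form at \<open>(p, r)\<close>, hence at
  least \<open>c\<close> unless \<open>r = 0\<close>. In that case the substitution is a translation
  up to sign, and the boundary conventions leave only the trivial one. It is used in both
  directions.\<close>

lemma reduced_unique_aux:
  assumes "(a,b,c) \<in> reduced_forms N" "(a',b',c') \<in> reduced_forms N" "N > 0" 
    "p*s - q*r = 1" "(a',b',c') = form_act (a,b,c) p q r s"
  shows "a \<le> a'" "a < c \<Longrightarrow> r \<noteq> 0 \<Longrightarrow> a < a'" "r = 0 \<Longrightarrow> a' = a \<and> b' = b"
proof -
  have pd: "(a,b,c) \<in> pd_forms N" and red: "\<bar>b\<bar> \<le> a" "a \<le> c" "\<bar>b\<bar> = a \<Longrightarrow> b \<ge> 0" using assms(1) by (auto simp: reduced_forms_def)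
  have red': "\<bar>b'\<bar> \<le> a'" "\<bar>b'\<bar> = a' \<Longrightarrow> b' \<ge> 0" using assms(2) by (auto simp: reduced_forms_def)
  have a: "a > 0" using pd_formsD[OF pd assms(3)] by simp
  have a': "a' = a*p^2 + b*p*r + c*r^2" and b': "b' = 2*a*p*q + b*(p*s + q*r) + 2*c*r*s" using assms(5) by (auto simp: form_act_def)
  show r0: "a' = a \<and> b' = b" if "r = 0"
  proof -
    have ps: "p*s = 1" using assms(4) that by simp
    then have "p = 1 \<and> s = 1 \<or> p = -1 \<and> s = -1" using pos_zmult_eq_1_iff_lemma zmult_eq_1_iff by blast
    then have p2: "p^2 = 1" by auto
    have aa: "a' = a" using a' p2 that by simp
    have "b' = b + 2*a*(p*q)" using b' that ps by (simp add: algebra_simps)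
    then obtain k where k: "b' = b + 2*a*k" by blast
    have "\<bar>b'\<bar> \<le> a" using red' aa by simp
    then have "\<bar>2*a*k\<bar> \<le> 2*a" using k red by linarith
    then have "a * \<bar>k\<bar> \<le> a * 1" using a by (simp add: abs_mult)
    then have "\<bar>k\<bar> \<le> 1" using a by (simp only: mult_le_cancel_left_pos)
    then have "k = 0 \<or> k = 1 \<or> k = -1" by linarith
    then show ?thesis
    proof (elim disjE)
      assume "k = 1" then have "b = -a" using k red \<open>\<bar>b'\<bar> \<le> a\<close> a by simp
      then show ?thesis using red(3) a by simp
    next
      assume "k = -1" then have "b' = -a" using k red \<open>\<bar>b'\<bar> \<le> a\<close> a by simp
      then show ?thesis using red'(2) aa a by simp
    qed (use k aa in simp)
  qed
  have rn: "c \<le> a'" if "r \<noteq> 0" using reduced_lower_bound[OF red(1,2) that a, of p] a' by simp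
  show "a \<le> a'" using r0 rn red by (cases "r = 0") auto
  show "a < c \<Longrightarrow> r \<noteq> 0 \<Longrightarrow> a < a'" using rn by linarith
qed

lemma reduced_unique:
  assumes "f \<in> reduced_forms N" "g \<in> reduced_forms N" "(f,g) \<in> sl2_equiv N" "N > 0"
  shows "f = g"
proof -
  obtain a b c a' b' c' where fg: "f = (a,b,c)" "g = (a',b',c')" by (cases f, cases g) auto
  obtain p q r s where h: "p*s - q*r = 1" "g = form_act f p q r s" using assms(3) by (auto simp: sl2_equiv_def)
  have h': "s*p - (-q)*(-r) = 1" "f = form_act g s (-q) (-r) p" using h form_act_inv[of p s q r f] by (simp_all add: algebra_simps)
  note A = reduced_unique_aux[OF assms(1)[unfolded fg] assms(2)[unfolded fg] assms(4) h(1) h(2)[unfolded fg]]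
  note B = reduced_unique_aux[OF assms(2)[unfolded fg] assms(1)[unfolded fg] assms(4) h'(1) h'(2)[unfolded fg]]
  have aa: "a = a'" using A(1) B(1) by simp
  have pd: "a > 0" "4*a*c - b^2 = N" "4*a*c' - b'^2 = N" 
    using assms(1,2,4) pd_formsD unfolding fg aa reduced_forms_def by blast+
  have le: "a \<le> c" "a' \<le> c'" using assms(1,2) unfolding fg reduced_forms_def by auto
  have bb: "b = b'"
  proof (cases "r = 0")
    case True then show ?thesis using A(3) by simp
  next
    case False
    then have "a = c" "a' = c'" using A(2) B(2) aa le by force+
    then have "b \<ge> 0" "b' \<ge> 0" "b^2 = b'^2" using assms(1,2) pd aa unfolding fg reduced_forms_def by auto
    then show ?thesis using power2_eq_iff_nonneg by blast
  qed
  then have "4*a*(c - c') = 0" using pd by (simp add: algebra_simps)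
  then have "c = c'" using pd(1) by simp
  then show ?thesis using fg aa bb by simp
qed

lemma finite_reduced: 
  assumes "N > 0" shows "finite (reduced_forms N)"
proof (rule finite_subset)
  show "reduced_forms N \<subseteq> {0..N} \<times> {-N..N} \<times> {0..N}"
  proof
    fix f assume f: "f \<in> reduced_forms N"
    obtain a b c where abc: "f = (a,b,c)" by (cases f) auto
    have r: "\<bar>b\<bar> \<le> a" "a \<le> c" "(a,b,c) \<in> pd_forms N" using f unfolding abc reduced_forms_def by auto
    note pd = pd_formsD[OF r(3) assms]
    have "b^2 \<le> a*c" using r pd mult_mono[of "\<bar>b\<bar>" a "\<bar>b\<bar>" c] by (simp add: power2_eq_square abs_mult[symmetric])
    then have "3 * (a*c) \<le> N" using pd by simp
    moreover have "a*c > 0" using pd by simp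
    ultimately have "a*c \<le> N" by linarith
    moreover have "a \<le> a*c" "c \<le> a*c" using pd(1,2) mult_left_mono[of 1 c a] mult_right_mono[of 1 a c] by auto
    ultimately have "0 \<le> a" "a \<le> N" "0 \<le> c" "c \<le> N" "-N \<le> b" "b \<le> N" using r(1) pd(1,2) by linarith+
    then show "f \<in> {0..N} \<times> {-N..N} \<times> {0..N}" by (simp add: abc)
  qed
qed simp

definition form_weight :: "qform \<Rightarrow> real" where
  "form_weight f = (case f of (a,b,c) \<Rightarrow> if b = 0 \<and> a = c then 1/2 else 1)"

text \<open>A multiple of \<open>x^2 + x y + y^2\<close> has discriminant \<open>-3 k^2\<close>, so
  weight 1/3 cannot occur when 3 does not divide \<open>N\<close>.\<close>

lemma hurwitz_reduced:
  assumes "N > 0" "\<not> 3 dvd N" "N mod 4 = 0 \<or> N mod 4 = 3"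
  shows "hurwitz N = (\<Sum>f\<in>reduced_forms N. form_weight f)"
proof -
  let ?E = "sl2_equiv N"
  have eq: "equiv (pd_forms N) ?E" by (rule equiv_sl2)
  have sub: "reduced_forms N \<subseteq> pd_forms N" by (auto simp: reduced_forms_def)
  have bij: "bij_betw (\<lambda>f. ?E `` {f}) (reduced_forms N) (pd_forms N // ?E)"
    proof (rule bij_betw_imageI)
      show "inj_on (\<lambda>f. ?E `` {f}) (reduced_forms N)"
        by (rule inj_onI) (use reduced_unique[OF _ _ _ assms(1)] eq_equiv_class[OF _ eq] sub in blast)
      show "(\<lambda>f. ?E `` {f}) ` reduced_forms N = pd_forms N // ?E"
      proof
        show "(\<lambda>f. ?E `` {f}) ` reduced_forms N \<subseteq> pd_forms N // ?E" using sub by (auto intro: quotientI)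
        show "pd_forms N // ?E \<subseteq> (\<lambda>f. ?E `` {f}) ` reduced_forms N"
        proof
          fix C assume "C \<in> pd_forms N // ?E"
          then obtain g where g: "g \<in> pd_forms N" "C = ?E `` {g}" by (auto elim: quotientE)
          obtain f where "f \<in> reduced_forms N" "(g,f) \<in> ?E" using reduced_form_exists[OF g(1) assms(1)] by blast
          then show "C \<in> (\<lambda>f. ?E `` {f}) ` reduced_forms N" using g equiv_class_eq[OF eq] by blast
        qed
      qed
    qed
  have "(\<Sum>C \<in> pd_forms N // ?E. class_weight C) = (\<Sum>f\<in>reduced_forms N. class_weight (?E `` {f}))"
    by (rule sum.reindex_bij_betw[OF bij, symmetric])
  also have "\<dots> = (\<Sum>f\<in>reduced_forms N. form_weight f)"
    proof (rule sum.cong[OF refl])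
      fix f assume f: "f \<in> reduced_forms N"
      obtain a b c where abc: "f = (a,b,c)" by (cases f) auto
      have "(k,k,k) \<notin> pd_forms N" for k using assms(2) by (auto simp: pd_forms_def power2_eq_square) 
      then have 1: "\<not> (\<exists>k. (k,k,k) \<in> ?E `` {f})" by (auto simp: sl2_equiv_def)
      have 2: "(\<exists>k. (k,0,k) \<in> ?E `` {f}) \<longleftrightarrow> b = 0 \<and> a = c"
      proof
        assume "\<exists>k. (k,0,k) \<in> ?E `` {f}"
        then obtain k where k: "(f,(k,0,k)) \<in> ?E" by auto
        then have "(k,0,k) \<in> reduced_forms N" by (auto simp: sl2_equiv_def reduced_forms_def pd_forms_def)
        then have "f = (k,0,k)" using reduced_unique[OF f _ k assms(1)] by simp
        then show "b = 0 \<and> a = c" using abc by simp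
      next
        assume "b = 0 \<and> a = c"
        then have "(a,0,a) \<in> ?E `` {f}" using f sub abc eq by (metis Image_singleton_iff equivE refl_onD subsetD)
        then show "\<exists>k. (k,0,k) \<in> ?E `` {f}" by blast
      qed
      show "class_weight (?E `` {f}) = form_weight f" unfolding class_weight_def form_weight_def using 1 2 abc by simp
    qed
  finally show ?thesis using assms unfolding hurwitz_def by auto
qed

section \<open>Forms with an obtuse superbase, in the sense of Selling\<close>

definition tri_forms :: "int \<Rightarrow> qform set" where
  "tri_forms N = {(a,b,c). (a,b,c) \<in> pd_forms N \<and> b \<le> 0 \<and> 0 \<le> 2*a+b \<and> 0 \<le> 2*c+b}"

definition tri_weight :: "qform \<Rightarrow> int" where
  "tri_weight f = (case f of (a,b,c) \<Rightarrow> sgn (-b) + sgn (2*a+b) + sgn (2*c+b) - 1)"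

lemma pd_rot: "(a,b,c) \<in> pd_forms N \<Longrightarrow> a+b+c > 0 \<Longrightarrow> (a+b+c, -(2*a+b), a) \<in> pd_forms N"
  by (auto simp: pd_forms_def power2_eq_square algebra_simps)

lemma pd_value_pos:
  assumes "(a,b,c) \<in> pd_forms N" "N > 0" shows "a + b + c > 0"
proof -
  have "4*a*(a+b+c) = (2*a+b)^2 + N" using assms(1) by (auto simp: pd_forms_def power2_eq_square algebra_simps)
  then have "4*a*(a+b+c) > 0" using assms(2) zero_le_power2[of "2*a+b"] by linarith
  then show ?thesis using assms(1) by (auto simp: pd_forms_def zero_less_mult_iff)
qed

lemma finite_tri_forms: assumes "N > 0" shows "finite (tri_forms N)"
proof (rule finite_subset)
  show "tri_forms N \<subseteq> {0..N} \<times> {-N..N} \<times> {0..N}"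
  proof
    fix f assume f: "f \<in> tri_forms N"
    obtain a b c where abc: "f = (a,b,c)" by (cases f) auto
    have pd: "(a,b,c) \<in> pd_forms N" and h: "b \<le> 0" "0 \<le> 2*a+b" "0 \<le> 2*c+b" using f unfolding abc tri_forms_def by auto
    note p = pd_formsD[OF pd assms] pd_value_pos[OF pd assms]
    define u v w where uvw: "u = -b" "v = 2*a+b" "w = 2*c+b"
    have N: "u*v + v*w + w*u = N" using p(3) unfolding uvw by (simp add: power2_eq_square algebra_simps)
    have nn: "u \<ge> 0" "v \<ge> 0" "w \<ge> 0" "u + v > 0" "u + w > 0" "v + w > 0" using h p unfolding uvw by auto
    have pr: "u*v \<ge> 0" "v*w \<ge> 0" "w*u \<ge> 0" using nn by simp_all
    have "u * (v+w) \<le> N" "v * (u+w) \<le> N" "w * (u + v) \<le> N" using N pr by (simp_all add: algebra_simps)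
    then have "u \<le> N" "v \<le> N" "w \<le> N"
      using int_prod_bound[of u "v+w" N] int_prod_bound[of v "u+w" N] int_prod_bound[of w "u+v" N] nn assms by fastforce+
    then have "0 \<le> a" "a \<le> N" "0 \<le> c" "c \<le> N" "-N \<le> b" "b \<le> N" using p nn unfolding uvw by linarith+
    then show "f \<in> {0..N} \<times> {-N..N} \<times> {0..N}" by (simp add: abc)
  qed
qed simp

text \<open>\<open>a\<close>, \<open>c\<close>, \<open>a + b + c\<close> are the values at the three
  superbase vectors, and the rotation permutes them; so the sum is three times that over
  \<open>A\<close>, where \<open>a\<close> is least. A form in \<open>A\<close> is reduced with
  \<open>b \<le> 0\<close> (\<open>A1\<close>) or becomes reduced with \<open>b \<ge> 0\<close>
  after one translation (\<open>A2\<close>). A reduced form receives 2 from \<open>A1\<close> if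
  \<open>b < 0\<close>, 2 from \<open>A2\<close> if \<open>b > 0\<close>, 1 from each if
  \<open>b = 0\<close> and \<open>a < c\<close>, but only 1 if \<open>b = 0\<close> and
  \<open>a = c\<close>: twice \<open>form_weight\<close>.\<close>

lemma tri_forms_sum:
  assumes N: "N > 0" "\<not> 3 dvd N"
  shows "real_of_int (\<Sum>f\<in>tri_forms N. tri_weight f) = 6 * (\<Sum>f\<in>reduced_forms N. form_weight f)"
proof -
  \<comment> \<open>In \<open>A\<close>, \<open>B\<close>, \<open>C\<close> the least value is
    \<open>a\<close>, \<open>c\<close>, \<open>a + b + c\<close> respectively, with ties broken
    cyclically. Three equal values would mean \<open>N = 3 a^2\<close>, which \<open>no3\<close>
    excludes.\<close>
  define A where "A = {(a,b,c). (a,b,c) \<in> tri_forms N \<and> c \<ge> -b \<and> c > a}"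
  define B where "B = {(a,b,c). (a,b,c) \<in> tri_forms N \<and> a \<ge> c \<and> a > -b}"
  define C where "C = {(a,b,c). (a,b,c) \<in> tri_forms N \<and> -b \<ge> a \<and> -b > c}"
  define A1 where "A1 = {(a,b,c). (a,b,c) \<in> pd_forms N \<and> b \<le> 0 \<and> -b < a \<and> a < c}"
  define A2 where "A2 = {(a,b,c). (a,b,c) \<in> pd_forms N \<and> b \<le> 0 \<and> -b \<ge> a \<and> 0 \<le> 2*a+b \<and> c \<ge> -b \<and> c > a}"
  define R1 where "R1 = {(a,b,c). (a,b,c) \<in> reduced_forms N \<and> (b < 0 \<or> b = 0 \<and> a < c)}"
  define R2 where "R2 = {(a,b,c). (a,b,c) \<in> reduced_forms N \<and> b \<ge> 0}"
  have no3: "(k,k,k) \<notin> pd_forms N" "(k,-k,k) \<notin> pd_forms N" for k using N(2) by (auto simp: pd_forms_def power2_eq_square)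
  have A1R1: "A1 = R1" unfolding A1_def R1_def reduced_forms_def pd_forms_def by auto
  have finR: "finite (reduced_forms N)" using finite_reduced[OF N(1)] .
  have finR12: "finite R1" "finite R2" by (rule finite_subset[OF _ finR], auto simp: R1_def R2_def)+
  have A2R2: "(\<Sum>f\<in>A2. tri_weight f) = (\<Sum>(a,b,c)\<in>R2. 1 + sgn b)" and finA2: "finite A2"
  proof -
    have bij: "bij_betw (\<lambda>(a,b,c). (a,2*a+b,a+b+c)) A2 R2"
    proof (rule bij_betwI[where g="\<lambda>(a,b,c). (a,b-2*a,a-b+c)"])
      show "(\<lambda>(a,b,c). (a,2*a+b,a+b+c)) \<in> A2 \<rightarrow> R2"
        by (auto simp: A2_def R2_def reduced_forms_def pd_forms_def power2_eq_square algebra_simps)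
      show "(\<lambda>(a,b,c). (a,b-2*a,a-b+c)) \<in> R2 \<rightarrow> A2"
      proof
        fix f assume "f \<in> R2"
        then obtain a b c where f: "f = (a,b,c)" and r: "(a,b,c) \<in> pd_forms N" "0 \<le> b" "b \<le> a" "a \<le> c" by (auto simp: R2_def reduced_forms_def)
        have "b < c" using r no3[of a] by (cases "a = b \<and> b = c") auto
        then show "(\<lambda>(a,b,c). (a,b-2*a,a-b+c)) f \<in> A2" using r unfolding f by (auto simp: A2_def pd_forms_def power2_eq_square algebra_simps)
      qed
    qed auto
    show "finite A2" using bij finR12 bij_betw_finite by blast
    have "(\<Sum>(a,b,c)\<in>R2. 1 + sgn b) = (\<Sum>f\<in>A2. (\<lambda>(a,b,c). 1 + sgn b) ((\<lambda>(a,b,c). (a,2*a+b,a+b+c)) f))"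
      by (rule sum.reindex_bij_betw[OF bij, symmetric])
    also have "\<dots> = (\<Sum>f\<in>A2. tri_weight f)"
    proof (rule sum.cong[OF refl])
      fix f assume "f \<in> A2"
      then obtain a b c where f: "f = (a,b,c)" and r: "(a,b,c) \<in> pd_forms N" "b \<le> 0" "-b \<ge> a" "0 \<le> 2*a+b" "c \<ge> -b" "c > a" by (auto simp: A2_def)
      have "a > 0" using pd_formsD[OF r(1) N(1)] by simp
      then have "sgn (-b) = 1" "sgn (2*c+b) = 1" using r by simp_all
      then show "(\<lambda>(a,b,c). 1 + sgn b) ((\<lambda>(a,b,c). (a,2*a+b,a+b+c)) f) = tri_weight f" by (simp add: f tri_weight_def)
    qed
    finally show "(\<Sum>f\<in>A2. tri_weight f) = (\<Sum>(a,b,c)\<in>R2. 1 + sgn b)" by simp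
  qed
  have AA: "A = A1 \<union> A2" 
  proof (intro equalityI subsetI)
    fix f assume "f \<in> A" then show "f \<in> A1 \<union> A2" unfolding A_def A1_def A2_def tri_forms_def by auto
  next
    fix f assume "f \<in> A1 \<union> A2" then show "f \<in> A" unfolding A_def A1_def A2_def tri_forms_def using pd_formsD[OF _ N(1)] by (auto; fastforce)
  qed
  have dis: "A1 \<inter> A2 = {}" unfolding A1_def A2_def by auto
  have finA: "finite A" and finBC: "finite B" "finite C"
    by (rule finite_subset[OF _ finite_tri_forms[OF N(1)]], auto simp: A_def B_def C_def)+
  have "(\<Sum>f\<in>A. tri_weight f) = (\<Sum>f\<in>R1. tri_weight f) + (\<Sum>(a,b,c)\<in>R2. 1 + sgn b)"
    unfolding AA A2R2[symmetric] A1R1[symmetric] by (rule sum.union_disjoint) (use finR12 A1R1 finA2 dis in auto)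
  also have "(\<Sum>f\<in>R1. tri_weight f) = (\<Sum>f\<in>reduced_forms N. case f of (a,b,c) \<Rightarrow> of_bool (b < 0 \<or> b = 0 \<and> a < c) * (1 + sgn (-b)))"
  proof (rule sum.mono_neutral_cong_left[OF finR])
    show "R1 \<subseteq> reduced_forms N" by (auto simp: R1_def)
    show "\<forall>f\<in>reduced_forms N - R1. (case f of (a,b,c) \<Rightarrow> of_bool (b < 0 \<or> b = 0 \<and> a < c) * (1 + sgn (-b))) = 0" by (auto simp: R1_def)
    fix f assume "f \<in> R1"
    then obtain a b c where f: "f = (a,b,c)" and r: "(a,b,c) \<in> pd_forms N" "b \<le> 0" "-b < a" "a < c" unfolding A1R1[symmetric] by (auto simp: A1_def)
    have "sgn (2*a+b) = 1" "sgn (2*c+b) = 1" using r by simp_all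
    then show "tri_weight f = (case f of (a,b,c) \<Rightarrow> of_bool (b < 0 \<or> b = 0 \<and> a < c) * (1 + sgn (-b)))" using r by (cases "b = 0") (simp_all add: f tri_weight_def)
  qed
  also have "(\<Sum>(a,b,c)\<in>R2. 1 + sgn b) = (\<Sum>f\<in>reduced_forms N. case f of (a,b,c) \<Rightarrow> of_bool (b \<ge> 0) * (1 + sgn b))"
    by (rule sum.mono_neutral_cong_left[OF finR]) (auto simp: R2_def)
  finally have "(\<Sum>f\<in>A. tri_weight f) = (\<Sum>f\<in>reduced_forms N. (case f of (a,b,c) \<Rightarrow> of_bool (b < 0 \<or> b = 0 \<and> a < c) * (1 + sgn (-b))) + (case f of (a,b,c) \<Rightarrow> of_bool (b \<ge> 0) * (1 + sgn b)))"
    by (simp add: sum.distrib)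
  then have "real_of_int (\<Sum>f\<in>A. tri_weight f) = (\<Sum>f\<in>reduced_forms N. real_of_int ((case f of (a,b,c) \<Rightarrow> of_bool (b < 0 \<or> b = 0 \<and> a < c) * (1 + sgn (-b))) + (case f of (a,b,c) \<Rightarrow> of_bool (b \<ge> 0) * (1 + sgn b))))"
    by (simp only: of_int_sum)
  also have "\<dots> = (\<Sum>f\<in>reduced_forms N. 2 * form_weight f)"
    by (rule sum.cong[OF refl]) (auto simp: form_weight_def reduced_forms_def sgn_if)
  finally have sumA: "real_of_int (\<Sum>f\<in>A. tri_weight f) = 2 * (\<Sum>f\<in>reduced_forms N. form_weight f)"
    by (simp add: sum_distrib_left)
  have rot: "(a+b+c, -(2*a+b), a) \<in> tri_forms N \<and> tri_weight (a+b+c, -(2*a+b), a) = tri_weight (a,b,c)" if "(a,b,c) \<in> tri_forms N" for a b c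
  proof -
    have pd: "(a,b,c) \<in> pd_forms N" using that by (simp add: tri_forms_def)
    have e: "2*(a+b+c) + -(2*a+b) = 2*c+b" "2*a + -(2*a+b) = -b" "- (-(2*a+b)) = 2*a+b" by simp_all
    have "(a+b+c, -(2*a+b), a) \<in> tri_forms N" using that pd_rot[OF pd pd_value_pos[OF pd N(1)]] by (auto simp: tri_forms_def)
    moreover have "tri_weight (a+b+c, -(2*a+b), a) = tri_weight (a,b,c)" unfolding tri_weight_def split e by simp
    ultimately show ?thesis by blast
  qed
  have rot2: "(c, -(2*c+b), a+b+c) \<in> tri_forms N \<and> tri_weight (c, -(2*c+b), a+b+c) = tri_weight (a,b,c)" if "(a,b,c) \<in> tri_forms N" for a b c
    using rot[OF conjunct1[OF rot[OF that]]] rot[OF that] by (simp add: algebra_simps)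
  have sumB: "(\<Sum>f\<in>B. tri_weight f) = (\<Sum>f\<in>A. tri_weight f)"
    by (rule sum.reindex_bij_witness[where i="\<lambda>(a,b,c). (a+b+c, -(2*a+b), a)" and j="\<lambda>(a,b,c). (c, -(2*c+b), a+b+c)"])
       (use rot rot2 in \<open>auto simp: A_def B_def\<close>)
  have sumC: "(\<Sum>f\<in>C. tri_weight f) = (\<Sum>f\<in>A. tri_weight f)"
    by (rule sum.reindex_bij_witness[where i="\<lambda>(a,b,c). (c, -(2*c+b), a+b+c)" and j="\<lambda>(a,b,c). (a+b+c, -(2*a+b), a)"])
       (use rot rot2 in \<open>auto simp: A_def C_def\<close>)
  have TT: "tri_forms N = A \<union> B \<union> C"
  proof (intro equalityI subsetI)
    fix f assume f: "f \<in> tri_forms N"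
    obtain a b c where abc: "f = (a,b,c)" by (cases f) auto
    have "\<not> (a = c \<and> -b = a)" using f no3[of a] unfolding abc tri_forms_def by auto
    then have "c \<ge> -b \<and> c > a \<or> a \<ge> c \<and> a > -b \<or> -b \<ge> a \<and> -b > c" by linarith
    then show "f \<in> A \<union> B \<union> C" using f unfolding abc A_def B_def C_def by auto
  qed (auto simp: A_def B_def C_def)
  have "(\<Sum>f\<in>tri_forms N. tri_weight f) = (\<Sum>f\<in>A. tri_weight f) + (\<Sum>f\<in>B. tri_weight f) + (\<Sum>f\<in>C. tri_weight f)"
    unfolding TT using finA finBC
    by (subst sum.union_disjoint, simp, simp, force simp: A_def B_def C_def, subst sum.union_disjoint, auto simp: A_def B_def C_def)
  then show ?thesis using sumA sumB sumC by simp
qed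

lemma hurwitz_tri:
  assumes "N > 0" "\<not> 3 dvd N" "N mod 4 = 0 \<or> N mod 4 = 3"
  shows "6 * hurwitz N = real_of_int (\<Sum>f\<in>tri_forms N. tri_weight f)"
  using hurwitz_reduced[OF assms] tri_forms_sum[OF assms(1,2)] by simp

lemma abs_le_square: "\<bar>t::int\<bar> \<le> t^2"
proof (cases "t = 0")
  case False
  then have "\<bar>t\<bar> * 1 \<le> \<bar>t\<bar> * \<bar>t\<bar>" by (intro mult_left_mono) auto
  then show ?thesis by (simp add: power2_eq_square)
qed simp

lemma finite_square_less: "finite {t::int. t^2 < m}"
proof (rule finite_subset)
  show "{t::int. t^2 < m} \<subseteq> {-m..m}"
  proof
    fix t assume "t \<in> {t::int. t^2 < m}"
    then have "\<bar>t\<bar> \<le> m" using abs_le_square[of t] by simp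
    then show "t \<in> {-m..m}" by auto
  qed
qed simp

lemma regT_disc_pos:
  assumes "regT a c x y" "a*c+x*y = n" shows "(x+y)^2 < 4*n"
proof -
  define u v w where uvw: "u = x-y" "v = 2*a-x+y" "w = 2*c-x+y"
  have nn: "u \<ge> 0" "v \<ge> 0" "w \<ge> 0" "u + v > 0" "u + w > 0" "v + w > 0" using assms(1) unfolding uvw by auto
  have "4*n - (x+y)^2 = u*v + v*w + w*u" using assms(2) unfolding uvw by (simp add: power2_eq_square algebra_simps)
  moreover have "u*v + v*w + w*u > 0"
  proof (cases "u = 0")
    case True then show ?thesis using nn by simp
  next
    case False
    then have "u * (v + w) > 0" "v * w \<ge> 0" using nn by simp_all
    then show ?thesis by (simp add: algebra_simps)
  qed
  ultimately show ?thesis by linarith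
qed

lemma parity_of_disc:
  fixes t b n a c :: int assumes "4*a*c - b^2 = 4*n - t^2" shows "even (t-b)"
proof (rule ccontr)
  assume "odd (t-b)"
  then have "odd (t+b)" by presburger
  then have "odd ((t-b)*(t+b))" using \<open>odd (t-b)\<close> by simp
  moreover have "(t-b)*(t+b) = 4*(n - a*c)" using assms by (simp add: power2_eq_square algebra_simps)
  ultimately show False by simp
qed

text \<open>A matrix of determinant \<open>n\<close> is its trace together with its form; the parity
  lemma makes the off-diagonal data recover integral \<open>x\<close> and \<open>y\<close>.\<close>

lemma qsum_regT_forms:
  shows "qsum n regT (\<lambda>a c x y. regT_weight a c x y * ind n (x+y))
    = (\<Sum>t\<in>{t. t^2 < 4*n}. ind n t * (\<Sum>f\<in>tri_forms (4*n - t^2). tri_weight f))"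
proof -
  have "(\<Sum>t\<in>{t. t^2 < 4*n}. ind n t * (\<Sum>f\<in>tri_forms (4*n - t^2). tri_weight f))
      = (\<Sum>t\<in>{t. t^2 < 4*n}. \<Sum>f\<in>tri_forms (4*n - t^2). ind n t * tri_weight f)" by (simp only: sum_distrib_left)
  also have "\<dots> = (\<Sum>(t,f)\<in>Sigma {t. t^2 < 4*n} (\<lambda>t. tri_forms (4*n - t^2)). ind n t * tri_weight f)"
    by (rule sum.Sigma) (use finite_square_less finite_tri_forms in auto)
  also have "\<dots> = qsum n regT (\<lambda>a c x y. regT_weight a c x y * ind n (x+y))"
    unfolding qsum_def
  proof (rule sum.reindex_bij_witness[where i="\<lambda>(a,c,x,y). (x+y,(a,-(x-y),c))" and j="\<lambda>(t,(a,b,c)). (a,c,(t-b) div 2,(t+b) div 2)"], goal_cases)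
    case (1 v)
    then obtain t a b c where v: "v = (t,(a,b,c))" "t^2 < 4*n" "(a,b,c) \<in> tri_forms (4*n-t^2)" by (cases v) auto
    have pd: "4*a*c - b^2 = 4*n - t^2" using v(2,3) pd_formsD(3)[of a b c "4*n-t^2"] by (simp add: tri_forms_def)
    have "even (t-b)" by (rule parity_of_disc[OF pd])
    then have "(t-b) div 2 + (t+b) div 2 = t" "(t-b) div 2 - (t+b) div 2 = -b" by presburger+
    then show ?case by (simp add: v(1))
  next
    case (2 v)
    then obtain t a b c where v: "v = (t,(a,b,c))" "t^2 < 4*n" "(a,b,c) \<in> tri_forms (4*n-t^2)" by (cases v) auto
    have N: "4*n - t^2 > 0" using v by simp
    have pd: "(a,b,c) \<in> pd_forms (4*n-t^2)" and tri: "b \<le> 0" "0 \<le> 2*a+b" "0 \<le> 2*c+b" using v(3) by (auto simp: tri_forms_def)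
    note p = pd_formsD[OF pd N] pd_value_pos[OF pd N]
    have e: "even (t-b)" by (rule parity_of_disc[OF p(3)])
    define x y where "x = (t-b) div 2" "y = (t+b) div 2"
    have xy: "t = x + y" "b = y - x" using e unfolding x_y_def by presburger+
    have "a*c + x*y = n" using p(3) unfolding xy by (simp add: power2_eq_square algebra_simps)
    moreover have "regT a c x y" using p tri unfolding xy by auto
    ultimately show ?case unfolding v(1) by (simp add: qset_def x_y_def[symmetric])
  next
    case (3 v)
    obtain a c x y where v: "v = (a,c,x,y)" by (cases v) auto
    have "(x + y - (-(x-y))) div 2 = x" "(x + y + (-(x-y))) div 2 = y" by simp_all
    then show ?case unfolding v split by simp
  next
    case (4 v)
    then obtain a c x y where v: "v = (a,c,x,y)" "regT a c x y" "a*c+x*y = n" by (auto simp: qset_def)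
    have "(x+y)^2 < 4*n" using regT_disc_pos v by blast
    moreover have "(a,-(x-y),c) \<in> tri_forms (4*n - (x+y)^2)" using v(2,3) by (auto simp: tri_forms_def pd_forms_def power2_eq_square algebra_simps)
    ultimately show ?case by (simp add: v(1))
  next
    case (5 v)
    then obtain t a b c where v: "v = (t,(a,b,c))" "t^2 < 4*n" "(a,b,c) \<in> tri_forms (4*n-t^2)" by (cases v) auto
    have pd: "4*a*c - b^2 = 4*n - t^2" using v(2,3) pd_formsD(3)[of a b c "4*n-t^2"] by (simp add: tri_forms_def)
    have e: "even (t-b)" by (rule parity_of_disc[OF pd])
    define x y where "x = (t-b) div 2" "y = (t+b) div 2"
    have xy: "t = x + y" "b = y - x" using e unfolding x_y_def by presburger+
    have "- b = x - y" "2*a+b = 2*a-x+y" "2*c+b=2*c-x+y" using xy by simp_all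
    then show ?case by (simp only: v(1) split x_y_def[symmetric] tri_weight_def xy(1)[symmetric] mult.commute)
  qed
  finally show ?thesis by simp
qed

lemma square_mod_4: "(t::int)^2 mod 4 = 0 \<or> t^2 mod 4 = 1"
proof (cases "even t")
  case True
  then obtain k where "t = 2*k" by blast
  then have "t^2 = 4*k^2" by (simp add: power2_eq_square)
  then show ?thesis by simp
next
  case False
  then obtain k where "t = 2*k+1" by (rule oddE)
  then have "t^2 = 4*(k^2+k) + 1" by (simp add: power2_eq_square algebra_simps)
  then show ?thesis by presburger
qed

text \<open>An analogue of the Kronecker-Hurwitz relation. Restricted to these \<open>t\<close>, no
  correction term in \<open>min d (n div d)\<close> survives.\<close>

theorem hurwitz_class_number_relation:
  assumes "n > 0" "\<not> 3 dvd n"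
  shows "(\<Sum>t\<in>{t. t^2 < 4*n}. real_of_int (ind n t) * (12 * hurwitz (4*n - t^2)))
    = (if n mod 3 = 1 then 6 else 12) * real_of_int (\<Sum>d\<in>posdivs n. d)"
proof -
  have "real_of_int (ind n t) * (12 * hurwitz (4*n - t^2)) = 2 * real_of_int (ind n t * (\<Sum>f\<in>tri_forms (4*n - t^2). tri_weight f))" if "t^2 < 4*n" for t
  proof (cases "ind n t = 0")
    case False
    have n3: "\<not> 3 dvd (4*n - t^2)" using ind_nonzero[OF assms(2) False] by presburger
    have "(4*n - t^2) mod 4 = 0 \<or> (4*n - t^2) mod 4 = 3" using square_mod_4[of t] by presburger
    moreover have "4*n - t^2 > 0" using that by simp
    ultimately have "6 * hurwitz (4*n - t^2) = real_of_int (\<Sum>f\<in>tri_forms (4*n - t^2). tri_weight f)"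
      by (intro hurwitz_tri n3)
    then have "12 * hurwitz (4*n - t^2) = 2 * real_of_int (\<Sum>f\<in>tri_forms (4*n - t^2). tri_weight f)" by linarith
    then show ?thesis by (simp only: of_int_mult mult.left_commute)
  qed simp
  then have "(\<Sum>t\<in>{t. t^2 < 4*n}. real_of_int (ind n t) * (12 * hurwitz (4*n - t^2)))
    = (\<Sum>t\<in>{t. t^2 < 4*n}. 2 * real_of_int (ind n t * (\<Sum>f\<in>tri_forms (4*n - t^2). tri_weight f)))"
    by (intro sum.cong refl) (simp only: mem_Collect_eq)
  also have "\<dots> = 2 * real_of_int (\<Sum>t\<in>{t. t^2 < 4*n}. ind n t * (\<Sum>f\<in>tri_forms (4*n - t^2). tri_weight f))"
    by (simp only: sum_distrib_left of_int_sum)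
  also have "\<dots> = 2 * real_of_int ((if n mod 3 = 1 then 3 else 6) * (\<Sum>d\<in>posdivs n. d))"
    unfolding qsum_regT_forms[symmetric] weighted_triples_sum[OF assms] ..
  also have "\<dots> = (if n mod 3 = 1 then 6 else 12) * real_of_int (\<Sum>d\<in>posdivs n. d)" by (simp split: if_split)
  finally show ?thesis .
qed

section \<open>Representations by the Eisenstein norm\<close>

definition eis_norm :: "int \<Rightarrow> int \<Rightarrow> int" where "eis_norm x y = x^2 - x*y + y^2"

definition eis :: "int \<Rightarrow> (int \<times> int) set" where "eis m = {(x,y). eis_norm x y = m}"

lemma eis_norm_4: "4 * eis_norm x y = (2*x - y)^2 + 3*y^2" "4 * eis_norm x y = (2*y - x)^2 + 3*x^2"
  by (simp_all add: eis_norm_def power2_eq_square algebra_simps)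

lemma eis_norm_nonneg: "eis_norm x y \<ge> 0"
  using eis_norm_4(1)[of x y] zero_le_power2[of "2*x-y"] zero_le_power2[of y] by linarith

lemma eis_norm_0: "eis_norm x y = 0 \<longleftrightarrow> x = 0 \<and> y = 0"
proof
  assume "eis_norm x y = 0"
  then have "y^2 = 0" "x^2 = 0"
    using eis_norm_4[of x y] zero_le_power2[of "2*x-y"] zero_le_power2[of "2*y-x"] zero_le_power2[of y] zero_le_power2[of x] by linarith+
  then show "x = 0 \<and> y = 0" by simp
qed (simp add: eis_norm_def)

lemma eis_norm_bound: "\<bar>x\<bar> \<le> 2 * eis_norm x y" "\<bar>y\<bar> \<le> 2 * eis_norm x y"
  using eis_norm_4[of x y] abs_le_square[of x] abs_le_square[of y] zero_le_power2[of "2*x-y"] zero_le_power2[of "2*y-x"] by linarith+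

lemma finite_eis: "finite (eis m)"
proof (rule finite_subset)
  show "eis m \<subseteq> {-2*m..2*m} \<times> {-2*m..2*m}"
  proof
    fix v assume "v \<in> eis m"
    then obtain x y where v: "v = (x,y)" "eis_norm x y = m" by (auto simp: eis_def)
    then show "v \<in> {-2*m..2*m} \<times> {-2*m..2*m}" using eis_norm_bound(1)[of x y] eis_norm_bound(2)[of y x] by (simp add: abs_le_iff)
  qed
qed simp

definition chi :: "int \<Rightarrow> int" where "chi d = (if d mod 3 = 1 then 1 else if d mod 3 = 2 then -1 else 0)"

lemma chi_mult: "chi (a * b) = chi a * chi b"
proof -
  have "a mod 3 = 0 \<or> a mod 3 = 1 \<or> a mod 3 = 2" "b mod 3 = 0 \<or> b mod 3 = 1 \<or> b mod 3 = 2" by auto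
  moreover have "(a*b) mod 3 = (a mod 3) * (b mod 3) mod 3" by (simp add: mod_mult_eq)
  ultimately show ?thesis unfolding chi_def by (elim disjE) simp_all
qed

definition chisum :: "int \<Rightarrow> int" where "chisum m = (\<Sum>d\<in>posdivs m. chi d)"

text \<open>Inclusion and exclusion for the divisors of \<open>m\<close> and their multiples by
  \<open>p\<close>. \<open>eis_count\<close> obeys the same recursion, proved separately for each
  residue of \<open>p\<close> modulo 3.\<close>

lemma chisum_prime_mult:
  assumes "prime (p::int)" "m > 0"
  shows "chisum (p*m) = (1 + chi p) * chisum m - (if p dvd m then chi p * chisum (m div p) else 0)"
proof -
  have p: "p > 0" using assms(1) by (simp add: prime_gt_0_int)
  let ?M = "(\<lambda>d. p * d) ` posdivs m"
  have inj: "inj_on (\<lambda>d. p * d) S" for S using p by (auto simp: inj_on_def)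
  have fin: "finite (posdivs m)" using finite_posdivs assms(2) .
  have un: "posdivs (p*m) = posdivs m \<union> ?M"
  proof (intro equalityI subsetI)
    fix d assume d: "d \<in> posdivs (p*m)"
    show "d \<in> posdivs m \<union> ?M"
    proof (cases "p dvd d")
      case True
      then obtain k where k: "d = p*k" by blast
      then have "k dvd m" "k > 0" using d p by (auto simp: posdivs_def zero_less_mult_iff)
      then show ?thesis using k by (auto simp: posdivs_def)
    next
      case False
      then have "coprime d p" using assms(1) prime_imp_coprime coprime_commute by blast
      then have "d dvd m" using d by (simp add: posdivs_def coprime_dvd_mult_right_iff)
      then show ?thesis using d by (auto simp: posdivs_def)
    qed
  next
    fix d assume "d \<in> posdivs m \<union> ?M" then show "d \<in> posdivs (p*m)" using p by (auto simp: posdivs_def)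
  qed
  have int: "posdivs m \<inter> ?M = (if p dvd m then (\<lambda>d. p*d) ` posdivs (m div p) else {})"
  proof (cases "p dvd m")
    case True
    then obtain k where k: "m = p * k" by blast
    then show ?thesis using p by (auto simp: posdivs_def)
  next
    case False
    then show ?thesis by (auto simp: posdivs_def dest: dvd_mult_left)
  qed
  have M: "(\<Sum>d\<in>(\<lambda>d. p*d) ` S. chi d) = chi p * (\<Sum>d\<in>S. chi d)" for S
    by (simp add: sum.reindex[OF inj] chi_mult sum_distrib_left)
  have "chisum (p*m) + (\<Sum>d\<in>posdivs m \<inter> ?M. chi d) = chisum m + (\<Sum>d\<in>?M. chi d)"
    unfolding chisum_def un using fin by (simp add: sum.union_inter)
  then show ?thesis unfolding int M chisum_def by (simp add: M distrib_right split: if_splits)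
qed

definition eis_count :: "int \<Rightarrow> int" where "eis_count m = int (card (eis m))"

lemma eis_one: "eis 1 = {(1,0),(-1,0),(0,1),(0,-1),(1,1),(-1,-1)}"
proof (intro equalityI subsetI)
  fix v assume "v \<in> eis 1"
  then obtain x y where v: "v = (x,y)" "eis_norm x y = 1" by (auto simp: eis_def)
  have "3*y^2 \<le> 4" "3*x^2 \<le> 4" using eis_norm_4[of x y] v zero_le_power2[of "2*x-y"] zero_le_power2[of "2*y-x"] by linarith+
  then have "\<bar>x\<bar> \<le> 1" "\<bar>y\<bar> \<le> 1" using abs_le_square[of x] abs_le_square[of y] by linarith+
  then have "x = -1 \<or> x = 0 \<or> x = 1" "y = -1 \<or> y = 0 \<or> y = 1" by linarith+
  then show "v \<in> {(1,0),(-1,0),(0,1),(0,-1),(1,1),(-1,-1)}" using v by (auto simp: eis_norm_def)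
qed (auto simp: eis_def eis_norm_def)

text \<open>Multiplication by \<open>1 + 2 omega\<close>, a square root of -3.\<close>

lemma eis_count_3:
  shows "eis_count (3*m) = eis_count m"
proof -
  have "card (eis m) = card (eis (3*m))"
  proof (rule bij_betw_same_card[OF bij_betwI[where f="\<lambda>(x,y). (x-2*y,2*x-y)" and g="\<lambda>(x,y). ((2*y-x) div 3,(y-2*x) div 3)"]])
    show "(\<lambda>(x,y). (x-2*y,2*x-y)) \<in> eis m \<rightarrow> eis (3*m)" by (auto simp: eis_def eis_norm_def power2_eq_square algebra_simps)
    show "(\<lambda>(x,y). ((2*y-x) div 3,(y-2*x) div 3)) \<in> eis (3*m) \<rightarrow> eis m"
    proof
      fix v assume "v \<in> eis (3*m)"
      then obtain x y where v: "v = (x,y)" "eis_norm x y = 3*m" by (auto simp: eis_def)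
      then have "(x+y)^2 = 3*(m + x*y)" by (simp add: eis_norm_def power2_eq_square algebra_simps)
      then have "3 dvd (x+y)^2" by simp
      then have "3 dvd (x+y)" by (rule prime_dvd_power[rotated]) simp
      then obtain k where k: "y = 3*k - x" by (metis add_diff_cancel_left' dvdE)
      have "(2*y-x) div 3 = 2*k - x" "(y - 2*x) div 3 = k - x" unfolding k by simp_all
      then show "(\<lambda>(x,y). ((2*y-x) div 3,(y-2*x) div 3)) v \<in> eis m" using v unfolding k
        by (simp add: eis_def eis_norm_def power2_eq_square algebra_simps)
    qed
    fix v assume "v \<in> eis (3*m)"
    then obtain x y where v: "v = (x,y)" "eis_norm x y = 3*m" by (auto simp: eis_def)
    then have "(x+y)^2 = 3*(m + x*y)" by (simp add: eis_norm_def power2_eq_square algebra_simps)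
    then have "3 dvd (x+y)^2" by simp
    then have "3 dvd (x+y)" by (rule prime_dvd_power[rotated]) simp
    then obtain k where k: "y = 3*k - x" by (metis add_diff_cancel_left' dvdE)
    have "(2*y-x) div 3 = 2*k - x" "(y - 2*x) div 3 = k - x" unfolding k by simp_all
    then show "(\<lambda>(x,y). (x-2*y,2*x-y)) ((\<lambda>(x,y). ((2*y-x) div 3,(y-2*x) div 3)) v) = v" using v unfolding k by simp
  qed auto
  then show ?thesis by (simp add: eis_count_def)
qed

lemma reduced_forms_3: "reduced_forms 3 = {(1,1,1)}"
proof (intro equalityI subsetI)
  fix f assume f: "f \<in> reduced_forms 3"
  obtain a b c where abc: "f = (a,b,c)" by (cases f) auto
  have r: "\<bar>b\<bar> \<le> a" "a \<le> c" "(a,b,c) \<in> pd_forms 3" "\<bar>b\<bar> = a \<Longrightarrow> b \<ge> 0" using f unfolding abc reduced_forms_def by auto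
  have p: "a > 0" "c > 0" "4*a*c - b^2 = 3" using pd_formsD[OF r(3)] by auto
  have "b^2 \<le> a*c" using r p mult_mono[of "\<bar>b\<bar>" a "\<bar>b\<bar>" c] by (simp add: power2_eq_square abs_mult[symmetric])
  moreover have "a*c > 0" using p by simp
  ultimately have ac: "a*c = 1" using p by linarith
  then have "a = 1" "c = 1" using p by (simp_all add: zmult_eq_1_iff)
  moreover have "b^2 = 1" using p ac by simp
  then have "b = 1 \<or> b = -1" by (simp add: power2_eq_1_iff)
  ultimately have "a = 1" "b = 1" "c = 1" using r by auto
  then show "f \<in> {(1,1,1)}" by (simp add: abc)
qed (auto simp: reduced_forms_def pd_forms_def)

text \<open>\<open>(m, 2 z + 1, c)\<close> has discriminant -3, for which there is a single
  class.\<close>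

lemma norm_of_root:
  assumes "m > 0" "m dvd z^2 + z + 1"
  shows "\<exists>u v. eis_norm u v = m"
proof -
  obtain c where c: "z^2 + z + 1 = m*c" using assms(2) by blast
  have "(m, 2*z+1, c) \<in> pd_forms 3" using c assms(1) by (simp add: pd_forms_def power2_eq_square algebra_simps)
  then obtain f where "f \<in> reduced_forms 3" "((m,2*z+1,c),f) \<in> sl2_equiv 3" using reduced_form_exists by force
  then have "((1,1,1),(m,2*z+1,c)) \<in> sl2_equiv 3" unfolding reduced_forms_3 using equiv_sl2[of 3] by (auto elim!: equivE dest: symD)
  then obtain p q r s where "(m,2*z+1,c) = form_act (1,1,1) p q r s" by (auto simp: sl2_equiv_def)
  then have "m = p^2 + p*r + r^2" by (simp add: form_act_def)
  then have "eis_norm p (-r) = m" by (simp add: eis_norm_def)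
  then show ?thesis by blast
qed

lemma prime_dvd_norm:
  assumes "prime (p::int)" "p dvd eis_norm x y" "\<not> (p dvd x \<and> p dvd y)"
  shows "\<exists>z. p dvd z^2 + z + 1"
proof -
  have ny: "\<not> p dvd y"
  proof
    assume y: "p dvd y"
    then have "p dvd eis_norm x y + y * (x - y)" using assms(2) by (intro dvd_add dvd_mult2)
    also have "eis_norm x y + y*(x-y) = x^2" by (simp add: eis_norm_def power2_eq_square algebra_simps)
    finally have "p dvd x" using assms(1) prime_dvd_power by blast
    then show False using y assms(3) by blast
  qed
  then have "coprime y p" using assms(1) prime_imp_coprime coprime_commute by blast
  then obtain w where w: "[y * w = 1] (mod p)" using cong_solve_coprime_int by blast
  have "p dvd eis_norm x y * w^2" using assms(2) by simp
  moreover have "eis_norm x y * w^2 = (x*w)^2 - (x*w)*(y*w) + (y*w)^2" by (simp add: eis_norm_def power2_eq_square algebra_simps)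
  moreover have "[(x*w)^2 - (x*w)*(y*w) + (y*w)^2 = (x*w)^2 - (x*w)*1 + 1^2] (mod p)"
    by (intro cong_add cong_diff cong_mult cong_pow cong_refl w)
  ultimately have "p dvd (x*w)^2 - (x*w)*1 + 1^2" using cong_dvd_iff by force
  then have "p dvd (-(x*w))^2 + (-(x*w)) + 1" by simp
  then show ?thesis by blast
qed

lemma eis_norm_mod_3: "eis_norm x y mod 3 \<noteq> 2"
proof -
  have "eis_norm x y = (x+y)^2 - 3*(x*y)" by (simp add: eis_norm_def power2_eq_square algebra_simps)
  then have "eis_norm x y mod 3 = (x+y)^2 mod 3" by presburger
  moreover have "3 dvd (x+y) \<Longrightarrow> (x+y)^2 mod 3 = 0" by (simp add: power2_eq_square)
  ultimately show ?thesis using square_mod_3[of "x+y"] by (cases "3 dvd (x+y)") auto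
qed

text \<open>Such a prime is not a norm, so by \<open>prime_dvd_norm\<close> and
  \<open>norm_of_root\<close> it divides both coordinates as soon as it divides the norm.\<close>

lemma eis_count_inert:
  assumes "prime (p::int)" "p mod 3 = 2"
  shows "eis_count (p*m) = (if p dvd m then eis_count (m div p) else 0)"
proof -
  have p: "p > 0" using assms(1) by (simp add: prime_gt_0_int)
  have div: "p dvd x \<and> p dvd y" if "eis_norm x y = p*m" for x y
  proof (rule ccontr)
    assume "\<not> (p dvd x \<and> p dvd y)"
    moreover have "p dvd eis_norm x y" using that by simp
    ultimately obtain z where "p dvd z^2 + z + 1" using prime_dvd_norm[OF assms(1)] by blast
    then obtain u v where "eis_norm u v = p" using norm_of_root[OF p] by blast
    then show False using eis_norm_mod_3[of u v] assms(2) by simp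
  qed
  have sc: "eis_norm (p*x) (p*y) = p^2 * eis_norm x y" for x y by (simp add: eis_norm_def power2_eq_square algebra_simps)
  show ?thesis
  proof (cases "p dvd m")
    case True
    then obtain k where k: "m = p*k" by blast
    have "eis (p*m) = (\<lambda>(x,y). (p*x,p*y)) ` eis k"
    proof (intro equalityI subsetI)
      fix v assume "v \<in> eis (p*m)"
      then obtain x y where v: "v = (x,y)" "eis_norm x y = p*m" by (auto simp: eis_def)
      then obtain x' y' where xy: "x = p*x'" "y = p*y'" using div by blast
      then have "p^2 * eis_norm x' y' = p^2*k" using v sc k by (simp add: power2_eq_square)
      then have "eis_norm x' y' = k" using p by simp
      then show "v \<in> (\<lambda>(x,y). (p*x,p*y)) ` eis k" using v xy by (auto simp: eis_def)
    qed (auto simp: eis_def sc k power2_eq_square)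
    moreover have "inj_on (\<lambda>(x,y). (p*x,p*y)) (eis k)" using p by (auto simp: inj_on_def)
    ultimately show ?thesis using k p by (simp add: eis_count_def card_image)
  next
    case False
    have "eis (p*m) = {}"
    proof (rule equals0I)
      fix v assume "v \<in> eis (p*m)"
      then obtain x y where v: "v = (x,y)" "eis_norm x y = p*m" by (auto simp: eis_def)
      then obtain x' y' where xy: "x = p*x'" "y = p*y'" using div by blast
      then have "p * (p * eis_norm x' y') = p*m" using v sc by (simp add: power2_eq_square)
      then show False using p False by (metis dvd_triv_left mult_left_cancel less_irrefl)
    qed
    then show ?thesis using False by (simp add: eis_count_def)
  qed
qed

text \<open>The power \<open>(p - 1) / 3\<close> of a primitive root is a cube root of unity
  different from 1.\<close>

lemma cube_root_of_unity_exists: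
  assumes "prime (p::int)" "p mod 3 = 1"
  shows "\<exists>z. p dvd z^2 + z + 1"
proof -
  define q where "q = nat p"
  have pq: "p = int q" using assms(1) prime_gt_0_int[of p] by (simp add: q_def)
  have q: "prime q" using assms(1) pq by simp
  have "q mod 3 = 1" using assms(2) pq by (metis of_nat_1 of_nat_eq_iff of_nat_numeral zmod_int)
  then obtain k where k: "q = 3*k+1" by (metis mult_div_mod_eq)
  have k0: "k > 0" using k q by (cases k) auto
  obtain g where g: "residue_primroot q g" using residue_primroot_def prime_primitive_root_exists[of q] q prime_gt_1_nat by blast
  have tot: "totient q = 3*k" using q k by (simp add: totient_prime)
  then have o: "ord q g = 3*k" using g by (simp add: residue_primroot_def)
  have 1: "[g^(3*k) = 1] (mod q)" using ord[of g q] o by simp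
  have 2: "\<not> [g^k = 1] (mod q)" using ord_minimal[of k q g] o k0 by simp
  define z where "z = int (g^k)"
  have "[int (g^(3*k)) = int 1] (mod int q)" using 1 by (simp only: cong_int_iff)
  then have "p dvd z^3 - 1" unfolding pq z_def by (simp add: cong_iff_dvd_diff power_mult[symmetric] mult.commute)
  moreover have "z^3 - 1 = (z - 1) * (z^2 + z + 1)" by (simp add: power2_eq_square power3_eq_cube algebra_simps)
  moreover have "\<not> p dvd z - 1"
  proof
    assume "p dvd z - 1"
    then have "[int (g^k) = int 1] (mod int q)" unfolding pq z_def by (simp add: cong_iff_dvd_diff)
    then show False using 2 by (simp only: cong_int_iff)
  qed
  ultimately show ?thesis using prime_dvd_mult_iff[OF assms(1)] by metis
qed

lemma eis_norm_mult: "eis_norm (x*a - y*b) (x*b + y*a - y*b) = eis_norm x y * eis_norm a b"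
  by (simp add: eis_norm_def power2_eq_square algebra_simps)

lemma eis_norm_mult_conj: "eis_norm (x*(a-b) + y*b) (y*a - x*b) = eis_norm x y * eis_norm a b"
  by (simp add: eis_norm_def power2_eq_square algebra_simps)

lemma prime_dvd_eis_coords:
  assumes "prime (p::int)" "p dvd v" "p^2 dvd eis_norm u v" shows "p dvd u"
proof -
  have "p dvd eis_norm u v" by (rule dvd_trans[OF _ assms(3)]) simp
  then have "p dvd eis_norm u v + v * (u - v)" using assms(2) by (intro dvd_add dvd_mult2)
  also have "eis_norm u v + v*(u-v) = u^2" by (simp add: eis_norm_def power2_eq_square algebra_simps)
  finally show ?thesis using assms(1) prime_dvd_power by blast
qed

text \<open>\<open>f\<close> and \<open>g\<close> multiply by an element of norm \<open>p\<close>
  and by its conjugate. Each element of norm \<open>p m\<close> is divisible by one of the two, and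
  by both exactly when it is divisible by \<open>p\<close>; \<open>nb\<close> and
  \<open>n2ab\<close> express that the two are not associated.\<close>

lemma eis_count_split:
  assumes "prime (p::int)" "p mod 3 = 1"
  shows "eis_count (p*m) = 2 * eis_count m - (if p dvd m then eis_count (m div p) else 0)"
proof -
  have p: "p > 0" using assms(1) by (simp add: prime_gt_0_int)
  obtain a b where ab: "eis_norm a b = p" using cube_root_of_unity_exists[OF assms] norm_of_root[OF p] by blast
  define f where "f = (\<lambda>v. (fst v*a - snd v*b, fst v*b + snd v*a - snd v*b))"
  define g where "g = (\<lambda>v. (fst v*(a-b) + snd v*b, snd v*a - fst v*b))"
  have fg: "f (g v) = (p * fst v, p * snd v)" and gf: "g (f v) = (p * fst v, p * snd v)" for v
    unfolding ab[symmetric] f_def g_def by (simp_all add: eis_norm_def power2_eq_square algebra_simps)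
  have nf: "eis_norm (fst (f v)) (snd (f v)) = eis_norm (fst v) (snd v) * p" for v unfolding f_def by (simp add: eis_norm_mult ab)
  have ng: "eis_norm (fst (g v)) (snd (g v)) = eis_norm (fst v) (snd v) * p" for v unfolding g_def by (simp add: eis_norm_mult_conj ab)
  have sc: "eis_norm (p*x) (p*y) = p^2 * eis_norm x y" for x y by (simp add: eis_norm_def power2_eq_square algebra_simps)
  have cancel: "v = w" if "(p * fst v, p * snd v) = (p * fst w, p * snd w)" for v w :: "int \<times> int" using that p by (simp add: prod_eq_iff)
  have inj: "inj f" "inj g"
  proof -
    show "inj f"
    proof (rule injI)
      fix v w assume "f v = f w"
      then have "g (f v) = g (f w)" by (rule arg_cong)
      then show "v = w" unfolding gf by (rule cancel)
    qed
    show "inj g"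
    proof (rule injI)
      fix v w assume "g v = g w"
      then have "f (g v) = f (g w)" by (rule arg_cong)
      then show "v = w" unfolding fg by (rule cancel)
    qed
  qed
  have mem: "v \<in> eis k \<longleftrightarrow> eis_norm (fst v) (snd v) = k" for v k by (cases v) (simp add: eis_def)
  have fi: "f v \<in> eis (p*m)" and gi: "g v \<in> eis (p*m)" if "v \<in> eis m" for v
    using that unfolding mem nf ng by simp_all
  have sub: "f ` eis m \<subseteq> eis (p*m)" "g ` eis m \<subseteq> eis (p*m)" using fi gi by blast+
  have divide: "\<exists>x y. v = (p*x, p*y) \<and> eis_norm x y = m" if "p dvd snd v" "eis_norm (fst v) (snd v) = p^2 * m" for v
  proof -
    have "p dvd fst v" by (rule prime_dvd_eis_coords[OF assms(1) that(1)]) (simp add: that(2))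
    then obtain x where x: "fst v = p*x" by (rule dvdE)
    from that(1) obtain y where y: "snd v = p*y" by (rule dvdE)
    have xy: "v = (p*x,p*y)" using x y by (simp add: prod_eq_iff)
    then have "p^2 * eis_norm x y = p^2 * m" using that(2) sc by simp
    then show ?thesis using xy p by auto
  qed
  have nb: "\<not> p dvd b"
  proof
    assume b: "p dvd b"
    have "p dvd eis_norm a b + b*(a-b)" using ab b by (intro dvd_add dvd_mult2) simp_all
    also have "eis_norm a b + b*(a-b) = a^2" by (simp add: eis_norm_def power2_eq_square algebra_simps)
    finally have "p dvd a" using assms(1) prime_dvd_power by blast
    then have "p * p dvd eis_norm a b" using b unfolding eis_norm_def power2_eq_square by (intro dvd_add dvd_diff mult_dvd_mono)
    then have "p * p dvd p * 1" unfolding ab by simp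
    then have "p dvd 1" using p unfolding dvd_mult_cancel_left by auto
    then show False using assms(1) not_prime_unit by blast
  qed
  have n2ab: "\<not> p dvd 2*a - b"
  proof
    assume d: "p dvd 2*a - b"
    have "p dvd 4 * eis_norm a b - (2*a-b)*(2*a-b)" unfolding ab by (rule dvd_diff[OF dvd_mult[OF dvd_refl] dvd_mult2[OF d]])
    also have "4 * eis_norm a b - (2*a-b)*(2*a-b) = 3 * b^2" by (simp add: eis_norm_def power2_eq_square algebra_simps)
    finally have "p dvd 3 \<or> p dvd b^2" using assms(1) prime_dvd_mult_iff by blast
    then have "p dvd 3 \<or> p dvd b" using assms(1) prime_dvd_power by blast
    then have "p dvd 3" using nb by blast
    then have "p = 3" using assms(1) primes_dvd_imp_eq[of p 3] by simp
    then show False using assms(2) by simp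
  qed
  have un: "eis (p*m) = f ` eis m \<union> g ` eis m"
  proof (intro equalityI subsetI)
    fix v assume "v \<in> eis (p*m)"
    then obtain x y where v: "v = (x,y)" "eis_norm x y = p*m" by (auto simp: eis_def)
    \<comment> \<open>The factors on the right are the second coordinates of \<open>g v\<close> and
      \<open>f v\<close>. Where \<open>p\<close> divides one of them, \<open>divide\<close> extracts
      \<open>p\<close> from the whole element.\<close>
    have "y^2 * eis_norm a b - b^2 * eis_norm x y = (y*a - x*b) * (x*b + y*a - y*b)" by (simp add: eis_norm_def power2_eq_square algebra_simps)
    moreover have "p dvd y^2 * eis_norm a b - b^2 * eis_norm x y" unfolding ab v(2) by (intro dvd_diff dvd_mult dvd_triv_left dvd_refl)
    ultimately have "p dvd (y*a - x*b) * (x*b + y*a - y*b)" by (simp only:)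
    then consider "p dvd y*a - x*b" | "p dvd x*b + y*a - y*b" using assms(1) prime_dvd_mult_iff by blast
    then show "v \<in> f ` eis m \<union> g ` eis m"
    proof cases
      case 1
      have "eis_norm (fst (g v)) (snd (g v)) = p^2*m" unfolding ng using v by (simp add: power2_eq_square)
      moreover have "p dvd snd (g v)" using 1 by (simp add: g_def v)
      ultimately obtain x' y' where w: "g v = (p*x',p*y')" "eis_norm x' y' = m" using divide[of "g v"] by blast
      have "g v = g (f (x',y'))" unfolding gf using w by simp
      then have "v = f (x',y')" using inj(2) by (simp only: inj_eq)
      moreover have "(x',y') \<in> eis m" using w by (simp add: eis_def)
      ultimately show ?thesis by blast
    next
      case 2
      have "eis_norm (fst (f v)) (snd (f v)) = p^2*m" unfolding nf using v by (simp add: power2_eq_square)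
      moreover have "p dvd snd (f v)" using 2 by (simp add: f_def v)
      ultimately obtain x' y' where w: "f v = (p*x',p*y')" "eis_norm x' y' = m" using divide[of "f v"] by blast
      have "f v = f (g (x',y'))" unfolding fg using w by simp
      then have "v = g (x',y')" using inj(1) by (simp only: inj_eq)
      moreover have "(x',y') \<in> eis m" using w by (simp add: eis_def)
      ultimately show ?thesis by blast
    qed
  qed (use sub in auto)
  have int: "f ` eis m \<inter> g ` eis m = (if p dvd m then (\<lambda>(x,y). (p*x,p*y)) ` eis (m div p) else {})" (is "_ = ?I")
  proof (intro equalityI subsetI)
    fix v assume v: "v \<in> f ` eis m \<inter> g ` eis m"
    obtain x y where xy: "v = (x,y)" by (cases v) auto
    have "v \<in> eis (p*m)" using v sub by blast
    then have N: "eis_norm x y = p*m" by (simp add: xy eis_def)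
    obtain w1 where "v = f w1" using v by blast
    then have "g v = (p * fst w1, p * snd w1)" using gf by simp
    then have d1: "p dvd y*a - x*b" by (simp add: xy g_def)
    obtain w2 where "v = g w2" using v by blast
    then have "f v = (p * fst w2, p * snd w2)" using fg by simp
    then have d2: "p dvd x*b + y*a - y*b" by (simp add: xy f_def)
    have "p dvd (x*b + y*a - y*b) - (y*a - x*b)" using d1 d2 by (rule dvd_diff[rotated])
    also have "(x*b + y*a - y*b) - (y*a - x*b) = b * (2*x-y)" by (simp add: algebra_simps)
    finally have d3: "p dvd 2*x - y" using nb assms(1) prime_dvd_mult_iff by blast
    have "p dvd (y*a - x*b) + a*(2*x-y)" using d1 d3 by (intro dvd_add dvd_mult)
    also have "(y*a - x*b) + a*(2*x-y) = x * (2*a-b)" by (simp add: algebra_simps)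
    finally have dx: "p dvd x" using n2ab assms(1) prime_dvd_mult_iff by blast
    have "p dvd 2*x - (2*x - y)" by (rule dvd_diff[OF dvd_mult[OF dx] d3])
    also have "2*x - (2*x - y) = y" by simp
    finally have "p dvd y" .
    then obtain x' y' where w: "x = p*x'" "y = p*y'" using dx by blast
    then have "p * (p * eis_norm x' y') = p * m" using N sc by (simp add: power2_eq_square)
    then have "p * eis_norm x' y' = m" using p by simp
    then have m: "p dvd m" "eis_norm x' y' = m div p" using p by auto
    then show "v \<in> ?I" using xy w by (auto simp: eis_def)
  next
    fix v assume v: "v \<in> ?I"
    then have pm: "p dvd m" by (auto split: if_splits)
    then obtain x y where xy: "v = (p*x,p*y)" "eis_norm x y = m div p" using v by (auto simp: eis_def)
    have "f (x,y) \<in> eis m" "g (x,y) \<in> eis m" unfolding mem nf ng using xy pm by simp_all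
    moreover have "v = f (g (x,y))" "v = g (f (x,y))" unfolding fg gf using xy by auto
    ultimately show "v \<in> f ` eis m \<inter> g ` eis m" by blast
  qed
  have cf: "card (f ` eis m) = card (eis m)" "card (g ` eis m) = card (eis m)" by (rule card_image[OF inj_on_subset[OF _ subset_UNIV]], rule inj)+
  have cp: "card ((\<lambda>(x,y). (p*x,p*y)) ` eis k) = card (eis k)" for k using p by (intro card_image) (auto simp: inj_on_def)
  have "card (f ` eis m \<union> g ` eis m) + card (f ` eis m \<inter> g ` eis m) = card (eis m) + card (eis m)"
    using card_Un_Int[of "f ` eis m" "g ` eis m"] finite_eis cf by simp
  then have "int (card (eis (p*m))) + int (card ?I) = 2 * int (card (eis m))" unfolding un[symmetric] int by linarith
  then show ?thesis unfolding eis_count_def by (auto simp: cp split: if_splits)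
qed

text \<open>Strong induction along the common prime recursion; the factor 6 is the number of
  units.\<close>

theorem eis_count_eq: "m > 0 \<Longrightarrow> eis_count m = 6 * chisum m"
proof (induction m rule: measure_induct_rule[where f = nat])
  case (less m)
  show ?case
  proof (cases "m = 1")
    case True
    have "posdivs 1 = {1}" by (auto simp: posdivs_def)
    then show ?thesis by (simp add: True eis_count_def eis_one chisum_def chi_def)
  next
    case False
    then obtain p where p: "prime p" "p dvd m" using prime_factor_int[of m] less.prems by auto
    have p0: "p > 1" using p(1) prime_gt_1_int by blast
    obtain k where k: "m = p*k" using p(2) by blast
    have k0: "k > 0" using less.prems k p0 by (simp add: zero_less_mult_iff)
    have "k < m" using k k0 p0 by simp
    then have IH: "eis_count k = 6 * chisum k" using less.IH k0 by simp
    have IH2: "eis_count (k div p) = 6 * chisum (k div p)" if pk: "p dvd k"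
    proof -
      obtain j where j: "k = p*j" using pk by blast
      have "j > 0" using k0 j p0 by (simp add: zero_less_mult_iff)
      moreover have "j < k" using calculation j p0 by simp
      moreover have "k div p = j" using j p0 by simp
      ultimately show ?thesis using less.IH[of j] \<open>k < m\<close> less.prems by simp
    qed
    have rec: "chisum m = (1 + chi p) * chisum k - (if p dvd k then chi p * chisum (k div p) else 0)"
      unfolding k by (rule chisum_prime_mult[OF p(1) k0])
    have "p mod 3 = 0 \<or> p mod 3 = 1 \<or> p mod 3 = 2" by auto
    then show ?thesis
    proof (elim disjE)
      assume "p mod 3 = 0"
      then have "3 dvd p" by presburger
      then have "p = 3" using primes_dvd_imp_eq[of 3 p] p(1) by simp
      then show ?thesis using eis_count_3[of k] IH rec k by (simp add: chi_def)
    next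
      assume a: "p mod 3 = 1"
      then show ?thesis using eis_count_split[OF p(1) a, of k] IH IH2 rec k by (simp add: chi_def)
    next
      assume a: "p mod 3 = 2"
      then show ?thesis using eis_count_inert[OF p(1) a, of k] IH IH2 rec k by (simp add: chi_def)
    qed
  qed
qed

section \<open>Representations by the quaternary norm form\<close>

lemma dsum_divisor: 
  assumes "n > 0"
  shows "dsum n (\<lambda>d e z. 1 \<le> z \<and> z < e) (\<lambda>d e z. g d) = (\<Sum>d\<in>posdivs n. (n div d - 1) * g d)"
proof -
  have "dsum n (\<lambda>d e z. 1 \<le> z \<and> z < e) (\<lambda>d e z. g d) = (\<Sum>d\<in>posdivs n. \<Sum>z\<in>{1..<n div d}. g d)"
    by (rule dsum_interval[OF assms, of "\<lambda>d e. 1" "\<lambda>d e. e"])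
  also have "\<dots> = (\<Sum>d\<in>posdivs n. (n div d - 1) * g d)"
  proof (rule sum.cong[OF refl])
    fix d assume "d \<in> posdivs n"
    then have "n div d > 0" using assms by (auto simp: posdivs_def pos_imp_zdiv_pos_iff zdvd_imp_le)
    then show "(\<Sum>z\<in>{1..<n div d}. g d) = (n div d - 1) * g d" by simp
  qed
  finally show ?thesis .
qed

text \<open>Liouville's method: one sum is cut in two ways, by \<open>a\<close> against
  \<open>x\<close> and by \<open>c\<close> against \<open>y\<close>. In the second cut
  \<open>(a, c, x, y)\<close> goes to \<open>(a, c - y, x + a, y)\<close>, so that
  \<open>h a x\<close> and \<open>h a (x - a)\<close> are compared over the same region.\<close>

lemma qsum_pos_split:
  fixes h :: "int \<Rightarrow> int \<Rightarrow> int"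
  assumes "n > 0" "\<And>a x. h a x = h x a"
  shows "qsum n pos4 (\<lambda>a c x y. h a x) = 2 * qsum n (\<lambda>a c x y. pos4 a c x y \<and> x > a) (\<lambda>a c x y. h a x) + (\<Sum>d\<in>posdivs n. (n div d - 1) * h d d)"
    and "qsum n pos4 (\<lambda>a c x y. h a x) = 2 * qsum n (\<lambda>a c x y. pos4 a c x y \<and> x > a) (\<lambda>a c x y. h a (x-a)) + (\<Sum>d\<in>posdivs n. \<Sum>z\<in>{1..<d}. h z (d-z))"
proof -
  let ?h = "\<lambda>a c x y. h a x"
  have "qsum n pos4 ?h = qsum n (\<lambda>a c x y. pos4 a c x y \<and> x > a) ?h + qsum n (\<lambda>a c x y. pos4 a c x y \<and> a \<ge> x) ?h"
    by (rule qsum_disjoint_pos) auto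
  moreover have "qsum n (\<lambda>a c x y. pos4 a c x y \<and> a \<ge> x) ?h = qsum n (\<lambda>a c x y. pos4 a c x y \<and> a > x) ?h + qsum n (\<lambda>a c x y. pos4 a c x y \<and> a = x) ?h"
    by (rule qsum_disjoint_pos) auto
  moreover have "qsum n (\<lambda>a c x y. pos4 a c x y \<and> a > x) ?h = qsum n (\<lambda>a c x y. pos4 a c x y \<and> a > x) (\<lambda>a c x y. h x a)"
    by (rule qsum_cong) (use assms(2) in auto)
  moreover have "qsum n (\<lambda>a c x y. pos4 a c x y \<and> a > x) (\<lambda>a c x y. h x a) = qsum n (\<lambda>a c x y. pos4 a c x y \<and> x > a) ?h"
    by (subst qsum_swap) (rule refl)
  moreover have "qsum n (\<lambda>a c x y. pos4 a c x y \<and> a = x) ?h = dsum n (\<lambda>d e z. 1 \<le> z \<and> z < e) (\<lambda>d e z. h d d)"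
    unfolding qsum_def dsum_def
    by (rule sum.reindex_bij_witness[where i="\<lambda>(d,e,z). (d,z,d,e-z)" and j="\<lambda>(a,c,x,y). (a,c+y,c)"])
       (auto simp: qset_def algebra_simps)
  ultimately show "qsum n pos4 ?h = 2 * qsum n (\<lambda>a c x y. pos4 a c x y \<and> x > a) ?h + (\<Sum>d\<in>posdivs n. (n div d - 1) * h d d)"
    unfolding dsum_divisor[OF assms(1)] by linarith
next
  let ?h = "\<lambda>a c x y. h a x"
  have "qsum n pos4 ?h = qsum n (\<lambda>a c x y. pos4 a c x y \<and> c > y) ?h + qsum n (\<lambda>a c x y. pos4 a c x y \<and> c \<le> y) ?h"
    by (rule qsum_disjoint_pos) auto
  moreover have "qsum n (\<lambda>a c x y. pos4 a c x y \<and> c \<le> y) ?h = qsum n (\<lambda>a c x y. pos4 a c x y \<and> y > c) ?h + qsum n (\<lambda>a c x y. pos4 a c x y \<and> c = y) ?h"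
    by (rule qsum_disjoint_pos) auto
  moreover have "qsum n (\<lambda>a c x y. pos4 a c x y \<and> c > y) ?h = qsum n (\<lambda>a c x y. pos4 a c x y \<and> x > a) (\<lambda>a c x y. h a (x-a))"
    unfolding qsum_def
    by (rule sum.reindex_bij_witness[where i="\<lambda>(a,c,x,y). (a,c+y,x-a,y)" and j="\<lambda>(a,c,x,y). (a,c-y,x+a,y)"])
       (auto simp: qset_def algebra_simps)
  moreover have "qsum n (\<lambda>a c x y. pos4 a c x y \<and> y > c) ?h = qsum n (\<lambda>a c x y. pos4 a c x y \<and> c > y) ?h"
    unfolding qsum_def
    by (rule sum.reindex_bij_witness[where i="\<lambda>(a,c,x,y). (x,y,a,c)" and j="\<lambda>(a,c,x,y). (x,y,a,c)"])
       (use assms(2) in \<open>auto simp: qset_def algebra_simps\<close>)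
  moreover have "qsum n (\<lambda>a c x y. pos4 a c x y \<and> c = y) ?h = dsum n (\<lambda>d e z. 1 \<le> z \<and> z < d) (\<lambda>d e z. h z (d-z))"
    unfolding qsum_def dsum_def
    by (rule sum.reindex_bij_witness[where i="\<lambda>(d,e,z). (z,e,d-z,e)" and j="\<lambda>(a,c,x,y). (a+x,c,a)"])
       (auto simp: qset_def algebra_simps)
  moreover have "dsum n (\<lambda>d e z. 1 \<le> z \<and> z < d) (\<lambda>d e z. h z (d-z)) = (\<Sum>d\<in>posdivs n. \<Sum>z\<in>{1..<d}. h z (d-z))"
    by (rule dsum_interval[OF assms(1), of "\<lambda>d e. 1" "\<lambda>d e. d"])
  ultimately show "qsum n pos4 ?h = 2 * qsum n (\<lambda>a c x y. pos4 a c x y \<and> x > a) (\<lambda>a c x y. h a (x-a)) + (\<Sum>d\<in>posdivs n. \<Sum>z\<in>{1..<d}. h z (d-z))"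
    by linarith
qed

definition same :: "int \<Rightarrow> int \<Rightarrow> int" where "same a x = of_bool (3 dvd (a - x) \<and> \<not> 3 dvd a)"
definition oppo :: "int \<Rightarrow> int \<Rightarrow> int" where "oppo a x = of_bool (3 dvd (a + x) \<and> \<not> 3 dvd a)"

lemma chi_chi: "chi a * chi x = same a x - oppo a x"
proof -
  have "a mod 3 = 0 \<or> a mod 3 = 1 \<or> a mod 3 = 2" "x mod 3 = 0 \<or> x mod 3 = 1 \<or> x mod 3 = 2" by auto
  moreover have "3 dvd (a - x) \<longleftrightarrow> a mod 3 = x mod 3" by (simp add: mod_eq_dvd_iff)
  moreover have "3 dvd (a + x) \<longleftrightarrow> (a mod 3 + x mod 3) mod 3 = 0" by (simp add: dvd_eq_mod_eq_0 mod_add_eq)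
  moreover have "3 dvd a \<longleftrightarrow> a mod 3 = 0" by (simp add: dvd_eq_mod_eq_0)
  ultimately show ?thesis unfolding chi_def same_def oppo_def by (elim disjE) simp_all
qed

lemma same_sum:
  assumes "d > 0" "\<not> 3 dvd d" shows "3 * (\<Sum>z\<in>{1..<d}. same z (d-z)) = d - chi d"
proof -
  have "same z (d-z) = ind 1 (z+d)" for z
  proof -
    have "3 dvd (z - (d - z)) \<longleftrightarrow> 3 dvd (z + d)" by presburger
    moreover have "3 dvd (z+d) \<Longrightarrow> \<not> 3 dvd z" using assms(2) by presburger
    ultimately show ?thesis by (auto simp: same_def ind_def)
  qed
  then have "(\<Sum>z\<in>{1..<d}. same z (d-z)) = ind_sum 1 d 1 d" by (simp add: ind_sum_def)
  also have "\<dots> = (d - 1 + d) div 3 - (1 - 1 + d) div 3" by (rule ind_sum_closed_1) (use assms in auto)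
  finally have e: "(\<Sum>z\<in>{1..<d}. same z (d-z)) = (d - 1 + d) div 3 - d div 3" by simp
  show ?thesis
  proof (cases "d mod 3 = 1")
    case True
    then show ?thesis unfolding e chi_def by simp presburger
  next
    case False
    then have "d mod 3 = 2" using assms(2) by presburger
    then show ?thesis unfolding e chi_def by simp presburger
  qed
qed

text \<open>\<open>chi a * chi x\<close> is \<open>same a x - oppo a x\<close>, and
  \<open>same a (x - a) = oppo a x\<close> because \<open>2 a - x = -(a + x)\<close> (mod 3). Hence
  the two cuts of \<open>same\<close> determine the off-diagonal part of the \<open>chi\<close> sum,
  leaving only \<open>same_sum\<close>.\<close>

lemma liouville_chi:
  assumes "n > 0" "\<not> 3 dvd n"
  shows "3 * qsum n pos4 (\<lambda>a c x y. chi a * chi x) = (\<Sum>d\<in>posdivs n. d) - chisum n"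
proof -
  let ?G = "\<lambda>a c x y. pos4 a c x y \<and> x > a"
  have nd: "\<not> 3 dvd d" if "d \<in> posdivs n" for d using that assms(2) by (auto simp: posdivs_def dest: dvd_trans)
  have sym: "same a x = same x a" for a x
  proof -
    have "3 dvd (a - x) \<longleftrightarrow> 3 dvd (x - a)" by (metis dvd_minus_iff minus_diff_eq)
    moreover have "3 dvd (x - a) \<Longrightarrow> 3 dvd x \<longleftrightarrow> 3 dvd a" by presburger
    ultimately show ?thesis by (auto simp: same_def)
  qed
  have tau: "(\<Sum>d\<in>posdivs n. (n div d - 1) * same d d) = (\<Sum>d\<in>posdivs n. n div d - 1)"
    by (rule sum.cong[OF refl]) (use nd in \<open>simp add: same_def\<close>)
  have tau': "(\<Sum>d\<in>posdivs n. (n div d - 1) * (chi d * chi d)) = (\<Sum>d\<in>posdivs n. n div d - 1)"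
  proof (rule sum.cong[OF refl])
    fix d assume "d \<in> posdivs n"
    then have "d mod 3 = 1 \<or> d mod 3 = 2" using nd[of d] by presburger
    then show "(n div d - 1) * (chi d * chi d) = n div d - 1" by (auto simp: chi_def)
  qed
  have 1: "qsum n pos4 (\<lambda>a c x y. same a x) = 2 * qsum n ?G (\<lambda>a c x y. same a x) + (\<Sum>d\<in>posdivs n. n div d - 1)"
    using qsum_pos_split(1)[OF assms(1), of same] sym tau by simp
  have 2: "qsum n pos4 (\<lambda>a c x y. same a x) = 2 * qsum n ?G (\<lambda>a c x y. same a (x-a)) + (\<Sum>d\<in>posdivs n. \<Sum>z\<in>{1..<d}. same z (d-z))"
    using qsum_pos_split(2)[OF assms(1), of same] sym by simp
  have op: "same a (x-a) = oppo a x" for a x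
  proof -
    have "3 dvd (a - (x - a)) \<longleftrightarrow> 3 dvd (a + x)" by presburger
    then show ?thesis by (simp add: same_def oppo_def)
  qed
  have 3: "qsum n pos4 (\<lambda>a c x y. chi a * chi x) = 2 * (qsum n ?G (\<lambda>a c x y. same a x) - qsum n ?G (\<lambda>a c x y. oppo a x)) + (\<Sum>d\<in>posdivs n. n div d - 1)"
    using qsum_pos_split(1)[OF assms(1), of "\<lambda>a x. chi a * chi x"] tau' unfolding chi_chi[symmetric] qsum_diff[symmetric] 
    by (simp add: mult.commute)
  have "qsum n pos4 (\<lambda>a c x y. chi a * chi x) = (\<Sum>d\<in>posdivs n. \<Sum>z\<in>{1..<d}. same z (d-z))"
  proof -
    have gen: "A = E" if "Q = 2 * N1 + T" "Q = 2 * N2 + E" "A = 2 * (N1 - N2) + T" for A E Q N1 N2 T :: int using that by presburger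
    have op': "(\<lambda>a c x y. same a (x-a)) = (\<lambda>a (c::int) x (y::int). oppo a x)" by (intro ext) (rule op)
    note 2 = 2[unfolded op']
    show ?thesis by (rule gen[OF 1 2 3])
  qed
  then have "3 * qsum n pos4 (\<lambda>a c x y. chi a * chi x) = (\<Sum>d\<in>posdivs n. 3 * (\<Sum>z\<in>{1..<d}. same z (d-z)))"
    by (simp only: sum_distrib_left)
  also have "\<dots> = (\<Sum>d\<in>posdivs n. d - chi d)"
    by (rule sum.cong[OF refl]) (use nd same_sum in \<open>auto simp: posdivs_def\<close>)
  finally show ?thesis by (simp add: sum_subtractf chisum_def)
qed

lemma chisum_convolution:
  assumes "n > 0"
  shows "(\<Sum>m\<in>{1..<n}. chisum m * chisum (n - m)) = qsum n pos4 (\<lambda>a c x y. chi a * chi x)"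
proof -
  have "(\<Sum>m\<in>{1..<n}. chisum m * chisum (n - m)) = (\<Sum>m\<in>{1..<n}. \<Sum>v\<in>posdivs m \<times> posdivs (n-m). chi (fst v) * chi (snd v))"
    unfolding chisum_def sum_product by (simp add: sum.cartesian_product case_prod_beta)
  also have "\<dots> = (\<Sum>(m,v)\<in>Sigma {1..<n} (\<lambda>m. posdivs m \<times> posdivs (n-m)). chi (fst v) * chi (snd v))"
    by (rule sum.Sigma) (auto intro!: finite_posdivs)
  also have "\<dots> = qsum n pos4 (\<lambda>a c x y. chi a * chi x)"
    unfolding qsum_def
  proof (rule sum.reindex_bij_witness[where i="\<lambda>(a,c,x,y). (a*c,(a,x))" and j="\<lambda>(m,(a,x)). (a,m div a,x,(n-m) div x)"], goal_cases)
    case (2 v)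
    then obtain m a x where v: "v = (m,(a,x))" "1 \<le> m" "m < n" "a > 0" "a dvd m" "x > 0" "x dvd (n-m)" by (cases v) (auto simp: posdivs_def)
    then have "m div a > 0" "(n-m) div x > 0" by (auto simp: pos_imp_zdiv_pos_iff zdvd_imp_le)
    then show ?case using v by (simp add: qset_def)
  next
    case (4 v)
    then obtain a c x y where v: "v = (a,c,x,y)" "pos4 a c x y" "a*c+x*y=n" by (auto simp: qset_def)
    have "a*c > 0" "x*y > 0" using v(2) by simp_all
    then have "1 \<le> a*c" "a*c < n" using v(3) by linarith+
    moreover have "n - a*c = x*y" using v(3) by simp
    ultimately show ?case using v(1,2) by (simp add: posdivs_def)
  qed (auto simp: posdivs_def qset_def)
  finally show ?thesis .
qed

definition quat_reps :: "int \<Rightarrow> (int \<times> int \<times> int \<times> int) set" where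
  "quat_reps n = {(x,y,z,w). eis_norm x y + eis_norm z w = n}"

lemma quat_reps_alt: "quat_reps n = (\<lambda>(m,(v,w)). (fst v, snd v, fst w, snd w)) ` Sigma {0..n} (\<lambda>m. eis m \<times> eis (n-m))"
proof (intro equalityI subsetI)
  fix q assume "q \<in> quat_reps n"
  then obtain x y z w where q: "q = (x,y,z,w)" "eis_norm x y + eis_norm z w = n" by (auto simp: quat_reps_def)
  have "(eis_norm x y, ((x,y),(z,w))) \<in> Sigma {0..n} (\<lambda>m. eis m \<times> eis (n-m))"
    using q(2) eis_norm_nonneg[of x y] eis_norm_nonneg[of z w] by (auto simp: eis_def)
  then show "q \<in> (\<lambda>(m,(v,w)). (fst v, snd v, fst w, snd w)) ` Sigma {0..n} (\<lambda>m. eis m \<times> eis (n-m))"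
    using q(1) by (intro image_eqI[where x="(eis_norm x y, ((x,y),(z,w)))"]) simp_all
qed (auto simp: quat_reps_def eis_def)

lemma finite_quat_reps: "finite (quat_reps n)"
  unfolding quat_reps_alt by (auto intro!: finite_eis)

text \<open>In the convolution of the Eisenstein counts, \<open>m = 0\<close> and
  \<open>m = n\<close> give \<open>12 * chisum n\<close>. This cancels against \<open>36 / 3\<close>
  times the \<open>- chisum n\<close> of \<open>liouville_chi\<close>.\<close>

theorem card_quat_reps:
  assumes "n > 0" "\<not> 3 dvd n"
  shows "int (card (quat_reps n)) = 12 * (\<Sum>d\<in>posdivs n. d)"
proof -
  let ?S = "Sigma {0..n} (\<lambda>m. eis m \<times> eis (n-m))"
  have "inj_on (\<lambda>(m,(v,w)). (fst v, snd v, fst w, snd w)) ?S"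
    by (auto simp: inj_on_def eis_def)
  then have "card (quat_reps n) = card ?S" unfolding quat_reps_alt by (rule card_image)
  also have "\<dots> = (\<Sum>m\<in>{0..n}. card (eis m) * card (eis (n-m)))"
    by (subst card_SigmaI) (auto simp: card_cartesian_product finite_eis)
  finally have "int (card (quat_reps n)) = (\<Sum>m\<in>{0..n}. eis_count m * eis_count (n-m))" by (simp add: eis_count_def)
  also have "{0..n} = insert 0 (insert n {1..<n})" using assms(1) by auto
  also have "(\<Sum>m\<in>insert 0 (insert n {1..<n}). eis_count m * eis_count (n-m)) = 2 * (eis_count 0 * eis_count n) + (\<Sum>m\<in>{1..<n}. eis_count m * eis_count (n-m))"
    using assms(1) by simp
  also have "eis 0 = {(0,0)}" by (auto simp: eis_def eis_norm_0)
  then have "eis_count 0 = 1" by (simp add: eis_count_def)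
  also have "(\<Sum>m\<in>{1..<n}. eis_count m * eis_count (n-m)) = (\<Sum>m\<in>{1..<n}. 36 * (chisum m * chisum (n-m)))"
    by (rule sum.cong[OF refl]) (simp add: eis_count_eq)
  also have "\<dots> = 36 * qsum n pos4 (\<lambda>a c x y. chi a * chi x)"
    unfolding chisum_convolution[OF assms(1), symmetric] by (simp add: sum_distrib_left)
  also have "eis_count n = 6 * chisum n" using eis_count_eq assms(1) by simp
  finally show ?thesis using liouville_chi[OF assms] by simp
qed

section \<open>Class numbers as ternary representation numbers\<close>

text \<open>\<open>3 z^2 + 4 eis_norm x y\<close> is four times the norm minus the squared trace of
  any quaternion \<open>(s + z omega) + (x + y omega) j\<close>.\<close>

definition tern :: "int \<Rightarrow> (int \<times> int \<times> int) set" where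
  "tern N = {(z,x,y). 3 * z^2 + 4 * eis_norm x y = N}"

lemma finite_tern: "finite (tern N)"
proof (rule finite_subset)
  show "tern N \<subseteq> {-N..N} \<times> {-N..N} \<times> {-N..N}"
  proof
    fix v assume "v \<in> tern N"
    then obtain z x y where v: "v = (z,x,y)" "3 * z^2 + 4 * eis_norm x y = N" by (auto simp: tern_def)
    have "\<bar>z\<bar> \<le> N" "\<bar>x\<bar> \<le> N" "\<bar>y\<bar> \<le> N"
      using v(2) abs_le_square[of z] eis_norm_nonneg[of x y] eis_norm_bound(1)[of x y] eis_norm_bound(2)[of y x] by linarith+
    then show "v \<in> {-N..N} \<times> {-N..N} \<times> {-N..N}" by (simp add: v(1) abs_le_iff)
  qed
qed simp

lemma eis_norm_trace_mod_3: "3 dvd eis_norm x y \<longleftrightarrow> 3 dvd (2*x - y)" "\<not> 3 dvd (2*x-y) \<Longrightarrow> eis_norm x y mod 3 = 1"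
proof -
  have e: "eis_norm x y = (2*x-y)^2 - 3*(x^2 - x*y)" by (simp add: eis_norm_def power2_eq_square algebra_simps)
  have m: "eis_norm x y mod 3 = (2*x-y)^2 mod 3" unfolding e by presburger
  show 2: "\<not> 3 dvd (2*x-y) \<Longrightarrow> eis_norm x y mod 3 = 1" using square_mod_3 m by simp
  have "3 dvd (2*x-y) \<Longrightarrow> eis_norm x y mod 3 = 0" using m by (simp add: power2_eq_square)
  then show "3 dvd eis_norm x y \<longleftrightarrow> 3 dvd (2*x - y)" using 2 by (cases "3 dvd (2*x-y)") (auto simp: dvd_eq_mod_eq_0)
qed

lemma ind_eq_norm: "ind n (2*x-y) = (if n mod 3 = 1 then of_bool (3 dvd eis_norm x y) else of_bool (\<not> 3 dvd eis_norm x y))"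
  by (simp add: ind_def eis_norm_trace_mod_3(1))

lemma quat_reps_swap_sum: "(\<Sum>(x,y,z,w)\<in>quat_reps n. h x y z w) = (\<Sum>(x,y,z,w)\<in>quat_reps n. h z w x y)"
  by (rule sum.reindex_bij_witness[where i="\<lambda>(x,y,z,w). (z,w,x,y)" and j="\<lambda>(x,y,z,w). (z,w,x,y)"])
     (auto simp: quat_reps_def)

lemma norms_mod_3:
  assumes "eis_norm x y + eis_norm z w = n"
  shows "n mod 3 = 2 \<Longrightarrow> \<not> 3 dvd eis_norm x y \<and> \<not> 3 dvd eis_norm z w" 
    "n mod 3 = 1 \<Longrightarrow> 3 dvd eis_norm x y \<longleftrightarrow> \<not> 3 dvd eis_norm z w"
proof -
  define A B where "A = eis_norm x y" and "B = eis_norm z w"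
  have "A mod 3 \<noteq> 2" "B mod 3 \<noteq> 2" "n = A + B" using eis_norm_mod_3 assms unfolding A_def B_def by auto
  then show "n mod 3 = 2 \<Longrightarrow> \<not> 3 dvd eis_norm x y \<and> \<not> 3 dvd eis_norm z w" 
    "n mod 3 = 1 \<Longrightarrow> 3 dvd eis_norm x y \<longleftrightarrow> \<not> 3 dvd eis_norm z w"
    unfolding A_def[symmetric] B_def[symmetric] by presburger+
qed

text \<open>\<open>ind\<close> at the trace only sees whether 3 divides the first Eisenstein norm.
  For \<open>n = 1\<close> (mod 3) exactly one of the two norms is divisible, so the exchange of
  halves gives half of all elements; for \<open>n = 2\<close> neither is, and all count.\<close>

lemma quat_trace_sum:
  assumes "n > 0" "\<not> 3 dvd n"
  shows "(\<Sum>(x,y,z,w)\<in>quat_reps n. ind n (2*x-y)) = (if n mod 3 = 1 then 6 else 12) * (\<Sum>d\<in>posdivs n. d)"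
proof (cases "n mod 3 = 1")
  case True
  let ?S = "\<Sum>(x,y,z,w)\<in>quat_reps n. ind n (2*x-y)"
  have "?S + ?S = (\<Sum>(x,y,z,w)\<in>quat_reps n. ind n (2*x-y)) + (\<Sum>(x,y,z,w)\<in>quat_reps n. ind n (2*z-w))"
    by (subst (2) quat_reps_swap_sum) (rule refl)
  also have "\<dots> = (\<Sum>q\<in>quat_reps n. (case q of (x,y,z,w) \<Rightarrow> ind n (2*x-y)) + (case q of (x,y,z,w) \<Rightarrow> ind n (2*z-w)))"
    by (rule sum.distrib[symmetric])
  also have "\<dots> = (\<Sum>q\<in>quat_reps n. 1)"
  proof (rule sum.cong[OF refl])
    fix q assume "q \<in> quat_reps n"
    then obtain x y z w where q: "q = (x,y,z,w)" "eis_norm x y + eis_norm z w = n" by (auto simp: quat_reps_def)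
    show "(case q of (x,y,z,w) \<Rightarrow> ind n (2*x-y)) + (case q of (x,y,z,w) \<Rightarrow> ind n (2*z-w)) = 1"
      using norms_mod_3(2)[OF q(2) True] True by (simp add: q(1) ind_eq_norm)
  qed
  finally show ?thesis using card_quat_reps[OF assms] True by simp
next
  case False
  then have 2: "n mod 3 = 2" using assms(2) by presburger
  have "(\<Sum>(x,y,z,w)\<in>quat_reps n. ind n (2*x-y)) = (\<Sum>q\<in>quat_reps n. 1)"
  proof (rule sum.cong[OF refl])
    fix q assume "q \<in> quat_reps n"
    then obtain x y z w where q: "q = (x,y,z,w)" "eis_norm x y + eis_norm z w = n" by (auto simp: quat_reps_def)
    show "(case q of (x,y,z,w) \<Rightarrow> ind n (2*x-y)) = 1"
      using norms_mod_3(1)[OF q(2) 2] 2 by (simp add: q(1) ind_eq_norm)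
  qed
  then show ?thesis using card_quat_reps[OF assms] 2 by simp
qed

lemma tern_parity:
  fixes t y m n :: int assumes "3*y^2 + 4*m = 4*n - t^2" shows "even (t+y)"
proof -
  have "t^2 + 3*y^2 = 2*(2*(n - m))" using assms by (simp add: algebra_simps)
  then have "even (t^2 + 3*y^2)" by simp
  then show ?thesis by simp
qed

lemma tern_trace_sum:
  assumes "n > 0" "\<not> 3 dvd n"
  shows "(\<Sum>t\<in>{t. t^2 < 4*n}. ind n t * int (card (tern (4*n - t^2)))) = (\<Sum>(x,y,z,w)\<in>quat_reps n. ind n (2*x-y))"
proof -
  have "(\<Sum>t\<in>{t. t^2 < 4*n}. ind n t * int (card (tern (4*n - t^2)))) = (\<Sum>t\<in>{t. t^2 < 4*n}. \<Sum>v\<in>tern (4*n-t^2). ind n t)"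
    by (simp add: mult.commute)
  also have "\<dots> = (\<Sum>(t,v)\<in>Sigma {t. t^2 < 4*n} (\<lambda>t. tern (4*n-t^2)). ind n t)"
    by (rule sum.Sigma) (use finite_square_less finite_tern in auto)
  also have "\<dots> = (\<Sum>(x,y,z,w)\<in>{(x,y,z,w). (x,y,z,w) \<in> quat_reps n \<and> (2*x-y)^2 \<noteq> 4*n}. ind n (2*x-y))"
  proof (rule sum.reindex_bij_witness[where i="\<lambda>(x,y,z,w). (2*x-y,(y,z,w))" and j="\<lambda>(t,(y,z,w)). ((t+y) div 2,y,z,w)"], goal_cases)
    case (1 v)
    then obtain t y z w where v: "v = (t,(y,z,w))" "t^2 < 4*n" "3*y^2 + 4*eis_norm z w = 4*n - t^2" by (cases v) (auto simp: tern_def)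
    have "even (t+y)" by (rule tern_parity[OF v(3)])
    then show ?case by (simp add: v(1))
  next
    case (2 v)
    then obtain t y z w where v: "v = (t,(y,z,w))" "t^2 < 4*n" "3*y^2 + 4*eis_norm z w = 4*n - t^2" by (cases v) (auto simp: tern_def)
    have "even (t+y)" by (rule tern_parity[OF v(3)])
    then obtain x where x: "t + y = 2*x" by blast
    then have t: "t = 2*x-y" by simp
    have "4 * eis_norm x y + 4 * eis_norm z w = 4*n" using v(3) eis_norm_4(1)[of x y] unfolding t by linarith
    then have "(x,y,z,w) \<in> quat_reps n" by (simp add: quat_reps_def)
    then show ?case using v(2) x t by (simp add: v(1))
  next
    case (3 v) then show ?case by auto
  next
    case (4 v)
    then obtain x y z w where v: "v = (x,y,z,w)" "eis_norm x y + eis_norm z w = n" "(2*x-y)^2 \<noteq> 4*n" by (auto simp: quat_reps_def)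
    have "(2*x-y)^2 + 3*y^2 + 4*eis_norm z w = 4*n" using v(2) eis_norm_4(1)[of x y] by linarith
    moreover have "(2*x-y)^2 < 4*n" using calculation v(3) eis_norm_nonneg[of z w] zero_le_power2[of y] by linarith
    ultimately show ?case by (simp add: v(1) tern_def)
  next
    case (5 v)
    then obtain t y z w where v: "v = (t,(y,z,w))" "t^2 < 4*n" "3*y^2 + 4*eis_norm z w = 4*n - t^2" by (cases v) (auto simp: tern_def)
    have "even (t+y)" by (rule tern_parity[OF v(3)])
    then show ?case by (simp add: v(1))
  qed
  also have "\<dots> = (\<Sum>(x,y,z,w)\<in>quat_reps n. ind n (2*x-y))"
  proof (rule sum.mono_neutral_left[OF finite_quat_reps])
    show "\<forall>q\<in>quat_reps n - {(x,y,z,w). (x,y,z,w) \<in> quat_reps n \<and> (2*x-y)^2 \<noteq> 4*n}. (case q of (x,y,z,w) \<Rightarrow> ind n (2*x-y)) = 0"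
      \<comment> \<open>The elements left out have \<open>t^2 = 4 n\<close>: they are rational
        integers, the degenerate case \<open>s = 0\<close>.\<close>
      using ind_vanish[OF assms(2), of _ 0] by auto
  qed auto
  finally show ?thesis .
qed

theorem hurwitz_eq_ternary:
  assumes "N > 0" "N mod 3 = 1"
  shows "12 * hurwitz N = real (card (tern N))"
proof (cases "N mod 4 = 0 \<or> N mod 4 = 3")
  case False
  then have m: "N mod 4 = 1 \<or> N mod 4 = 2" by presburger
  have "tern N = {}"
  proof (rule equals0I)
    fix v assume "v \<in> tern N"
    then obtain z x y where v: "3 * z^2 + 4 * eis_norm x y = N" by (auto simp: tern_def)
    show False using v m square_mod_4[of z] by presburger
  qed
  moreover have "hurwitz N = 0" using m assms(1) by (auto simp: hurwitz_def)
  ultimately show ?thesis by simp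
next
  case True
  from assms True show ?thesis
  proof (induction N rule: measure_induct_rule[where f = nat])
    case (less N)
    define g where "g M = 12 * hurwitz M - real (card (tern M))" for M
    have IH: "g M = 0" if "0 < M" "M < N" "M mod 3 = 1" "M mod 4 = 0 \<or> M mod 4 = 3" for M
      using less.IH[of M] that by (simp add: g_def)
    obtain n t0 where nt: "N = 4*n - t0^2" "t0 = 0 \<and> n mod 3 = 1 \<or> t0 = 1 \<and> n mod 3 = 2"
    proof (cases "N mod 4 = 0")
      case True
      have "N = 4 * (N div 4)" using True by presburger
      then have "N = 4 * (N div 4) - 0^2" by simp
      moreover have "(N div 4) mod 3 = 1" using True less.prems(2) by presburger
      ultimately show ?thesis using that[of "N div 4" 0] by blast
    next
      case False
      then have "N mod 4 = 3" using less.prems(3) by blast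
      then have "N = 4 * ((N+1) div 4) - 1" "((N+1) div 4) mod 3 = 2" using less.prems(2) by presburger+
      then show ?thesis using that[of "(N+1) div 4" 1] by simp
    qed
    have n: "n > 0" "\<not> 3 dvd n" using nt less.prems(1) zero_le_power2[of t0] by (linarith, presburger)
    let ?T = "{t. t^2 < 4*n}"
    have c4: "(4*n-t^2) mod 4 = 0 \<or> (4*n-t^2) mod 4 = 3" for t using square_mod_4[of t] by presburger
    have "(\<Sum>t\<in>?T. real_of_int (ind n t) * g (4*n - t^2)) = (\<Sum>t\<in>?T. real_of_int (ind n t) * (12 * hurwitz (4*n - t^2))) - (\<Sum>t\<in>?T. real_of_int (ind n t) * real (card (tern (4*n - t^2))))"
      by (simp add: g_def right_diff_distrib sum_subtractf)
    also have "(\<Sum>t\<in>?T. real_of_int (ind n t) * real (card (tern (4*n - t^2)))) = real_of_int (\<Sum>t\<in>?T. ind n t * int (card (tern (4*n - t^2))))"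
      by simp
    finally have zero: "(\<Sum>t\<in>?T. real_of_int (ind n t) * g (4*n - t^2)) = 0"
      unfolding tern_trace_sum[OF n] quat_trace_sum[OF n] hurwitz_class_number_relation[OF n] by simp
    have small: "real_of_int (ind n t) * g (4*n - t^2) = real_of_int (ind n t) * of_bool (t^2 = t0^2) * g N" if "t \<in> ?T" for t
    proof (cases "ind n t = 0 \<or> t^2 = t0^2")
      case True then show ?thesis using nt by auto
    next
      case False
      have "t^2 > t0^2"
      proof (cases "t = 0")
        case True
        then show ?thesis using False nt(2) by (auto simp: ind_def)
      next
        case f: False
        then have "t^2 \<ge> 1" using zero_less_power2[of t] by linarith
        then show ?thesis using nt(2) False by auto
      qed
      then have "g (4*n-t^2) = 0" using IH[of "4*n-t^2"] ind_nonzero[OF n(2), of t] c4[of t] that False nt(1) by simp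
      then show ?thesis using False by simp
    qed
    have fin: "finite ?T" by (rule finite_square_less)
    have "(\<Sum>t\<in>?T. real_of_int (ind n t) * g (4*n - t^2)) = (\<Sum>t\<in>?T. real_of_int (ind n t) * of_bool (t^2 = t0^2)) * g N"
      unfolding sum_distrib_right by (rule sum.cong[OF refl]) (use small in auto)
    then have "(\<Sum>t\<in>?T. real_of_int (ind n t) * of_bool (t^2 = t0^2)) * g N = 0" using zero by simp
    moreover have "(\<Sum>t\<in>?T. real_of_int (ind n t) * of_bool (t^2 = t0^2)) > 0"
    proof (rule sum_pos2[OF fin, of t0])
      show "t0 \<in> ?T" using nt(1) less.prems(1) by simp
      show "0 < real_of_int (ind n t0) * of_bool (t0^2 = t0^2)" using nt(2) by (auto simp: ind_def)
      show "0 \<le> real_of_int (ind n t) * of_bool (t^2 = t0^2)" for t by (simp add: ind_def)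
    qed
    ultimately have "g N = 0" by simp
    then show ?case by (simp add: g_def)
  qed
qed

section \<open>A maximal order of the quaternion algebra ramified at 3\<close>

text \<open>
  \<open>Quat a b c d\<close> stands for $(a+b\omega)+(c+d\omega)j$ with $\omega^2+\omega+1=0$, $j^2=-1$ and
  $j\alpha=\bar\alpha j$.
\<close>
datatype quat = Quat (qa: int) (qb: int) (qc: int) (qd: int)

lemma quat_eq_iff: "p = q \<longleftrightarrow> qa p = qa q \<and> qb p = qb q \<and> qc p = qc q \<and> qd p = qd q"
  by (cases p; cases q) auto

instantiation quat :: ring_1
begin
definition "0 = Quat 0 0 0 0"
definition "1 = Quat 1 0 0 0"
definition "p + q = Quat (qa p + qa q) (qb p + qb q) (qc p + qc q) (qd p + qd q)"
definition "p - q = Quat (qa p - qa q) (qb p - qb q) (qc p - qc q) (qd p - qd q)"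
definition "- p = Quat (- qa p) (- qb p) (- qc p) (- qd p)"
definition "p * q = Quat
  (qa p * qa q - qb p * qb q - (qc p * (qc q - qd q) + qd p * qd q))
  (qa p * qb q + qb p * qa q - qb p * qb q - (qd p * qc q - qc p * qd q))
  (qa p * qc q - qb p * qd q + (qc p * (qa q - qb q) + qd p * qb q))
  (qa p * qd q + qb p * qc q - qb p * qd q + (qd p * qa q - qc p * qb q))"
instance
  by standard (simp_all add: zero_quat_def one_quat_def plus_quat_def minus_quat_def uminus_quat_def times_quat_def algebra_simps)
end

lemma quat_sel [simp]:
  "qa 0 = 0" "qb 0 = 0" "qc 0 = 0" "qd 0 = 0" "qa 1 = 1" "qb 1 = 0" "qc 1 = 0" "qd 1 = 0"
  "qa (p + q) = qa p + qa q" "qb (p + q) = qb p + qb q" "qc (p + q) = qc p + qc q" "qd (p + q) = qd p + qd q"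
  "qa (p - q) = qa p - qa q" "qb (p - q) = qb p - qb q" "qc (p - q) = qc p - qc q" "qd (p - q) = qd p - qd q"
  "qa (- p) = - qa p" "qb (- p) = - qb p" "qc (- p) = - qc p" "qd (- p) = - qd p"
  by (simp_all add: zero_quat_def one_quat_def plus_quat_def minus_quat_def uminus_quat_def)

lemma quat_mult_sel:
  "qa (p * q) = qa p * qa q - qb p * qb q - (qc p * (qc q - qd q) + qd p * qd q)"
  "qb (p * q) = qa p * qb q + qb p * qa q - qb p * qb q - (qd p * qc q - qc p * qd q)"
  "qc (p * q) = qa p * qc q - qb p * qd q + (qc p * (qa q - qb q) + qd p * qb q)"
  "qd (p * q) = qa p * qd q + qb p * qc q - qb p * qd q + (qd p * qa q - qc p * qb q)"
  by (simp_all add: times_quat_def)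

lemma of_nat_quat: "of_nat k = Quat (int k) 0 0 0"
  by (induction k) (simp_all add: quat_eq_iff)

lemma of_int_quat: "of_int k = Quat k 0 0 0"
  by (cases k) (simp_all add: of_nat_quat quat_eq_iff)

lemma of_int_sel [simp]: "qa (of_int k) = k" "qb (of_int k) = 0" "qc (of_int k) = 0" "qd (of_int k) = 0"
  by (simp_all add: of_int_quat)

definition qcnj :: "quat \<Rightarrow> quat" where "qcnj q = Quat (qa q - qb q) (- qb q) (- qc q) (- qd q)"

lemma qcnj_sel [simp]: "qa (qcnj q) = qa q - qb q" "qb (qcnj q) = - qb q" "qc (qcnj q) = - qc q" "qd (qcnj q) = - qd q"
  by (simp_all add: qcnj_def)

definition qnorm :: "quat \<Rightarrow> int" where "qnorm q = eis_norm (qa q) (qb q) + eis_norm (qc q) (qd q)"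

lemma qnorm_mult: "qnorm (p * q) = qnorm p * qnorm q"
  unfolding qnorm_def eis_norm_def quat_mult_sel by (simp add: power2_eq_square algebra_simps)

lemma qcnj_qcnj [simp]: "qcnj (qcnj q) = q"
  by (simp add: quat_eq_iff)

lemma qnorm_qcnj [simp]: "qnorm (qcnj q) = qnorm q"
  by (simp add: qnorm_def eis_norm_def power2_eq_square algebra_simps)

lemma mult_qcnj: "q * qcnj q = of_int (qnorm q)"
  by (simp add: quat_eq_iff quat_mult_sel qnorm_def eis_norm_def power2_eq_square algebra_simps)

lemma qcnj_mult_self: "qcnj q * q = of_int (qnorm q)"
  using mult_qcnj[of "qcnj q"] by simp

lemma qnorm_nonneg: "qnorm q \<ge> 0"
  by (simp add: qnorm_def eis_norm_nonneg)

lemma qnorm_eq_0: "qnorm q = 0 \<longleftrightarrow> q = 0"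
proof
  assume "qnorm q = 0"
  then have "eis_norm (qa q) (qb q) = 0" "eis_norm (qc q) (qd q) = 0"
    using eis_norm_nonneg[of "qa q" "qb q"] eis_norm_nonneg[of "qc q" "qd q"] unfolding qnorm_def by linarith+
  then show "q = 0" by (simp add: eis_norm_0 quat_eq_iff)
qed (simp add: qnorm_def eis_norm_def)

lemma qnorm_of_int: "qnorm (of_int k) = k^2"
  by (simp add: qnorm_def eis_norm_def)

lemma qnorm_uminus [simp]: "qnorm (- q) = qnorm q"
  by (simp add: qnorm_def eis_norm_def)

lemma qnorm_add_scaled: "k dvd qnorm (p + of_int k * q) - qnorm p"
proof (rule dvdI)
  show "qnorm (p + of_int k * q) - qnorm p = k * (2 * qa p * qa q - qa p * qb q - qb p * qa q + 2 * qb p * qb q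
     + (2 * qc p * qc q - qc p * qd q - qd p * qc q + 2 * qd p * qd q) + k * qnorm q)"
    by (simp add: quat_mult_sel qnorm_def eis_norm_def power2_eq_square algebra_simps)
qed

lemma of_int_commute: "of_int k * (q::quat) = q * of_int k"
  by (simp add: quat_eq_iff quat_mult_sel)

section \<open>Division with remainder and factorization\<close>

lemma nearest_multiple:
  assumes "(m::int) > 0" obtains k where "\<bar>2 * (x - m * k)\<bar> \<le> m"
proof -
  define k where "k = (2*x + m) div (2*m)"
  have "(2*x + m) mod (2*m) = 2*x + m - 2*m*k" unfolding k_def by (simp add: minus_mult_div_eq_mod)
  then have "0 \<le> 2*x + m - 2*m*k" "2*x + m - 2*m*k < 2*m" using assms pos_mod_sign[of "2*m" "2*x+m"] pos_mod_bound[of "2*m" "2*x+m"] by linarith+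
  then have "\<bar>2 * (x - m * k)\<bar> \<le> m" by (simp add: algebra_simps)
  then show ?thesis using that by blast
qed

text \<open>Rounding \<open>y\<close> first and then \<open>2 x - y\<close> bounds four times the
  norm by \<open>m^2 + 3 (m/2)^2\<close>, whence 7/16. Two such terms stay below \<open>m^2\<close>,
  so the order is Euclidean.\<close>

lemma eis_approx:
  assumes "(m::int) > 0" shows "\<exists>k l. 16 * eis_norm (x - m*k) (y - m*l) \<le> 7 * m^2"
proof -
  obtain l where l: "\<bar>2 * (y - m*l)\<bar> \<le> m" using nearest_multiple[OF assms] .
  have m2: "2*m > 0" using assms by simp
  obtain k where k: "\<bar>2 * ((2*x - (y - m*l)) - (2*m)*k)\<bar> \<le> 2*m" using nearest_multiple[OF m2] .
  have "\<bar>2*(x - m*k) - (y - m*l)\<bar> \<le> m" using k by (simp add: algebra_simps)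
  then have 1: "(2*(x - m*k) - (y - m*l))^2 \<le> m^2" using assms by (intro abs_le_square_iff[THEN iffD1]) simp
  have "(2 * (y - m*l))^2 \<le> m^2" using l assms by (intro abs_le_square_iff[THEN iffD1]) simp
  then have 2: "4 * (y - m*l)^2 \<le> m^2" by (simp only: power_mult_distrib) simp
  have "16 * eis_norm (x - m*k) (y - m*l) = 4 * (2*(x - m*k) - (y - m*l))^2 + 12 * (y - m*l)^2"
    using eis_norm_4(1)[of "x - m*k" "y - m*l"] by linarith
  then have "16 * eis_norm (x - m*k) (y - m*l) \<le> 7 * m^2" using 1 2 by linarith
  then show ?thesis by blast
qed

lemma quat_approx:
  assumes "(m::int) > 0" shows "\<exists>k. qnorm (q - of_int m * k) < m^2"
proof -
  obtain k1 l1 where 1: "16 * eis_norm (qa q - m*k1) (qb q - m*l1) \<le> 7 * m^2" using eis_approx[OF assms] by blast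
  obtain k2 l2 where 2: "16 * eis_norm (qc q - m*k2) (qd q - m*l2) \<le> 7 * m^2" using eis_approx[OF assms] by blast
  have "qnorm (q - of_int m * Quat k1 l1 k2 l2) = eis_norm (qa q - m*k1) (qb q - m*l1) + eis_norm (qc q - m*k2) (qd q - m*l2)"
    by (simp add: qnorm_def quat_mult_sel)
  moreover have "m^2 > 0" using assms by simp
  ultimately have "qnorm (q - of_int m * Quat k1 l1 k2 l2) < m^2" using 1 2 by linarith
  then show ?thesis by blast
qed

lemma quat_division:
  assumes "b \<noteq> 0" shows "\<exists>k. qnorm (a - b * k) < qnorm b"
proof -
  have m: "qnorm b > 0" using assms qnorm_nonneg[of b] qnorm_eq_0[of b] by linarith
  obtain k where k: "qnorm (qcnj b * a - of_int (qnorm b) * k) < (qnorm b)^2" using quat_approx[OF m] by blast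
  have "qcnj b * a - of_int (qnorm b) * k = qcnj b * (a - b * k)"
    by (simp add: right_diff_distrib mult.assoc[symmetric] qcnj_mult_self)
  then have "qnorm b * qnorm (a - b * k) < qnorm b * qnorm b" using k by (simp add: qnorm_mult power2_eq_square)
  then have "qnorm (a - b * k) < qnorm b" using m by simp
  then show ?thesis by blast
qed

text \<open>\<open>g\<close> generates the right ideal \<open>J\<close> spanned by \<open>q\<close>
  and \<open>n1\<close>. Its norm divides \<open>n1^2\<close> and \<open>n1 n2\<close>, hence
  \<open>n1\<close> by coprimality; conversely every norm in \<open>J\<close> is congruent to some
  \<open>qnorm (q * u)\<close> modulo \<open>n1\<close>, hence divisible by
  \<open>n1\<close>.\<close>

lemma quat_factor:
  assumes "qnorm q = n1 * n2" "n1 > 0" "n2 > 0" "coprime n1 n2"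
  shows "\<exists>g s. q = g * s \<and> qnorm g = n1 \<and> qnorm s = n2"
proof -
  define J where "J = {x. \<exists>u v. x = q * u + of_int n1 * v}"
  have closed: "x - y * k \<in> J" if xJ: "x \<in> J" and yJ: "y \<in> J" for x y k
  proof -
    obtain u v where "x = q * u + of_int n1 * v" using xJ unfolding J_def by blast
    moreover obtain u' v' where "y = q * u' + of_int n1 * v'" using yJ unfolding J_def by blast
    ultimately have "x - y * k = q * (u - u' * k) + of_int n1 * (v - v' * k)" by (simp add: algebra_simps)
    then show ?thesis unfolding J_def by blast
  qed
  have "q = q * 1 + of_int n1 * 0" by simp
  then have qJ: "q \<in> J" unfolding J_def by blast
  have "of_int n1 = q * 0 + of_int n1 * 1" by simp
  then have nJ: "of_int n1 \<in> J" unfolding J_def by blast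
  have "q \<noteq> 0" using assms qnorm_eq_0[of q] by auto
  then obtain g where g: "g \<in> J \<and> g \<noteq> 0" "\<And>y. y \<in> J \<and> y \<noteq> 0 \<Longrightarrow> nat (qnorm g) \<le> nat (qnorm y)"
    using ex_has_least_nat[of "\<lambda>x. x \<in> J \<and> x \<noteq> 0" q "\<lambda>x. nat (qnorm x)"] qJ by blast
  have div: "\<exists>k. x = g * k" if "x \<in> J" for x
  proof -
    obtain k where k: "qnorm (x - g * k) < qnorm g" using quat_division g(1) by blast
    have "x - g * k \<in> J" using closed that g(1) by blast
    moreover have "\<not> nat (qnorm g) \<le> nat (qnorm (x - g*k))" using k qnorm_nonneg[of "x - g*k"] by linarith
    ultimately have "x - g * k = 0" using g(2)[of "x - g*k"] by blast
    then have "x = g * k" by simp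
    then show ?thesis by blast
  qed
  obtain s where s: "q = g * s" using div qJ by blast
  obtain t where t: "of_int n1 = g * t" using div nJ by blast
  have gp: "qnorm g > 0" using g(1) qnorm_nonneg[of g] qnorm_eq_0[of g] by linarith
  have nq: "qnorm g * qnorm s = n1 * n2" unfolding assms(1)[symmetric] qnorm_mult[symmetric] s ..
  have "qnorm g * qnorm t = n1^2" unfolding qnorm_mult[symmetric] t[symmetric] by (rule qnorm_of_int)
  then have "qnorm g dvd n1^2" by (metis dvd_triv_left)
  moreover have "qnorm g dvd n1 * n2" using nq by (metis dvd_triv_left)
  ultimately have "qnorm g dvd gcd (n1 * n2) (n1 * n1)" by (simp add: power2_eq_square)
  moreover have "gcd (n1 * n2) (n1 * n1) = n1 * gcd n2 n1" using assms(2) by (simp add: gcd_mult_left abs_mult)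
  moreover have "gcd n2 n1 = 1" using assms(4) by (simp add: gcd.commute)
  ultimately have d1: "qnorm g dvd n1" by simp
  obtain u v where uv: "g = q * u + of_int n1 * v" using g(1) by (auto simp: J_def)
  have "n1 dvd qnorm g - qnorm (q * u)" unfolding uv by (rule qnorm_add_scaled)
  moreover have "n1 dvd qnorm (q * u)" unfolding qnorm_mult assms(1) by simp
  ultimately have "n1 dvd (qnorm g - qnorm (q * u)) + qnorm (q * u)" by (rule dvd_add)
  then have d2: "n1 dvd qnorm g" by simp
  have ng: "qnorm g = n1" using d1 d2 gp assms(2) zdvd_antisym_nonneg[of "qnorm g" n1] by simp
  have "n1 * qnorm s = n1 * n2" using nq ng by simp
  then have "qnorm s = n2" using assms(2) by simp
  then show ?thesis using s ng by blast
qed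

lemma quat_factor_unique:
  assumes "g * s = g' * s'" "qnorm g = n1" "qnorm g' = n1" "qnorm s = n2" "qnorm s' = n2" "n1 > 0" "coprime n1 n2"
  shows "\<exists>u. qnorm u = 1 \<and> g' = g * u \<and> s = u * s'"
proof -
  obtain A B where AB: "A * n1 + B * n2 = 1" using assms(7) bezout_int[of n1 n2] by (auto simp: coprime_iff_gcd_eq_1)
  \<comment> \<open>The quotient of \<open>g'\<close> by \<open>g\<close> is rational a priori. Both
    \<open>n1\<close> times it, \<open>qcnj g * g'\<close>, and \<open>n2\<close> times it,
    \<open>s * qcnj s'\<close>, are integral, so the Bezout combination is the quotient
    itself.\<close>
  define u where "u = qcnj g * g' * of_int A + s * qcnj s' * of_int B"
  have 1: "g * (qcnj g * g' * of_int A) = g' * of_int (A * n1)"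
  proof -
    have "g * (qcnj g * g' * of_int A) = (g * qcnj g) * g' * of_int A" by (simp only: mult.assoc)
    also have "\<dots> = of_int n1 * g' * of_int A" by (simp only: mult_qcnj assms(2))
    also have "\<dots> = g' * of_int n1 * of_int A" unfolding of_int_commute[of n1 g'] ..
    also have "\<dots> = g' * (of_int A * of_int n1)" unfolding mult.assoc of_int_commute[of n1 "of_int A"] ..
    finally show ?thesis by (simp only: of_int_mult)
  qed
  have 2: "g * (s * qcnj s' * of_int B) = g' * of_int (B * n2)"
  proof -
    have "g * (s * qcnj s' * of_int B) = (g * s) * qcnj s' * of_int B" by (simp only: mult.assoc)
    also have "\<dots> = g' * (s' * qcnj s') * of_int B" by (simp only: assms(1) mult.assoc)
    also have "\<dots> = g' * of_int n2 * of_int B" by (simp only: mult_qcnj assms(5))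
    also have "\<dots> = g' * (of_int B * of_int n2)" unfolding mult.assoc of_int_commute[of n2 "of_int B"] ..
    finally show ?thesis by (simp only: of_int_mult)
  qed
  have gu: "g' = g * u"
  proof -
    have "g * u = g' * of_int (A * n1) + g' * of_int (B * n2)" unfolding u_def distrib_left 1 2 ..
    also have "\<dots> = g' * of_int (A * n1 + B * n2)" by (simp add: distrib_left)
    finally show ?thesis unfolding AB by simp
  qed
  have "n1 * qnorm u = n1" using qnorm_mult[of g u] assms(2,3) gu by simp
  then have u: "qnorm u = 1" using assms(6) by simp
  have "g * (s - u * s') = 0" using assms(1) gu by (simp add: right_diff_distrib mult.assoc)
  then have "qnorm g * qnorm (s - u * s') = 0" unfolding qnorm_mult[symmetric] qnorm_eq_0 .
  then have "qnorm (s - u * s') = 0" using assms(2,6) by simp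
  then have "s = u * s'" by (simp add: qnorm_eq_0)
  then show ?thesis using u gu by blast
qed

section \<open>Normalization modulo 2\<close>

definition congruent_one :: "quat \<Rightarrow> bool" where
  "congruent_one q \<longleftrightarrow> odd (qa q) \<and> even (qb q) \<and> even (qc q) \<and> even (qd q)"

lemma congruent_one_mult: "congruent_one p \<Longrightarrow> congruent_one q \<Longrightarrow> congruent_one (p * q)"
  by (simp add: congruent_one_def quat_mult_sel)

lemma congruent_one_cancel: "congruent_one p \<Longrightarrow> congruent_one (p * q) \<Longrightarrow> congruent_one q"
  by (simp add: congruent_one_def quat_mult_sel)

lemma congruent_one_qcnj: "congruent_one q \<Longrightarrow> congruent_one (qcnj q)"
  by (simp add: congruent_one_def)

lemma congruent_one_unit:
  assumes "congruent_one u" "qnorm u = 1" shows "u = 1 \<or> u = -1"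
proof -
  have z: "eis_norm (qc u) (qd u) = 0"
  proof (rule ccontr)
    assume "eis_norm (qc u) (qd u) \<noteq> 0"
    then have "eis_norm (qa u) (qb u) = 0" using assms(2) eis_norm_nonneg[of "qa u" "qb u"] eis_norm_nonneg[of "qc u" "qd u"] unfolding qnorm_def by linarith
    then show False using assms(1) by (simp add: eis_norm_0 congruent_one_def)
  qed
  then have "eis_norm (qa u) (qb u) = 1" using assms(2) by (simp only: qnorm_def add_0_right)
  then have 1: "qc u = 0" "qd u = 0" "(qa u, qb u) \<in> eis 1" using z by (simp_all add: eis_norm_0 eis_def)
  then have "(qa u, qb u) = (1,0) \<or> (qa u, qb u) = (-1,0)" using assms(1) unfolding eis_one congruent_one_def by auto
  then show ?thesis using 1 by (auto simp: quat_eq_iff)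
qed

lemma eis_norm_even: "even (eis_norm x y) \<longleftrightarrow> even x \<and> even y"
  by (auto simp: eis_norm_def)

text \<open>The units modulo sign represent all six invertible classes modulo 2: a factor
  \<open>j\<close> makes the \<open>j\<close> part even, then \<open>1\<close>, \<open>omega\<close>
  or \<open>omega^2\<close> makes the rest congruent to 1. With \<open>congruent_one_unit\<close>
  this leaves only the sign ambiguous.\<close>

lemma normalize_unit:
  assumes "odd (qnorm q)" shows "\<exists>u. qnorm u = 1 \<and> congruent_one (q * u)"
proof -
  have *: "\<exists>u. qnorm u = 1 \<and> congruent_one (p * u)" if p: "even (qc p)" "even (qd p)" "\<not> (even (qa p) \<and> even (qb p))" for p
  proof -
    consider "odd (qa p) \<and> even (qb p)" | "even (qa p) \<and> odd (qb p)" | "odd (qa p) \<and> odd (qb p)" using p(3) by blast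
    then show ?thesis
    proof cases
      case 1 then show ?thesis using p by (intro exI[of _ "Quat 1 0 0 0"]) (simp add: congruent_one_def quat_mult_sel qnorm_def eis_norm_def)
    next
      case 2 then show ?thesis using p by (intro exI[of _ "Quat (-1) (-1) 0 0"]) (simp add: congruent_one_def quat_mult_sel qnorm_def eis_norm_def)
    next
      case 3 then show ?thesis using p by (intro exI[of _ "Quat 0 1 0 0"]) (simp add: congruent_one_def quat_mult_sel qnorm_def eis_norm_def)
    qed
  qed
  have "odd (eis_norm (qa q) (qb q)) \<and> even (eis_norm (qc q) (qd q)) \<or> even (eis_norm (qa q) (qb q)) \<and> odd (eis_norm (qc q) (qd q))"
    using assms by (auto simp: qnorm_def)
  then show ?thesis
  proof
    assume "odd (eis_norm (qa q) (qb q)) \<and> even (eis_norm (qc q) (qd q))"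
    then show ?thesis using * unfolding eis_norm_even by blast
  next
    assume h: "even (eis_norm (qa q) (qb q)) \<and> odd (eis_norm (qc q) (qd q))"
    let ?j = "Quat 0 0 1 0"
    have "even (qc (q * ?j))" "even (qd (q * ?j))" "\<not> (even (qa (q * ?j)) \<and> even (qb (q * ?j)))"
      using h unfolding eis_norm_even by (auto simp: quat_mult_sel)
    then obtain u where "qnorm u = 1" "congruent_one (q * ?j * u)" using * by blast
    then have "qnorm (?j * u) = 1" "congruent_one (q * (?j * u))" by (simp_all add: qnorm_mult mult.assoc qnorm_def[of ?j] eis_norm_def)
    then show ?thesis by blast
  qed
qed

lemma normalized_factor:
  assumes "congruent_one q" "qnorm q = n1 * n2" "n1 > 0" "n2 > 0" "coprime n1 n2" "odd n1"
  shows "\<exists>g s. q = g * s \<and> qnorm g = n1 \<and> qnorm s = n2 \<and> congruent_one g \<and> congruent_one s"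
proof -
  obtain g s where gs: "q = g * s" "qnorm g = n1" "qnorm s = n2" using quat_factor[OF assms(2-5)] by blast
  obtain u where u: "qnorm u = 1" "congruent_one (g * u)" using normalize_unit[of g] gs assms(6) by auto
  have "q = (g * u) * (qcnj u * s)"
  proof -
    have "(g * u) * (qcnj u * s) = g * (u * qcnj u) * s" by (simp only: mult.assoc)
    then show ?thesis by (simp add: mult_qcnj u gs(1))
  qed
  moreover have "congruent_one (qcnj u * s)" using congruent_one_cancel[OF u(2)] assms(1) calculation by simp
  moreover have "qnorm (g * u) = n1" "qnorm (qcnj u * s) = n2" using gs u by (simp_all add: qnorm_mult)
  ultimately show ?thesis using u(2) by blast
qed

lemma normalized_factor_unique:
  assumes "g * s = g' * s'" "qnorm g = n1" "qnorm g' = n1" "qnorm s = n2" "qnorm s' = n2" "n1 > 0" "coprime n1 n2"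
    "congruent_one g" "congruent_one g'"
  shows "(g' = g \<and> s' = s) \<or> (g' = - g \<and> s' = - s)"
proof -
  obtain u where u: "qnorm u = 1" "g' = g * u" "s = u * s'" using quat_factor_unique[OF assms(1-7)] by blast
  have "congruent_one u" using congruent_one_cancel assms(8,9) u(2) by blast
  then have "u = 1 \<or> u = -1" using congruent_one_unit u(1) by blast
  then show ?thesis using u by auto
qed

definition norm_set :: "int \<Rightarrow> quat set" where "norm_set m = {q. qnorm q = m}"
definition one_set :: "int \<Rightarrow> quat set" where "one_set m = {q. qnorm q = m \<and> congruent_one q}"

lemma norm_set_reps: "norm_set m = (\<lambda>(x,y,z,w). Quat x y z w) ` quat_reps m"
proof (intro equalityI subsetI)
  fix q assume "q \<in> norm_set m"
  then have "(qa q, qb q, qc q, qd q) \<in> quat_reps m" by (simp add: norm_set_def quat_reps_def qnorm_def)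
  then show "q \<in> (\<lambda>(x,y,z,w). Quat x y z w) ` quat_reps m" by (rule rev_image_eqI) simp
qed (auto simp: norm_set_def quat_reps_def qnorm_def)

lemma finite_norm_set: "finite (norm_set m)"
  unfolding norm_set_reps by (rule finite_imageI[OF finite_quat_reps])

lemma card_norm_set: "card (norm_set m) = card (quat_reps m)"
  unfolding norm_set_reps by (rule card_image) (auto simp: inj_on_def)

lemma finite_one_set: "finite (one_set m)"
  by (rule finite_subset[OF _ finite_norm_set[of m]]) (auto simp: one_set_def norm_set_def)

text \<open>For odd norm exactly one of the two Eisenstein coordinates is even. Exchanging them
  (\<open>?s\<close>) and multiplying the first by \<open>omega\<close> (\<open>?w\<close>) or
  \<open>omega^2\<close> (\<open>?v\<close>) preserve the norm and permute the six classes modulo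
  2.\<close>

lemma card_one_set:
  assumes "odd m" shows "card (norm_set m) = 6 * card (one_set m)"
proof -
  define A where "A = {q \<in> norm_set m. even (qc q) \<and> even (qd q)}"
  define B where "B = {q \<in> norm_set m. even (qa q) \<and> even (qb q)}"
  define T2 where "T2 = {q \<in> norm_set m. even (qc q) \<and> even (qd q) \<and> even (qa q) \<and> odd (qb q)}"
  define T3 where "T3 = {q \<in> norm_set m. even (qc q) \<and> even (qd q) \<and> odd (qa q) \<and> odd (qb q)}"
  let ?w = "\<lambda>q. Quat (- qb q) (qa q - qb q) (qc q) (qd q)" and ?v = "\<lambda>q. Quat (qb q - qa q) (- qa q) (qc q) (qd q)"
  let ?s = "\<lambda>q. Quat (qc q) (qd q) (qa q) (qb q)"
  have nw: "qnorm (?w q) = qnorm q" "qnorm (?v q) = qnorm q" "qnorm (?s q) = qnorm q" for q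
    by (simp_all add: qnorm_def eis_norm_def power2_eq_square algebra_simps)
  have par: "even (qa q) \<and> even (qb q) \<longleftrightarrow> \<not> (even (qc q) \<and> even (qd q))" if "q \<in> norm_set m" for q
    using that assms eis_norm_even[of "qa q" "qb q"] eis_norm_even[of "qc q" "qd q"] by (auto simp: norm_set_def qnorm_def)
  have fin: "finite A" "finite B" "finite T2" "finite T3" 
    unfolding A_def B_def T2_def T3_def using finite_norm_set by auto
  have "card A = card B"
    by (rule bij_betw_same_card[OF bij_betwI[where f="?s" and g="?s"]]) (auto simp: A_def B_def norm_set_def nw)
  moreover have "norm_set m = A \<union> B" "A \<inter> B = {}" using par unfolding A_def B_def by blast+
  ultimately have "card (norm_set m) = 2 * card A" using card_Un_disjoint[of A B] fin by simp
  moreover have "card (one_set m) = card T2"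
    by (rule bij_betw_same_card[OF bij_betwI[where f="?w" and g="?v"]]) (auto simp: one_set_def congruent_one_def T2_def norm_set_def nw)
  moreover have "card T2 = card T3"
    by (rule bij_betw_same_card[OF bij_betwI[where f="?w" and g="?v"]]) (auto simp: T3_def T2_def norm_set_def nw)
  moreover have "card A = card (one_set m) + card T2 + card T3"
  proof -
    have "A = (one_set m \<union> T2) \<union> T3"
    proof (intro equalityI subsetI)
      fix q assume "q \<in> A"
      then show "q \<in> (one_set m \<union> T2) \<union> T3" using par[of q] unfolding A_def T2_def T3_def one_set_def norm_set_def congruent_one_def by blast
    qed (auto simp: A_def T2_def T3_def one_set_def norm_set_def congruent_one_def)
    moreover have "card ((one_set m \<union> T2) \<union> T3) = card (one_set m \<union> T2) + card T3"
      by (rule card_Un_disjoint) (use fin finite_one_set in \<open>auto simp: T2_def T3_def one_set_def congruent_one_def\<close>)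
    moreover have "card (one_set m \<union> T2) = card (one_set m) + card T2"
      by (rule card_Un_disjoint) (use fin finite_one_set in \<open>auto simp: T2_def one_set_def congruent_one_def\<close>)
    ultimately show ?thesis by simp
  qed
  ultimately show ?thesis by simp
qed

text \<open>$\omega\mapsto 1$ maps the order onto $F_9=F_3(j)$, \<open>q\<close> to \<open>resA q + resB q j\<close>.\<close>
definition resA :: "quat \<Rightarrow> int" where "resA q = qa q + qb q"
definition resB :: "quat \<Rightarrow> int" where "resB q = qc q + qd q"

lemma resA_mult: "[resA (p * q) = resA p * resA q - resB p * resB q] (mod 3)"
  unfolding cong_iff_dvd_diff
  by (rule dvdI[of _ _ "- qb p * qb q + (qc p + qd p) * qd q - qd p * qd q"])
     (simp add: resA_def resB_def quat_mult_sel algebra_simps)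

text \<open>On residues in F_9, conjugation keeps \<open>resA\<close> and negates
  \<open>resB\<close>.\<close>

lemma resA_qcnj_mult: "[resA (qcnj p * q) = resA p * resA q + resB p * resB q] (mod 3)"
  unfolding cong_iff_dvd_diff
  by (rule dvdI[of _ _ "- qb p * (qa q + qb q) + qb p * qb q - (qc p + qd p) * qd q + qd p * qd q"])
     (simp add: resA_def resB_def quat_mult_sel algebra_simps)

lemma eis_norm_res: "3 dvd eis_norm x y \<longleftrightarrow> 3 dvd (x + y)"
proof -
  have "3 dvd (2*x-y) \<longleftrightarrow> 3 dvd (x + y)" by presburger
  then show ?thesis using eis_norm_trace_mod_3(1)[of x y] by simp
qed

text \<open>The norm is \<open>resA^2 + resB^2\<close> (mod 3), and 2 is a sum of two squares only
  as 1 + 1.\<close>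

lemma res_norm_2:
  assumes "qnorm q mod 3 = 2" shows "\<not> 3 dvd resA q" "\<not> 3 dvd resB q"
  using norms_mod_3(1)[of "qa q" "qb q" "qc q" "qd q" "qnorm q"] assms by (simp_all add: qnorm_def eis_norm_res resA_def resB_def)

lemma not_dvd_3_cases: "\<not> 3 dvd (x::int) \<Longrightarrow> x mod 3 = 1 \<or> x mod 3 = 2"
  by presburger

text \<open>The first coordinates are \<open>a c - b d\<close> and \<open>a c + b d\<close> with all
  four residues nonzero; the products \<open>a c\<close> and \<open>b d\<close> are equal or
  opposite modulo 3, so exactly one of the two vanishes.\<close>

lemma conjugate_factor_flips:
  assumes "qnorm g mod 3 = 2" "qnorm s mod 3 = 2"
  shows "3 dvd resA (qcnj g * s) \<longleftrightarrow> \<not> 3 dvd resA (g * s)"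
proof -
  define a b c d where "a = resA g mod 3" "b = resB g mod 3" "c = resA s mod 3" "d = resB s mod 3"
  have cs: "a = 1 \<or> a = 2" "b = 1 \<or> b = 2" "c = 1 \<or> c = 2" "d = 1 \<or> d = 2"
    unfolding a_b_c_d_def by (intro not_dvd_3_cases res_norm_2 assms)+
  have "[resA g * resA s = a * c] (mod 3)" "[resB g * resB s = b * d] (mod 3)"
    unfolding a_b_c_d_def by (intro cong_mult; simp add: cong_def)+
  then have "[resA (g * s) = a * c - b * d] (mod 3)" "[resA (qcnj g * s) = a * c + b * d] (mod 3)"
    using resA_mult[of g s] resA_qcnj_mult[of g s] by (blast intro: cong_trans cong_diff cong_add)+
  then have "3 dvd resA (g * s) \<longleftrightarrow> 3 dvd (a * c - b * d)" "3 dvd resA (qcnj g * s) \<longleftrightarrow> 3 dvd (a * c + b * d)"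
    using cong_dvd_iff by blast+
  then show ?thesis using cs by auto
qed

lemma residue_balance:
  assumes "m = n1 * n2" "n1 > 0" "n2 > 0" "coprime n1 n2" "odd n1" "n1 mod 3 = 2" "n2 mod 3 = 2"
  shows "2 * card {q \<in> one_set m. 3 dvd resA q} = card (one_set m)"
proof -
  define P where "P q g s \<longleftrightarrow> q = g * s \<and> qnorm g = n1 \<and> qnorm s = n2 \<and> congruent_one g \<and> congruent_one s" for q g s
  \<comment> \<open>The factorization is unique up to a common sign, which cancels in
    \<open>qcnj g * s\<close>; so the choice is immaterial (\<open>FP\<close>). The image factors as
    \<open>qcnj g\<close> times \<open>s\<close>, which makes \<open>F\<close> an
    involution.\<close>
  define F where "F q = (SOME x. \<exists>g s. P q g s \<and> x = qcnj g * s)" for q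
  have F: "\<exists>g s. P q g s \<and> F q = qcnj g * s" if q: "q \<in> one_set m" for q
  proof -
    have "\<exists>g s. P q g s" using normalized_factor[of q n1 n2] q assms unfolding one_set_def P_def by auto
    then have "\<exists>x. \<exists>g s. P q g s \<and> x = qcnj g * s" by blast
    then show ?thesis unfolding F_def by (rule someI_ex)
  qed
  have FP: "F q = qcnj g * s" if gs: "P q g s" and q: "q \<in> one_set m" for q g s
  proof -
    obtain g' s' where h: "P q g' s'" "F q = qcnj g' * s'" using F[OF q] by blast
    have "(g' = g \<and> s' = s) \<or> (g' = - g \<and> s' = - s)"
      by (rule normalized_factor_unique[where ?n1.0 = n1 and ?n2.0 = n2]) (use h(1) gs assms in \<open>auto simp: P_def\<close>)
    moreover have "qcnj (- g) * - s = qcnj g * s" by (simp add: quat_eq_iff quat_mult_sel algebra_simps)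
    ultimately show ?thesis using h(2) by auto
  qed
  have cnjP: "P (qcnj g * s) (qcnj g) s" and cnjm: "qcnj g * s \<in> one_set m" if "P q g s" for q g s
    using that congruent_one_qcnj congruent_one_mult by (auto simp: P_def one_set_def qnorm_mult assms(1))
  have Fm: "F q \<in> one_set m" and FF: "F (F q) = q" and Fr: "3 dvd resA (F q) \<longleftrightarrow> \<not> 3 dvd resA q" if q: "q \<in> one_set m" for q
  proof -
    obtain g s where h: "P q g s" "F q = qcnj g * s" using F[OF q] by blast
    show "F q \<in> one_set m" unfolding h(2) by (rule cnjm[OF h(1)])
    show "F (F q) = q" unfolding h(2) using FP[OF cnjP[OF h(1)] cnjm[OF h(1)]] h(1) by (simp add: P_def)
    show "3 dvd resA (F q) \<longleftrightarrow> \<not> 3 dvd resA q" unfolding h(2) using conjugate_factor_flips[of g s] h(1) assms by (simp add: P_def)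
  qed
  have "card {q \<in> one_set m. 3 dvd resA q} = card {q \<in> one_set m. \<not> 3 dvd resA q}"
    by (rule bij_betw_same_card[OF bij_betwI[where f=F and g=F]]) (use Fm FF Fr in auto)
  moreover have "card (one_set m) = card {q \<in> one_set m. 3 dvd resA q} + card {q \<in> one_set m. \<not> 3 dvd resA q}"
    using card_Un_disjoint[of "{q \<in> one_set m. 3 dvd resA q}" "{q \<in> one_set m. \<not> 3 dvd resA q}"] finite_one_set[of m]
    by (simp add: Collect_disj_eq[symmetric] conj_disj_distribL[symmetric] disjoint_iff)
  ultimately show ?thesis by simp
qed

text \<open>An element congruent to 1 is \<open>r + z (1 + 2 omega) + 2 (x + y omega) j\<close>,
  with norm \<open>r^2 + 3 z^2 + 4 eis_norm x y\<close> and \<open>resA\<close> equal to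
  \<open>r + 3 z\<close>. The condition on \<open>c\<close> rules out \<open>r^2 = m\<close>, which
  the range of summation omits.\<close>

lemma ternary_residue_count:
  assumes "odd m" "\<not> [c^2 = m] (mod 3)"
  shows "(\<Sum>r\<in>{r. r^2 < m \<and> r mod 3 = c mod 3}. card (tern (m - r^2))) = card {q \<in> one_set m. resA q mod 3 = c mod 3}"
proof -
  let ?S = "{r. r^2 < m \<and> r mod 3 = c mod 3}"
  have fin: "finite ?S" by (rule finite_subset[OF _ finite_square_less[of m]]) auto
  have "(\<Sum>r\<in>?S. card (tern (m - r^2))) = card (Sigma ?S (\<lambda>r. tern (m - r^2)))"
    using fin finite_tern by simp
  also have "\<dots> = card {q \<in> one_set m. resA q mod 3 = c mod 3}"
  proof (rule bij_betw_same_card[OF bij_betwI[where f="\<lambda>(r,(z,x,y)). Quat (r+z) (2*z) (2*x) (2*y)" and g="\<lambda>q. (qa q - qb q div 2, (qb q div 2, qc q div 2, qd q div 2))"]])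
    show "(\<lambda>(r,(z,x,y)). Quat (r+z) (2*z) (2*x) (2*y)) \<in> Sigma ?S (\<lambda>r. tern (m - r^2)) \<rightarrow> {q \<in> one_set m. resA q mod 3 = c mod 3}"
    proof
      fix v assume "v \<in> Sigma ?S (\<lambda>r. tern (m - r^2))"
      then obtain r z x y where v: "v = (r,(z,x,y))" "r mod 3 = c mod 3" "3*z^2 + 4*eis_norm x y = m - r^2" by (cases v) (auto simp: tern_def)
      have "eis_norm (r+z) (2*z) = r^2 + 3*z^2" "eis_norm (2*x) (2*y) = 4 * eis_norm x y" by (simp_all add: eis_norm_def power2_eq_square algebra_simps)
      then have n: "eis_norm (r+z) (2*z) + eis_norm (2*x) (2*y) = m" using v(3) by linarith
      have "m = r^2 + 3*z^2 + 4*eis_norm x y" using v(3) by linarith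
      then have "odd (r^2 + 3*z^2)" using assms(1) by simp
      then have "odd (r+z)" by simp
      moreover have "(r + z + 2*z) mod 3 = r mod 3" by presburger
      ultimately show "(\<lambda>(r,(z,x,y)). Quat (r+z) (2*z) (2*x) (2*y)) v \<in> {q \<in> one_set m. resA q mod 3 = c mod 3}"
        using n v by (simp add: one_set_def congruent_one_def qnorm_def resA_def)
    qed
    show "(\<lambda>q. (qa q - qb q div 2, (qb q div 2, qc q div 2, qd q div 2))) \<in> {q \<in> one_set m. resA q mod 3 = c mod 3} \<rightarrow> Sigma ?S (\<lambda>r. tern (m - r^2))"
    proof
      fix q assume q: "q \<in> {q \<in> one_set m. resA q mod 3 = c mod 3}"
      then obtain z x y where zxy: "qb q = 2*z" "qc q = 2*x" "qd q = 2*y" by (auto simp: one_set_def congruent_one_def elim!: evenE)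
      define r where "r = qa q - z"
      have qa: "qa q = r + z" by (simp add: r_def)
      have "eis_norm (r+z) (2*z) = r^2 + 3*z^2" "eis_norm (2*x) (2*y) = 4 * eis_norm x y" by (simp_all add: eis_norm_def power2_eq_square algebra_simps)
      moreover have "qnorm q = m" using q by (simp add: one_set_def)
      then have "eis_norm (r+z) (2*z) + eis_norm (2*x) (2*y) = m" unfolding qnorm_def zxy qa .
      ultimately have t: "3*z^2 + 4*eis_norm x y = m - r^2" by linarith
      have "(r + z + 2*z) mod 3 = r mod 3" by presburger
      moreover have "resA q = r + z + 2*z" unfolding resA_def zxy qa ..
      ultimately have rc: "r mod 3 = c mod 3" using q by simp
      have "r^2 \<noteq> m"
      proof
        assume "r^2 = m"
        moreover have "[c^2 = r^2] (mod 3)" by (rule cong_pow) (simp add: cong_def rc)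
        ultimately show False using assms(2) by simp
      qed
      moreover have "r^2 \<le> m" using t eis_norm_nonneg[of x y] zero_le_power2[of z] by linarith
      ultimately have "r^2 < m" by simp
      then show "(qa q - qb q div 2, (qb q div 2, qc q div 2, qd q div 2)) \<in> Sigma ?S (\<lambda>r. tern (m - r^2))"
        using t rc unfolding zxy qa by (simp add: tern_def)
    qed
    fix v assume "v \<in> Sigma ?S (\<lambda>r. tern (m - r^2))"
    then show "(\<lambda>q. (qa q - qb q div 2, (qb q div 2, qc q div 2, qd q div 2))) ((\<lambda>(r,(z,x,y)). Quat (r+z) (2*z) (2*x) (2*y)) v) = v"
      by (cases v) auto
  next
    fix q assume q: "q \<in> {q \<in> one_set m. resA q mod 3 = c mod 3}"
    then show "(\<lambda>(r,(z,x,y)). Quat (r+z) (2*z) (2*x) (2*y)) (qa q - qb q div 2, (qb q div 2, qc q div 2, qd q div 2)) = q"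
      by (auto simp: one_set_def congruent_one_def quat_eq_iff)
  qed
  finally show ?thesis .
qed

lemma residue_count_2:
  assumes "m mod 3 = 2" "c mod 3 = 1 \<or> c mod 3 = 2"
  shows "2 * card {q \<in> one_set m. resA q mod 3 = c mod 3} = card (one_set m)"
proof -
  let ?A = "{q \<in> one_set m. resA q mod 3 = 1}" and ?B = "{q \<in> one_set m. resA q mod 3 = 2}"
  have mm: "- q \<in> one_set m" if "q \<in> one_set m" for q using that by (simp add: one_set_def congruent_one_def)
  have r: "resA (- q) = - resA q" for q by (simp add: resA_def)
  have "card ?A = card ?B"
  proof (rule bij_betw_same_card[OF bij_betwI[where f=uminus and g=uminus]])
    have "- x mod 3 = 2" if "x mod 3 = 1" for x :: int using that by presburger
    then show "uminus \<in> ?A \<rightarrow> ?B" using mm r by auto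
    have "- x mod 3 = 1" if "x mod 3 = 2" for x :: int using that by presburger
    then show "uminus \<in> ?B \<rightarrow> ?A" using mm r by auto
  qed auto
  moreover have "one_set m = ?A \<union> ?B"
  proof -
    have "resA q mod 3 = 1 \<or> resA q mod 3 = 2" if "q \<in> one_set m" for q
      using that assms(1) by (intro not_dvd_3_cases res_norm_2) (simp add: one_set_def)
    then show ?thesis by auto
  qed
  moreover have "card (?A \<union> ?B) = card ?A + card ?B"
    by (rule card_Un_disjoint) (use finite_one_set in auto)
  ultimately show ?thesis using assms(2) by auto
qed

lemma power_mod_3:
  assumes "(p::nat) mod 3 = 2" "odd k" shows "p ^ k mod 3 = 2"
proof -
  obtain j where j: "k = 2*j+1" using assms(2) by (rule oddE)
  have "(4::nat)^j mod 3 = 1"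
    using power_mod[of "4::nat" 3 j] by simp
  then have "(4::nat)^j * 2 mod 3 = 2" by presburger
  moreover have "(2::nat)^k = (2^2)^j * 2" unfolding j by (simp only: power_add power_mult power_one_right)
  ultimately have "(2::nat)^k mod 3 = 2" by simp
  then show ?thesis using power_mod[of p 3 k] unfolding assms(1) by simp
qed

theorem theorem5:
  fixes n :: nat and c :: int
  assumes "n > 0"
    and "gcd n 6 = 1"
    and "\<exists>p::nat. prime p \<and> p mod 3 = 2 \<and> odd (multiplicity p n)"
    and "(n mod 3 = 1 \<and> c = 0) \<or> (n mod 3 = 2 \<and> (c = 1 \<or> c = 2))"
  shows "(\<Sum>r \<in> {r::int. real_of_int \<bar>r\<bar> < sqrt (real n) \<and> r mod 3 = c mod 3}.
            hurwitz (int n - r^2)) = real (\<Sum>d \<in> {d. d dvd n}. d) / 12"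
proof -
  define m where "m = int n"
  define sigma where "sigma = (\<Sum>d\<in>posdivs m. d)"
  have m0: "m > 0" using assms(1) by (simp add: m_def)
  have "odd n"
  proof
    assume "even n" then have "2 dvd gcd n 6" by simp
    then show False using assms(2) by simp
  qed
  then have om: "odd m" by (simp add: m_def)
  have mc: "m mod 3 = 1 \<and> c = 0 \<or> m mod 3 = 2 \<and> (c = 1 \<or> c = 2)"
    using assms(4) unfolding m_def by presburger
  then have m3: "\<not> 3 dvd m" by presburger
  have sig: "real (\<Sum>d \<in> {d. d dvd n}. d) = real_of_int sigma"
  proof -
    have "sigma = (\<Sum>d\<in>{d. d dvd n}. int d)" unfolding sigma_def
      by (rule sum.reindex_bij_witness[where i=int and j=nat]) (use assms(1) in \<open>auto simp: posdivs_def m_def dvd_pos_nat nat_dvd_iff\<close>)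
    then show ?thesis by simp
  qed
  have S: "{r::int. real_of_int \<bar>r\<bar> < sqrt (real n) \<and> r mod 3 = c mod 3} = {r. r^2 < m \<and> r mod 3 = c mod 3}"
  proof -
    have "real_of_int \<bar>r\<bar> < sqrt (real n) \<longleftrightarrow> r^2 < m" for r :: int
    proof -
      have "real_of_int \<bar>r\<bar> < sqrt (real n) \<longleftrightarrow> sqrt (real_of_int (r^2)) < sqrt (real n)" by simp
      also have "\<dots> \<longleftrightarrow> real_of_int (r^2) < real_of_int m" unfolding real_sqrt_less_iff m_def by simp
      finally show ?thesis by (simp only: of_int_less_iff)
    qed
    then show ?thesis by simp
  qed
  \<comment> \<open>Both allowed choices satisfy \<open>c^2 = m - 1\<close> (mod 3), so every term
    lies in the class of \<open>hurwitz_eq_ternary\<close>.\<close>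
  have sq: "(m - r^2) mod 3 = 1" if "r mod 3 = c mod 3" for r
  proof (cases "3 dvd r")
    case True
    then have "m mod 3 = 1" using that mc by presburger
    moreover obtain k where "r = 3*k" using True by blast
    then have "r^2 = 3*(3*k^2)" by (simp add: power2_eq_square)
    ultimately show ?thesis by presburger
  next
    case False
    then have "m mod 3 = 2" using that mc by presburger
    then show ?thesis using square_mod_3[OF False] by presburger
  qed
  have c2: "\<not> [c^2 = m] (mod 3)" using mc by (auto simp: cong_def)
  have count: "2 * card {q \<in> one_set m. resA q mod 3 = c mod 3} = card (one_set m)"
  proof (cases "m mod 3 = 2")
    case True
    then show ?thesis using residue_count_2[of m c] mc by auto
  next
    case False
    then have m1: "m mod 3 = 1" "c = 0" using mc by auto
    obtain p where p: "prime p" "p mod 3 = 2" "odd (multiplicity p n)" using assms(3) by blast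
    \<comment> \<open>The full power of \<open>p\<close> is split off: this makes the factors
      coprime, and \<open>k\<close> odd gives \<open>p^k = 2\<close> (mod 3), which with
      \<open>n = 1\<close> forces \<open>l = 2\<close>.\<close>
    define k where "k = multiplicity p n"
    obtain l where l: "n = p ^ k * l" "\<not> p dvd l"
      using multiplicity_decompose'[of n p] assms(1) p(1) unfolding k_def by (metis not_prime_unit not_less_zero)
    have l0: "l > 0" using l assms(1) by (cases l) auto
    have pk3: "p ^ k mod 3 = 2" using power_mod_3 p k_def by simp
    have "n mod 3 = 1" using m1 unfolding m_def by presburger
    then have "(p^k mod 3) * (l mod 3) mod 3 = 1" unfolding l(1) mod_mult_eq .
    moreover have "l mod 3 = 0 \<or> l mod 3 = 1 \<or> l mod 3 = 2" by auto
    ultimately have l3: "l mod 3 = 2" using pk3 by auto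
    have "coprime (p ^ k) l" using p(1) l(2) by (simp add: prime_imp_coprime)
    then have cop: "coprime (int (p ^ k)) (int l)" by (simp only: coprime_int_iff)
    have "odd (int (p ^ k))" using \<open>odd n\<close> l(1) by simp
    moreover have "m = int (p ^ k) * int l" unfolding m_def l(1) by simp
    moreover have "int (p ^ k) > 0" "int l > 0" using l0 p(1) prime_gt_0_nat by simp_all
    moreover have "int (p ^ k) mod 3 = 2" "int l mod 3 = 2" using pk3 l3 by presburger+
    ultimately have "2 * card {q \<in> one_set m. 3 dvd resA q} = card (one_set m)" using residue_balance cop by blast
    then show ?thesis using m1 by (simp add: dvd_eq_mod_eq_0)
  qed
  have "12 * (\<Sum>r \<in> {r. r^2 < m \<and> r mod 3 = c mod 3}. hurwitz (m - r^2)) = (\<Sum>r \<in> {r. r^2 < m \<and> r mod 3 = c mod 3}. real (card (tern (m - r^2))))"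
    unfolding sum_distrib_left by (rule sum.cong[OF refl]) (use hurwitz_eq_ternary sq in auto)
  also have "\<dots> = real (card {q \<in> one_set m. resA q mod 3 = c mod 3})"
    using ternary_residue_count[OF om c2] by (simp only: of_nat_sum[symmetric])
  also have "\<dots> = real_of_int sigma"
  proof -
    \<comment> \<open>The required count is half of \<open>one_set m\<close>, itself a sixth of
      these \<open>12 * sigma\<close> elements.\<close>
    have "int (card (norm_set m)) = 12 * sigma" unfolding sigma_def card_norm_set by (rule card_quat_reps[OF m0 m3])
    then have "int (card {q \<in> one_set m. resA q mod 3 = c mod 3}) = sigma" using card_one_set[OF om] count by linarith
    then show ?thesis by (metis of_int_of_nat_eq)
  qed
  finally show ?thesis unfolding S sig m_def[symmetric] by simp
qed

end
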